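(* Let $\kappa = 4$. Then for every $N\ge 1$ and $\alpha\in\mathrm{LP}_N$, the pure partition function $\mathcal{Z}_\alpha$ can be written as $$\mathcal{Z}_\alpha(x_1, \ldots, x_{2N}) = \sum_{\beta \in \mathrm{LP}_N} \mathcal{M}^{-1}_{\alpha,\beta} \; \mathcal{U}_\beta(x_1, \ldots, x_{2N}), \qquad x_1<\cdots<x_{2N},$$ where $\mathcal{U}_\beta$ are the explicit conformal block functions defined in the context, and the coefficients $\mathcal{M}^{-1}_{\alpha,\beta} \in \mathbb{Z}$ are $$\mathcal{M}^{-1}_{\alpha,\beta}=\begin{cases}(-1)^{|\alpha/\beta|}\,\#\mathcal{C}(\alpha/\beta),&\text{if }\alpha\preceq\beta,\\0,&\text{otherwise.}\end{cases}$$
   Context: Link patterns: $\mathrm{LP}_N$ is the set of planar (non-crossing) pair partitions of $\{1,\ldots,2N\}$ (pairs are links), $\mathrm{LP}_0=\{\emptyset\}$; if $\{j,j+1\}\in\alpha\in\mathrm{LP}_N$, $\alpha/\{j,j+1\}\in\mathrm{LP}_{N-1}$ is obtained by removing this link and relabeling the remaining indices increasingly. Every $\alpha\in\mathrm{LP}_N$ is written as $\alpha=\{\{a_1,b_1\},\ldots,\{a_N,b_N\}\}$ with $a_1<\cdots<a_N$ and $a_j<b_j$ for all $j$. $\mathfrak{X}_{2N}=\{x_1<\cdots<x_{2N}\}\subset\mathbb{R}^{2N}$; $\mathbb{H}$ is the upper half-plane. Pure partition functions with $\kappa=4$: the unique collection of smooth functions $\mathcal{Z}_\alpha:\mathfrak{X}_{2N}\to\mathbb{R}$,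 $\alpha\in\mathrm{LP}_N$, $N\ge0$, with $\mathcal{Z}_\emptyset=1$ such that: (PDE) $\big[2\partial_i^2+\sum_{j\ne i}(\frac{2}{x_j-x_i}\partial_j-\frac{1}{2(x_j-x_i)^2})\big]\mathcal{Z}_\alpha=0$ for all $i$; (COV) $\mathcal{Z}_\alpha(x_1,\ldots,x_{2N})=\prod_i\varphi'(x_i)^{1/4}\mathcal{Z}_\alpha(\varphi(x_1),\ldots,\varphi(x_{2N}))$ for Möbius maps $\varphi$ of $\mathbb{H}$ with $\varphi(x_1)<\cdots<\varphi(x_{2N})$; (ASY) for all $j$ and $\xi\in(x_{j-1},x_{j+2})$ (with $x_0=-\infty$, $x_{2N+1}=+\infty$), $\lim_{x_j,x_{j+1}\to\xi}(x_{j+1}-x_j)^{1/2}\mathcal{Z}_\alpha$ equals $0$ if $\{j,j+1\}\notin\alpha$ and $\mathcal{Z}_{\alpha/\{j,j+1\}}(x_1,\ldots,x_{j-1},x_{j+2},\ldots,x_{2N})$ otherwise; (growth) $|\mathcal{Z}_\alpha|\le C\prod_{i<j}(x_j-x_i)^{\mu_{ij}(p)}$ for some $C,p>0$, with $\mu_{ij}(p)=p$ if $|x_j-x_i|>1$ and $-p$ if $|x_j-x_i|<1$. Conformal blocks: $\mathcal{U}_\alpha(x_1,\ldots,x_{2N})=\prod_{1\le i<j\le2N}(x_j-x_i)^{\frac12\vartheta_\alpha(i,j)}$, where $\vartheta_\alpha(i,j)=+1$ if $i,j\in\{a_1,\ldots,a_N\}$ or $i,j\in\{b_1,\ldots,b_N\}$,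 and $\vartheta_\alpha(i,j)=-1$ otherwise. Dyck paths: $\alpha\in\mathrm{LP}_N$ is identified with the Dyck path $\alpha:\{0,\ldots,2N\}\to\mathbb{Z}_{\ge0}$, $\alpha(0)=0$, $\alpha(k)=\alpha(k-1)+1$ if $k\in\{a_1,\ldots,a_N\}$ and $\alpha(k)=\alpha(k-1)-1$ if $k\in\{b_1,\ldots,b_N\}$. Partial order: $\alpha\preceq\beta$ iff $\alpha(k)\le\beta(k)$ for all $k\in\{0,\ldots,2N\}$. Tilings: for $\alpha\preceq\beta$, the skew Young diagram $\alpha/\beta$ is the region between the two piecewise linear graphs; it is a union of atomic squares, i.e. squares with corners $(x\pm1,m)$, $(x,m\pm1)$ and midpoint $(x,m)$, $x,m\in\mathbb{Z}$, and $|\alpha/\beta|$ is the number of its atomic squares. A Dyck tile $t$ is a non-empty union of atomic squares whose midpoints form a shifted Dyck path: $\{(x_t+i,h_t+\delta(i)):0\le i\le 2n\}$ for some $n\ge0$ and Dyck path $\delta$ of $2n$ steps (a single square if $n=0$); its horizontal extent is $[x_t,x_t+2n]$. A Dyck tiling of $\alpha/\beta$ is a collection of non-overlapping Dyck tiles with union $\alpha/\beta$. A tile $t_1$ covers $t_2$ if $t_1$ contains an atomic square that is an upward vertical translate of an atomic square of $t_2$. A Dyck tiling is cover-inclusive if for any two distinct tiles, either their horizontal extents are disjoint, or the tile that covers the other has horizontal extent contained in that of the other. $\#\mathcal{C}(\alpha/\beta)$ is the number of cover-inclusive Dyck tilings of $\alpha/\beta$, with $\#\mathcal{C}(\alpha/\alpha)=1$.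 (Known fact justifying the notation: these coefficients are the entries of the inverse of the matrix $\mathcal{M}_{\alpha,\beta}=\mathbf{1}\{\alpha\overset{()}{\leftarrow}\beta\}$ on $\mathrm{LP}_N$, where for $\alpha=\{\{a_1,b_1\},\ldots,\{a_N,b_N\}\}$ with $a_1<\cdots<a_N$ and $a_j<b_j$ for all $j$, $\alpha\overset{()}{\leftarrow}\beta$ means that $\beta=\{\{a_1,b_{\sigma(1)}\},\ldots,\{a_N,b_{\sigma(N)}\}\}$ for some permutation $\sigma$ of $\{1,\ldots,N\}$.) *)

theory Defs
  imports "HOL-Analysis.Analysis"
begin

section \<open>Link patterns\<close>

definition link_patterns :: "nat \<Rightarrow> nat set set set" where
  "link_patterns N =
     {\<alpha>. partition_on {1..2*N} \<alpha> \<and> (\<forall>l\<in>\<alpha>. card l = 2) \<and>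
         \<not> (\<exists>a b c d. {a, b} \<in> \<alpha> \<and> {c, d} \<in> \<alpha> \<and> a < c \<and> c < b \<and> b < d)}"

text \<open>In the notation \<open>\<alpha> = {{a\<^sub>1, b\<^sub>1}, \<dots>, {a\<^sub>N, b\<^sub>N}}\<close> with \<open>a\<^sub>j < b\<^sub>j\<close>,
  these are the sets \<open>{a\<^sub>1, \<dots>, a\<^sub>N}\<close> and \<open>{b\<^sub>1, \<dots>, b\<^sub>N}\<close>.\<close>

definition left_ends :: "nat set set \<Rightarrow> nat set" where
  "left_ends \<alpha> = Min ` \<alpha>"

definition right_ends :: "nat set set \<Rightarrow> nat set" where
  "right_ends \<alpha> = Max ` \<alpha>"

text \<open>\<open>\<alpha>/{j,j+1}\<close>\<close>

definition remove_link :: "nat \<Rightarrow> nat set set \<Rightarrow> nat set set" where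
  "remove_link j \<alpha> =
     (\<lambda>l. (\<lambda>k. if k < j then k else k - 2) ` l) ` (\<alpha> - {{j, j + 1}})"


section \<open>Functions on the chamber \<open>x\<^sub>1 < \<dots> < x\<^sub>n\<close>\<close>

text \<open>Since the number of variables varies, a point of \<open>\<real>\<^sup>n\<close> is a function
  \<open>nat \<Rightarrow> real\<close> that is \<open>undefined\<close> outside \<open>{1..n}\<close>; on these functions the product
  topology of \<open>nat \<Rightarrow> real\<close> induces the Euclidean topology of \<open>\<real>\<^sup>n\<close>.\<close>

definition chamber :: "nat \<Rightarrow> (nat \<Rightarrow> real) set" where
  "chamber n = {x \<in> {1..n} \<rightarrow>\<^sub>E UNIV. strict_mono_on {1..n} x}"

definition partial :: "nat \<Rightarrow> ((nat \<Rightarrow> real) \<Rightarrow> real) \<Rightarrow> (nat \<Rightarrow> real) \<Rightarrow> real" where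
  "partial i f x = deriv (\<lambda>t. f (x(i := t))) (x i)"

text \<open>\<open>k\<close> times continuously differentiable on the (open) chamber.\<close>

primrec Ck_on_chamber :: "nat \<Rightarrow> nat \<Rightarrow> ((nat \<Rightarrow> real) \<Rightarrow> real) \<Rightarrow> bool" where
  "Ck_on_chamber n 0 f \<longleftrightarrow> continuous_on (chamber n) f"
| "Ck_on_chamber n (Suc k) f \<longleftrightarrow> continuous_on (chamber n) f \<and>
     (\<forall>i\<in>{1..n}. (\<forall>x\<in>chamber n. (\<lambda>t. f (x(i := t))) differentiable at (x i)) \<and>
                 Ck_on_chamber n k (partial i f))"

definition smooth_on_chamber :: "nat \<Rightarrow> ((nat \<Rightarrow> real) \<Rightarrow> real) \<Rightarrow> bool" where
  "smooth_on_chamber n f \<longleftrightarrow> (\<forall>k. Ck_on_chamber n k f)"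

text \<open>The point \<open>(x\<^sub>1, \<dots>, x\<^sub>j\<^sub>-\<^sub>1, x\<^sub>j\<^sub>+\<^sub>2, \<dots>, x\<^sub>n)\<close>, indexed by \<open>{1..n-2}\<close>.\<close>

definition drop_two :: "nat \<Rightarrow> nat \<Rightarrow> (nat \<Rightarrow> real) \<Rightarrow> (nat \<Rightarrow> real)" where
  "drop_two n j x = (\<lambda>i\<in>{1..n-2}. if i < j then x i else x (i + 2))"


section \<open>Pure partition functions for \<open>\<kappa> = 4\<close>\<close>

definition PDE :: "nat \<Rightarrow> ((nat \<Rightarrow> real) \<Rightarrow> real) \<Rightarrow> bool" where
  "PDE n f \<longleftrightarrow> (\<forall>i\<in>{1..n}. \<forall>x\<in>chamber n.
     2 * partial i (partial i f) x +
     (\<Sum>j\<in>{1..n} - {i}. 2 / (x j - x i) * partial j f x - 1 / (2 * (x j - x i)\<^sup>2) * f x) = 0)"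

text \<open>The Moebius maps of the upper half-plane are \<open>moebius a b c d\<close> with real coefficients and
  positive determinant. As division by zero is total, it has to be required separately that
  no \<open>x\<^sub>i\<close> is mapped to \<open>\<infinity>\<close>.\<close>

definition COV :: "nat \<Rightarrow> ((nat \<Rightarrow> real) \<Rightarrow> real) \<Rightarrow> bool" where
  "COV n f \<longleftrightarrow> (\<forall>a b c d :: real. \<forall>x\<in>chamber n.
     a * d - b * c > 0 \<longrightarrow> (\<forall>i\<in>{1..n}. c * x i + d \<noteq> 0) \<longrightarrow>
     strict_mono_on {1..n} (\<lambda>i. moebius a b c d (x i)) \<longrightarrow>
     f x = (\<Prod>i\<in>{1..n}. deriv (moebius a b c d) (x i) powr (1/4)) *
           f (\<lambda>i\<in>{1..n}. moebius a b c d (x i)))"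

text \<open>\<open>f\<close> is the function with \<open>n\<close> variables, \<open>g\<close> the one with \<open>n - 2\<close> variables (or \<open>0\<close>).
  The limit is a joint one in \<open>(x\<^sub>j, x\<^sub>j\<^sub>+\<^sub>1) = (u, v)\<close>, \<open>u < v\<close>, the other variables being fixed.
  The conditions \<open>1 < j\<close> and \<open>j + 1 < n\<close> account for \<open>x\<^sub>0 = -\<infinity>\<close> and \<open>x\<^sub>n\<^sub>+\<^sub>1 = \<infinity>\<close>.\<close>

definition ASY_at :: "nat \<Rightarrow> nat \<Rightarrow> ((nat \<Rightarrow> real) \<Rightarrow> real) \<Rightarrow> ((nat \<Rightarrow> real) \<Rightarrow> real) \<Rightarrow> bool" where
  "ASY_at n j f g \<longleftrightarrow> (\<forall>x\<in>chamber n. \<forall>\<xi>.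
     (1 < j \<longrightarrow> x (j - 1) < \<xi>) \<longrightarrow> (j + 1 < n \<longrightarrow> \<xi> < x (j + 2)) \<longrightarrow>
     ((\<lambda>(u, v). (v - u) powr (1/2) * f (x(j := u, j + 1 := v))) \<longlongrightarrow> g (drop_two n j x))
       (at (\<xi>, \<xi>) within {(u, v). u < v}))"

definition growth_exponent :: "real \<Rightarrow> real \<Rightarrow> real" where
  "growth_exponent p r = (if \<bar>r\<bar> > 1 then p else - p)"

definition power_law_bound :: "nat \<Rightarrow> ((nat \<Rightarrow> real) \<Rightarrow> real) \<Rightarrow> bool" where
  "power_law_bound n f \<longleftrightarrow> (\<exists>C>0. \<exists>p>0. \<forall>x\<in>chamber n.
     \<bar>f x\<bar> \<le> C * (\<Prod>j\<in>{1..n}. \<Prod>i\<in>{1..<j}. (x j - x i) powr growth_exponent p (x j - x i)))"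

text \<open>A link pattern determines the number of its points, so that a collection
  \<open>(\<Z>\<^sub>\<alpha>)\<close>, \<open>\<alpha> \<in> link_patterns N\<close>, \<open>N \<ge> 0\<close>, is indexed by \<open>\<alpha>\<close> alone.
  Only the values of \<open>\<Z>\<^sub>\<alpha>\<close> on the chamber are relevant.\<close>

definition pure_partition_functions ::
    "(nat set set \<Rightarrow> (nat \<Rightarrow> real) \<Rightarrow> real) \<Rightarrow> bool" where
  "pure_partition_functions Z \<longleftrightarrow>
     (\<forall>x\<in>chamber 0. Z {} x = 1) \<and>
     (\<forall>N. \<forall>\<alpha>\<in>link_patterns N.
        smooth_on_chamber (2*N) (Z \<alpha>) \<and>
        PDE (2*N) (Z \<alpha>) \<and>
        COV (2*N) (Z \<alpha>) \<and>
        (\<forall>j\<in>{1..<2*N}. ASY_at (2*N) j (Z \<alpha>)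
           (if {j, j + 1} \<in> \<alpha> then Z (remove_link j \<alpha>) else (\<lambda>_. 0))) \<and>
        power_law_bound (2*N) (Z \<alpha>))"


section \<open>Conformal blocks\<close>

definition vartheta :: "nat set set \<Rightarrow> nat \<Rightarrow> nat \<Rightarrow> real" where
  "vartheta \<alpha> i j =
     (if i \<in> left_ends \<alpha> \<and> j \<in> left_ends \<alpha> \<or> i \<in> right_ends \<alpha> \<and> j \<in> right_ends \<alpha>
      then 1 else - 1)"

definition conformal_block :: "nat \<Rightarrow> nat set set \<Rightarrow> (nat \<Rightarrow> real) \<Rightarrow> real" where
  "conformal_block N \<alpha> x =
     (\<Prod>j\<in>{1..2*N}. \<Prod>i\<in>{1..<j}. (x j - x i) powr (1/2 * vartheta \<alpha> i j))"


section \<open>Dyck paths and skew Young diagrams\<close>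

definition dyck_path :: "nat \<Rightarrow> (nat \<Rightarrow> int) \<Rightarrow> bool" where
  "dyck_path n \<delta> \<longleftrightarrow>
     \<delta> 0 = 0 \<and> \<delta> (2*n) = 0 \<and> (\<forall>k\<le>2*n. \<delta> k \<ge> 0) \<and> (\<forall>k<2*n. \<bar>\<delta> (Suc k) - \<delta> k\<bar> = 1)"

text \<open>The Dyck path of \<open>\<alpha> \<in> link_patterns N\<close>; only its values on \<open>{0..2*N}\<close> are relevant.\<close>

primrec path_of :: "nat set set \<Rightarrow> nat \<Rightarrow> int" where
  "path_of \<alpha> 0 = 0"
| "path_of \<alpha> (Suc k) = (if Suc k \<in> left_ends \<alpha> then path_of \<alpha> k + 1 else path_of \<alpha> k - 1)"

definition path_le :: "nat \<Rightarrow> nat set set \<Rightarrow> nat set set \<Rightarrow> bool" where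
  "path_le N \<alpha> \<beta> \<longleftrightarrow> (\<forall>k\<in>{0..2*N}. path_of \<alpha> k \<le> path_of \<beta> k)"

text \<open>Atomic squares are represented by their midpoints, regions and tiles by the sets of
  midpoints of their atomic squares. The square with midpoint \<open>(k, m)\<close> lies in the region between
  the graphs iff its corners \<open>(k\<plusminus>1, m)\<close>, \<open>(k, m\<plusminus>1)\<close> do, because both graphs have slopes \<open>\<plusminus>1\<close>.
  Points on the paths have even coordinate sum; the squares forming the region are those
  whose corners are such points, that is, \<open>k + m\<close> is odd.\<close>

definition skew_diagram :: "nat \<Rightarrow> nat set set \<Rightarrow> nat set set \<Rightarrow> (nat \<times> int) set" where
  "skew_diagram N \<alpha> \<beta> = {(k, m). 1 \<le> k \<and> k + 1 \<le> 2*N \<and> odd (int k + m) \<and>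
     path_of \<alpha> (k - 1) \<le> m \<and> m \<le> path_of \<beta> (k - 1) \<and>
     path_of \<alpha> k \<le> m - 1 \<and> m + 1 \<le> path_of \<beta> k \<and>
     path_of \<alpha> (k + 1) \<le> m \<and> m \<le> path_of \<beta> (k + 1)}"


section \<open>Cover-inclusive Dyck tilings\<close>

definition dyck_tile :: "(nat \<times> int) set \<Rightarrow> bool" where
  "dyck_tile t \<longleftrightarrow> (\<exists>n x h \<delta>. dyck_path n \<delta> \<and> t = {(x + i, h + \<delta> i) | i. i \<le> 2*n})"

text \<open>Distinct atomic squares of a skew diagram do not overlap, so non-overlapping tiles are
  disjoint sets of midpoints.\<close>

definition dyck_tiling :: "(nat \<times> int) set \<Rightarrow> (nat \<times> int) set set \<Rightarrow> bool" where
  "dyck_tiling D T \<longleftrightarrow> partition_on D T \<and> (\<forall>t\<in>T. dyck_tile t)"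

text \<open>The integer points of the horizontal extent \<open>[x\<^sub>t, x\<^sub>t + 2n]\<close>, whose endpoints are integers.\<close>

definition extent :: "(nat \<times> int) set \<Rightarrow> nat set" where
  "extent t = fst ` t"

definition covers :: "(nat \<times> int) set \<Rightarrow> (nat \<times> int) set \<Rightarrow> bool" where
  "covers t1 t2 \<longleftrightarrow> (\<exists>k m m'. (k, m) \<in> t1 \<and> (k, m') \<in> t2 \<and> m' < m)"

definition cover_inclusive :: "(nat \<times> int) set set \<Rightarrow> bool" where
  "cover_inclusive T \<longleftrightarrow> (\<forall>t1\<in>T. \<forall>t2\<in>T. t1 \<noteq> t2 \<longrightarrow>
     extent t1 \<inter> extent t2 = {} \<or>
     covers t1 t2 \<and> extent t1 \<subseteq> extent t2 \<or>
     covers t2 t1 \<and> extent t2 \<subseteq> extent t1)"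

definition num_cover_inclusive_tilings :: "nat \<Rightarrow> nat set set \<Rightarrow> nat set set \<Rightarrow> nat" where
  "num_cover_inclusive_tilings N \<alpha> \<beta> =
     card {T. dyck_tiling (skew_diagram N \<alpha> \<beta>) T \<and> cover_inclusive T}"

text \<open>The coefficients \<open>\<M>\<inverse>\<^sub>\<alpha>\<^sub>,\<^sub>\<beta>\<close>\<close>

definition M_inv :: "nat \<Rightarrow> nat set set \<Rightarrow> nat set set \<Rightarrow> int" where
  "M_inv N \<alpha> \<beta> =
     (if path_le N \<alpha> \<beta>
      then (- 1) ^ card (skew_diagram N \<alpha> \<beta>) * int (num_cover_inclusive_tilings N \<alpha> \<beta>)
      else 0)"

end

theory Submission
  imports Defs
begin

text \<open>Let \<open>n = 2 N\<close> and let \<open>V\<close> be the Vandermonde product. Multiplying by \<open>\<surd>V\<close> turns a conformal block into a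
  product of two Vandermonde polynomials, one in the left and one in the right end points. If \<open>\<Z>\<close> solves the
  partial differential equations and is translation invariant, then \<open>H = \<Z> \<surd>V\<close> is a polynomial: in terms of
  Dunkl operators \<open>T\<^sub>i\<close> for the symmetric group (with multiplicity \<open>1\<close>), the equations read \<open>T\<^sub>i\<^sup>2 (H / V) = 0\<close>, and as symmetric
  polynomials in the \<open>T\<^sub>i\<close> act on \<open>H / V\<close> like the corresponding polynomials in the \<open>\<partial>\<^sub>i\<close> act on \<open>H\<close>, all elementary symmetric
  polynomials in the \<open>\<partial>\<^sub>i\<close> annihilate \<open>H\<close>. Hence \<open>\<partial>\<^sub>i\<^sup>n H = 0\<close> and \<open>\<Delta>H = 0\<close>. By Moebius covariance \<open>H\<close> has degree at most
  \<open>N - 1\<close> in \<open>x\<^sub>1\<close>. A harmonic polynomial that vanishes on the walls \<open>x\<^sub>j = x\<^sub>j\<^sub>+\<^sub>1\<close> is antisymmetric, so it vanishes at the \<open>2 N - 1\<close>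
  points \<open>x\<^sub>1 = x\<^sub>k\<close>, which is too many for this degree. So \<open>\<Z>\<^sub>\<alpha>\<close> is determined by its limits at the walls, and it remains to check
  that the coefficients satisfy the matching recursion. It holds for the signed number of cover-inclusive Dyck tilings because a
  single tile at a peak of the upper path can be split off, and a tiling without this tile arises from a unique tiling of a smaller
  diagram by inserting a peak into all tiles of the column.\<close>

section \<open>Calculus on the chamber\<close>

text \<open>Dunkl operators contain reflections, but \<open>Z \<alpha>\<close> is known on one
  chamber only, and only as a smooth function. Extend \<open>F = H / V\<close> symmetrically to all
  chambers. Then \<open>V T\<^sub>k F\<close> involves no reflected values, and in
  \<open>T\<^sub>k\<^sup>2 F\<close> a reflection merely turns \<open>T\<^sub>k F\<close> into
  \<open>T\<^sub>l F\<close>. So all that is used about the \<open>T\<^sub>k\<close> can be stated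
  on the chamber, with partial fractions in place of reflections. The equations
  \<open>T\<^sub>k\<^sup>2 F = 0\<close> kill the power sums of degree at least 2; the first power
  sum is killed by translation invariance, and Newton's relations then give all elementary symmetric
  polynomials. Polynomiality matters twice: it continues \<open>H\<close> beyond the chamber, where
  reflections at the walls make sense, and it turns the final comparison into a count of roots. The
  comparison is between \<open>H\<close> and the linear combination of blocks times
  \<open>\<surd>V\<close>. The latter has to be harmonic, of degree at most \<open>N - 1\<close> in
  the first variable, and equal to \<open>H\<close> on the walls. Its values there are governed by
  patterns with one link less, hence the induction on \<open>N\<close>.\<close>

lemma schwarz_second_order:
  fixes g g1 g2 g12 g21 :: "real \<Rightarrow> real \<Rightarrow> real"
  assumes e: "e > 0"
    and d1: "\<And>s t. \<bar>s - a\<bar> < e \<Longrightarrow> \<bar>t - b\<bar> < e \<Longrightarrow> ((\<lambda>s. g s t) has_real_derivative g1 s t) (at s)"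
    and d2: "\<And>s t. \<bar>s - a\<bar> < e \<Longrightarrow> \<bar>t - b\<bar> < e \<Longrightarrow> ((\<lambda>t. g s t) has_real_derivative g2 s t) (at t)"
    and d12: "\<And>s t. \<bar>s - a\<bar> < e \<Longrightarrow> \<bar>t - b\<bar> < e \<Longrightarrow> ((\<lambda>t. g1 s t) has_real_derivative g12 s t) (at t)"
    and d21: "\<And>s t. \<bar>s - a\<bar> < e \<Longrightarrow> \<bar>t - b\<bar> < e \<Longrightarrow> ((\<lambda>s. g2 s t) has_real_derivative g21 s t) (at s)"
    and c12: "\<And>\<epsilon>. \<epsilon> > 0 \<Longrightarrow> \<exists>\<delta>>0. \<forall>s t. \<bar>s - a\<bar> < \<delta> \<longrightarrow> \<bar>t - b\<bar> < \<delta> \<longrightarrow> \<bar>g12 s t - g12 a b\<bar> < \<epsilon>"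
    and c21: "\<And>\<epsilon>. \<epsilon> > 0 \<Longrightarrow> \<exists>\<delta>>0. \<forall>s t. \<bar>s - a\<bar> < \<delta> \<longrightarrow> \<bar>t - b\<bar> < \<delta> \<longrightarrow> \<bar>g21 s t - g21 a b\<bar> < \<epsilon>"
  shows "g12 a b = g21 a b"
proof -
  have "\<bar>g12 a b - g21 a b\<bar> \<le> \<epsilon>" if \<epsilon>: "\<epsilon> > 0" for \<epsilon>
  proof -
    obtain \<delta>1 where \<delta>1: "\<delta>1 > 0" "\<And>s t. \<bar>s - a\<bar> < \<delta>1 \<Longrightarrow> \<bar>t - b\<bar> < \<delta>1 \<Longrightarrow> \<bar>g12 s t - g12 a b\<bar> < \<epsilon>/2"
      using c12[of "\<epsilon>/2"] \<epsilon> by auto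
    obtain \<delta>2 where \<delta>2: "\<delta>2 > 0" "\<And>s t. \<bar>s - a\<bar> < \<delta>2 \<Longrightarrow> \<bar>t - b\<bar> < \<delta>2 \<Longrightarrow> \<bar>g21 s t - g21 a b\<bar> < \<epsilon>/2"
      using c21[of "\<epsilon>/2"] \<epsilon> by auto
    define h where "h = min e (min \<delta>1 \<delta>2) / 2"
    have h: "h > 0" "h < e" "h < \<delta>1" "h < \<delta>2"
      using e \<delta>1(1) \<delta>2(1) unfolding h_def by auto
    \<comment> \<open>The mixed second difference over a square of side \<open>h\<close>. Two
      applications of the mean value theorem, in either order of the variables, express it through
      \<open>g12\<close> and through \<open>g21\<close>.\<close>
    define Dl where "Dl = g (a+h) (b+h) - g (a+h) b - g a (b+h) + g a b"
    have "\<exists>z>a. z < a + h \<and> (g (a+h) (b+h) - g (a+h) b) - (g a (b+h) - g a b) = (a + h - a) * (g1 z (b+h) - g1 z b)"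
      by (rule MVT2) (use h in \<open>auto intro!: derivative_eq_intros d1\<close>)
    then obtain z where z: "a < z" "z < a + h" "Dl = h * (g1 z (b+h) - g1 z b)"
      unfolding Dl_def by auto
    have "\<exists>w>b. w < b + h \<and> g1 z (b+h) - g1 z b = (b + h - b) * g12 z w"
      by (rule MVT2) (use h z in \<open>auto intro!: derivative_eq_intros d12\<close>)
    then obtain w where w: "b < w" "w < b + h" "g1 z (b+h) - g1 z b = h * g12 z w" by auto
    have "\<exists>w>b. w < b + h \<and> (g (a+h) (b+h) - g a (b+h)) - (g (a+h) b - g a b) = (b + h - b) * (g2 (a+h) w - g2 a w)"
      by (rule MVT2) (use h in \<open>auto intro!: derivative_eq_intros d2\<close>)
    then obtain w' where w': "b < w'" "w' < b + h" "Dl = h * (g2 (a+h) w' - g2 a w')"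
      unfolding Dl_def by auto
    have "\<exists>z>a. z < a + h \<and> g2 (a+h) w' - g2 a w' = (a + h - a) * g21 z w'"
      by (rule MVT2) (use h w' in \<open>auto intro!: derivative_eq_intros d21\<close>)
    then obtain z' where z': "a < z'" "z' < a + h" "g2 (a+h) w' - g2 a w' = h * g21 z' w'" by auto
    have "g12 z w = g21 z' w'" using z w z' w' h by simp
    moreover have "\<bar>g12 z w - g12 a b\<bar> < \<epsilon>/2" using \<delta>1(2)[of z w] z w h by auto
    moreover have "\<bar>g21 z' w' - g21 a b\<bar> < \<epsilon>/2" using \<delta>2(2)[of z' w'] z' w' h by auto
    ultimately show ?thesis by linarith
  qed
  then show ?thesis by (metis abs_le_zero_iff dense_ge eq_iff_diff_eq_0)
qed

lemma chamber_mem_iff: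
  "x \<in> chamber n \<longleftrightarrow> (\<forall>i. i \<notin> {1..n} \<longrightarrow> x i = undefined) \<and> (\<forall>i\<in>{1..n}. \<forall>j\<in>{1..n}. i < j \<longrightarrow> x i < x j)"
  by (auto simp: chamber_def PiE_def extensional_def strict_mono_on_def)

lemma chamber_less: "x \<in> chamber n \<Longrightarrow> i \<in> {1..n} \<Longrightarrow> j \<in> {1..n} \<Longrightarrow> i < j \<Longrightarrow> x i < x j"
  by (auto simp: chamber_mem_iff)

lemma chamber_neq: "x \<in> chamber n \<Longrightarrow> i \<in> {1..n} \<Longrightarrow> j \<in> {1..n} \<Longrightarrow> i \<noteq> j \<Longrightarrow> x i \<noteq> x j"
  by (metis chamber_less less_irrefl linorder_neqE_nat)

lemma chamber_open:
  assumes "x \<in> chamber n"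
  obtains e where "e > 0"
    "\<And>y. (\<And>i. i \<notin> {1..n} \<Longrightarrow> y i = undefined) \<Longrightarrow> (\<And>i. i \<in> {1..n} \<Longrightarrow> \<bar>y i - x i\<bar> < e) \<Longrightarrow> y \<in> chamber n"
proof -
  define S where "S = (\<lambda>(i,j). x j - x i) ` {(i,j). i \<in> {1..n} \<and> j \<in> {1..n} \<and> i < j}"
  have "finite S" unfolding S_def
    by (rule finite_imageI, rule finite_subset[of _ "{1..n} \<times> {1..n}"]) auto
  moreover have "\<forall>s\<in>S. s > 0" using assms unfolding S_def by (auto intro: chamber_less)
  \<comment> \<open>The element 1 keeps the minimum meaningful when there are no pairs, that is for
    \<open>n \<le> 1\<close>. Half the smallest gap is a safe radius because both points of a pair
    may move towards each other.\<close>
  ultimately have m: "Min (insert 1 S) > 0" "\<And>s. s \<in> S \<Longrightarrow> Min (insert 1 S) \<le> s"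
    by auto
  define e where "e = Min (insert 1 S) / 2"
  have "y i < y j" if y: "\<And>i. i \<in> {1..n} \<Longrightarrow> \<bar>y i - x i\<bar> < e" and ij: "i \<in> {1..n}" "j \<in> {1..n}" "i < j" for y :: "nat \<Rightarrow> real" and i j
  proof -
    have "x j - x i \<in> S" using ij unfolding S_def by auto
    then have "2 * e \<le> x j - x i" using m(2) unfolding e_def by auto
    with y[OF ij(1)] y[OF ij(2)] show ?thesis by linarith
  qed
  then show thesis
    by (intro that[of e]) (use m(1) in \<open>auto simp: e_def chamber_mem_iff\<close>)
qed

lemma chamber_update_open:
  assumes "x \<in> chamber n" "i \<in> {1..n}"
  shows "\<forall>\<^sub>F t in nhds (x i). x(i := t) \<in> chamber n"
proof -
  obtain e where e: "e > 0" 
    "\<And>y. (\<And>i. i \<notin> {1..n} \<Longrightarrow> y i = undefined) \<Longrightarrow> (\<And>i. i \<in> {1..n} \<Longrightarrow> \<bar>y i - x i\<bar> < e) \<Longrightarrow> y \<in> chamber n"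
    using chamber_open[OF assms(1)] by metis
  have "x(i := t) \<in> chamber n" if "dist t (x i) < e" for t
    by (rule e(2)) (use assms that e(1) in \<open>auto simp: chamber_mem_iff dist_real_def\<close>)
  then show ?thesis using e(1) by (auto simp: eventually_nhds_metric)
qed

lemma partial_cong:
  assumes "\<And>y. y \<in> chamber n \<Longrightarrow> f y = g y" "x \<in> chamber n" "i \<in> {1..n}"
  shows "partial i f x = partial i g x"
  unfolding partial_def
  by (rule deriv_cong_ev) (auto intro: eventually_mono[OF chamber_update_open[OF assms(2,3)]] assms(1))

lemma differentiable_cong_chamber:
  assumes "\<And>y. y \<in> chamber n \<Longrightarrow> f y = g y" "x \<in> chamber n" "i \<in> {1..n}"
    "(\<lambda>t. f (x(i := t))) differentiable at (x i)"
  shows "(\<lambda>t. g (x(i := t))) differentiable at (x i)"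
proof -
  obtain D where "((\<lambda>t. f (x(i := t))) has_derivative D) (at (x i))"
    using assms(4) unfolding differentiable_def by auto
  then have "((\<lambda>t. g (x(i := t))) has_derivative D) (at (x i))"
    by (rule has_derivative_transform_eventually)
       (use assms in \<open>auto intro: eventually_mono[OF chamber_update_open[OF assms(2,3)]] eventually_nhds_x_imp_x simp: eventually_at_filter\<close>)
  then show ?thesis unfolding differentiable_def by auto
qed

lemma Ck_cong:
  assumes "\<And>y. y \<in> chamber n \<Longrightarrow> f y = g y" "Ck_on_chamber n k f"
  shows "Ck_on_chamber n k g"
  using assms
proof (induction k arbitrary: f g)
  case 0
  then show ?case by (simp cong: continuous_on_cong)
next
  case (Suc k)
  have "Ck_on_chamber n k (partial i g)" if "i \<in> {1..n}" for i
    by (rule Suc.IH[of "partial i f"]) (use Suc.prems that partial_cong[of n f g] in auto)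
  with Suc.prems show ?case
    by (auto cong: continuous_on_cong intro: differentiable_cong_chamber[of n f g])
qed

lemma Ck_imp_cont: "Ck_on_chamber n k f \<Longrightarrow> continuous_on (chamber n) f"
  by (cases k) auto

lemma Ck_Suc_imp: "Ck_on_chamber n (Suc k) f \<Longrightarrow> Ck_on_chamber n k f"
proof (induction k arbitrary: f)
  case (Suc k)
  then show ?case by (metis Ck_on_chamber.simps(2))
qed auto

text \<open>Relational form of a partial derivative. Sum and product rules compose for it without
  side conditions, whereas \<open>partial\<close> is a \<open>deriv\<close> whose existence would
  have to be established anew at every step.\<close>

definition deriv_on :: "nat \<Rightarrow> nat \<Rightarrow> ((nat \<Rightarrow> real) \<Rightarrow> real) \<Rightarrow> ((nat \<Rightarrow> real) \<Rightarrow> real) \<Rightarrow> bool" where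
  "deriv_on n i f f' \<longleftrightarrow> (\<forall>x\<in>chamber n. ((\<lambda>t. f (x(i := t))) has_real_derivative f' x) (at (x i)))"

lemma deriv_on_partial: "deriv_on n i f f' \<Longrightarrow> x \<in> chamber n \<Longrightarrow> partial i f x = f' x"
  unfolding deriv_on_def partial_def by (auto intro: DERIV_imp_deriv)

lemma deriv_onI:
  assumes "\<And>x. x \<in> chamber n \<Longrightarrow> (\<lambda>t. f (x(i := t))) differentiable at (x i)"
  shows "deriv_on n i f (partial i f)"
  using assms unfolding deriv_on_def partial_def
  by (metis DERIV_deriv_iff_real_differentiable)

lemma Ck_SucI:
  assumes "continuous_on (chamber n) f" "\<And>i. i \<in> {1..n} \<Longrightarrow> deriv_on n i f (f' i)"
    "\<And>i. i \<in> {1..n} \<Longrightarrow> Ck_on_chamber n k (f' i)"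
  shows "Ck_on_chamber n (Suc k) f"
proof -
  have "Ck_on_chamber n k (partial i f)" if "i \<in> {1..n}" for i
    by (rule Ck_cong[OF _ assms(3)[OF that]]) (use deriv_on_partial[OF assms(2)] that in auto)
  moreover have "(\<lambda>t. f (x(i := t))) differentiable at (x i)" if "x \<in> chamber n" "i \<in> {1..n}" for x i
    using assms(2) that unfolding deriv_on_def
    unfolding real_differentiable_def by blast
  ultimately show ?thesis using assms(1) by auto
qed

lemma Ck_SucD: "Ck_on_chamber n (Suc k) f \<Longrightarrow> i \<in> {1..n} \<Longrightarrow> deriv_on n i f (partial i f)"
  by (intro deriv_onI) auto

lemma deriv_on_add: "deriv_on n i f f' \<Longrightarrow> deriv_on n i g g' \<Longrightarrow> deriv_on n i (\<lambda>x. f x + g x) (\<lambda>x. f' x + g' x)"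
  unfolding deriv_on_def by (auto intro!: derivative_eq_intros)

lemma deriv_on_minus: "deriv_on n i f f' \<Longrightarrow> deriv_on n i g g' \<Longrightarrow> deriv_on n i (\<lambda>x. f x - g x) (\<lambda>x. f' x - g' x)"
  unfolding deriv_on_def by (auto intro!: derivative_eq_intros)

lemma deriv_on_mult: "deriv_on n i f f' \<Longrightarrow> deriv_on n i g g' \<Longrightarrow> deriv_on n i (\<lambda>x. f x * g x) (\<lambda>x. f' x * g x + f x * g' x)"
  unfolding deriv_on_def by (auto intro!: derivative_eq_intros)

lemma deriv_on_const: "deriv_on n i (\<lambda>x. c) (\<lambda>x. 0)"
  unfolding deriv_on_def by auto

lemma deriv_on_cmult: "deriv_on n i f f' \<Longrightarrow> deriv_on n i (\<lambda>x. c * f x) (\<lambda>x. c * f' x)"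
  using deriv_on_mult[OF deriv_on_const[of n i c]] by auto

lemma deriv_on_sum: "(\<And>k. k \<in> K \<Longrightarrow> deriv_on n i (f k) (f' k)) \<Longrightarrow> deriv_on n i (\<lambda>x. \<Sum>k\<in>K. f k x) (\<lambda>x. \<Sum>k\<in>K. f' k x)"
  unfolding deriv_on_def by (auto intro!: DERIV_sum)

lemma deriv_on_prod:
  assumes "finite K" "\<And>k. k \<in> K \<Longrightarrow> deriv_on n i (f k) (f' k)"
  shows "deriv_on n i (\<lambda>x. \<Prod>k\<in>K. f k x) (\<lambda>x. \<Sum>k\<in>K. f' k x * (\<Prod>l\<in>K-{k}. f l x))"
  using assms
proof (induction K)
  case empty
  then show ?case by (simp add: deriv_on_const)
next
  case (insert a K)
  have "deriv_on n i (\<lambda>x. f a x * (\<Prod>k\<in>K. f k x))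
     (\<lambda>x. f' a x * (\<Prod>k\<in>K. f k x) + f a x * (\<Sum>k\<in>K. f' k x * (\<Prod>l\<in>K-{k}. f l x)))"
    by (rule deriv_on_mult) (use insert in auto)
  moreover have "f a x * (\<Sum>k\<in>K. f' k x * (\<Prod>l\<in>K-{k}. f l x)) = (\<Sum>k\<in>K. f' k x * (\<Prod>l\<in>insert a K-{k}. f l x))" for x
    unfolding sum_distrib_left
  proof (rule sum.cong)
    fix k assume k: "k \<in> K"
    then have "insert a K - {k} = insert a (K - {k})" using insert by auto
    then show "f a x * (f' k x * (\<Prod>l\<in>K-{k}. f l x)) = f' k x * (\<Prod>l\<in>insert a K-{k}. f l x)"
      using insert by simp
  qed simp
  moreover have "insert a K - {a} = K" using insert by auto
  ultimately show ?case using insert by simp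
qed

lemma Ck_const: "Ck_on_chamber n k (\<lambda>x. c)"
proof (induction k arbitrary: c)
  case (Suc k)
  show ?case by (rule Ck_SucI[where f' = "\<lambda>i x. 0"]) (use Suc deriv_on_const in auto)
qed auto

lemma Ck_add: "Ck_on_chamber n k f \<Longrightarrow> Ck_on_chamber n k g \<Longrightarrow> Ck_on_chamber n k (\<lambda>x. f x + g x)"
proof (induction k arbitrary: f g)
  case (Suc k)
  show ?case
    by (rule Ck_SucI[where f' = "\<lambda>i x. partial i f x + partial i g x"])
       (use Suc in \<open>auto intro!: continuous_intros deriv_on_add Ck_SucD Suc.IH intro: Ck_imp_cont simp del: Ck_on_chamber.simps, auto\<close>)
qed (auto intro!: continuous_intros)

lemma Ck_mult: "Ck_on_chamber n k f \<Longrightarrow> Ck_on_chamber n k g \<Longrightarrow> Ck_on_chamber n k (\<lambda>x. f x * g x)"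
proof (induction k arbitrary: f g)
  case (Suc k)
  show ?case
  proof (rule Ck_SucI[where f' = "\<lambda>i x. partial i f x * g x + f x * partial i g x"])
    show "continuous_on (chamber n) (\<lambda>x. f x * g x)"
      using Suc.prems by (auto intro!: continuous_intros)
    fix i assume i: "i \<in> {1..n}"
    show "deriv_on n i (\<lambda>x. f x * g x) (\<lambda>x. partial i f x * g x + f x * partial i g x)"
      by (intro deriv_on_mult Ck_SucD[of n k] Suc.prems i)
    show "Ck_on_chamber n k (\<lambda>x. partial i f x * g x + f x * partial i g x)"
      by (intro Ck_add Suc.IH) (use Suc.prems i Ck_Suc_imp in auto)
  qed
qed (auto intro!: continuous_intros)

lemma smooth_cong: "(\<And>y. y \<in> chamber n \<Longrightarrow> f y = g y) \<Longrightarrow> smooth_on_chamber n f \<Longrightarrow> smooth_on_chamber n g"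
  unfolding smooth_on_chamber_def using Ck_cong[of n f g] by blast

lemma smooth_const: "smooth_on_chamber n (\<lambda>x. c)"
  unfolding smooth_on_chamber_def by (simp add: Ck_const)

lemma smooth_add: "smooth_on_chamber n f \<Longrightarrow> smooth_on_chamber n g \<Longrightarrow> smooth_on_chamber n (\<lambda>x. f x + g x)"
  unfolding smooth_on_chamber_def by (simp add: Ck_add)

lemma smooth_mult: "smooth_on_chamber n f \<Longrightarrow> smooth_on_chamber n g \<Longrightarrow> smooth_on_chamber n (\<lambda>x. f x * g x)"
  unfolding smooth_on_chamber_def by (simp add: Ck_mult)

lemma smooth_cmult: "smooth_on_chamber n f \<Longrightarrow> smooth_on_chamber n (\<lambda>x. c * f x)"
  by (intro smooth_mult smooth_const)

lemma smooth_diff: "smooth_on_chamber n f \<Longrightarrow> smooth_on_chamber n g \<Longrightarrow> smooth_on_chamber n (\<lambda>x. f x - g x)"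
  using smooth_add[OF _ smooth_cmult[of n g "-1"], of f] by simp

lemma smooth_sum: "(\<And>k. k \<in> K \<Longrightarrow> smooth_on_chamber n (f k)) \<Longrightarrow> smooth_on_chamber n (\<lambda>x. \<Sum>k\<in>K. f k x)"
  by (induction K rule: infinite_finite_induct) (auto intro: smooth_add smooth_const)

lemma smooth_prod: "(\<And>k. k \<in> K \<Longrightarrow> smooth_on_chamber n (f k)) \<Longrightarrow> smooth_on_chamber n (\<lambda>x. \<Prod>k\<in>K. f k x)"
  by (induction K rule: infinite_finite_induct) (auto intro: smooth_mult smooth_const)

lemma smooth_deriv_on: "smooth_on_chamber n f \<Longrightarrow> i \<in> {1..n} \<Longrightarrow> deriv_on n i f (partial i f)"
  unfolding smooth_on_chamber_def using Ck_SucD by blast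

lemma smooth_partial: "smooth_on_chamber n f \<Longrightarrow> i \<in> {1..n} \<Longrightarrow> smooth_on_chamber n (partial i f)"
  unfolding smooth_on_chamber_def by (metis Ck_on_chamber.simps(2))

lemma smooth_cont: "smooth_on_chamber n f \<Longrightarrow> continuous_on (chamber n) f"
  unfolding smooth_on_chamber_def using Ck_imp_cont by blast

lemma deriv_on_diff_powr:
  assumes "a \<in> {1..n}" "b \<in> {1..n}" "a < b"
  shows "deriv_on n i (\<lambda>x. (x b - x a) powr s)
     (\<lambda>x. ((if i = b then s else 0) - (if i = a then s else 0)) * (x b - x a) powr (s - 1))"
  using assms chamber_less[of _ n a b] unfolding deriv_on_def
  by (auto intro!: derivative_eq_intros simp: powr_diff)

lemma continuous_on_coordinate: "continuous_on S (\<lambda>x::nat \<Rightarrow> real. x a)"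
  by (rule continuous_on_subset[OF continuous_on_product_coordinates]) simp

lemma smooth_diff_powr:
  assumes "a \<in> {1..n}" "b \<in> {1..n}" "a < b"
  shows "smooth_on_chamber n (\<lambda>x. (x b - x a) powr s)"
proof -
  have cont: "continuous_on (chamber n) (\<lambda>x. (x b - x a) powr s)" for s
    using assms chamber_neq[of _ n b a]
    by (auto intro!: continuous_on_powr continuous_intros continuous_on_coordinate)
  \<comment> \<open>The exponent is generalised because every differentiation lowers it by
    one.\<close>
  have "Ck_on_chamber n k (\<lambda>x. (x b - x a) powr s)" for k
  proof (induction k arbitrary: s)
    case (Suc k)
    show ?case
      by (rule Ck_SucI[OF cont deriv_on_diff_powr[OF assms]]) (use Suc Ck_mult[OF Ck_const] in auto)
  qed (simp add: cont)
  then show ?thesis unfolding smooth_on_chamber_def by auto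
qed

lemma continuous_on_update:
  fixes f :: "'a::topological_space \<Rightarrow> nat \<Rightarrow> real"
  assumes "continuous_on S f" "continuous_on S c"
  shows "continuous_on S (\<lambda>p. (f p)(i := c p))"
proof (rule continuous_on_coordinatewise_then_product)
  show "continuous_on S (\<lambda>p. ((f p)(i := c p)) k)" for k
    by (cases "k = i") (use assms continuous_on_product_then_coordinatewise in auto)
qed

text \<open>Translates continuity in the product topology of \<open>nat \<Rightarrow> real\<close>
  into the two-parameter epsilon-delta form required by \<open>schwarz_second_order\<close> and
  \<open>deriv_diagonal\<close>.\<close>

lemma chamber_section_cont:
  fixes a b :: real and g :: "(nat \<Rightarrow> real) \<Rightarrow> real"
  assumes g: "continuous_on (chamber n) g" and e: "e > 0"
    and yc: "\<And>s t. \<bar>s - a\<bar> < e \<Longrightarrow> \<bar>t - b\<bar> < e \<Longrightarrow> y s t \<in> chamber n"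
    and cont: "continuous_on UNIV (\<lambda>p. y (fst p) (snd p))" and \<epsilon>: "\<epsilon> > 0"
  shows "\<exists>\<delta>>0. \<forall>s t. \<bar>s - a\<bar> < \<delta> \<longrightarrow> \<bar>t - b\<bar> < \<delta> \<longrightarrow> \<bar>g (y s t) - g (y a b)\<bar> < \<epsilon>"
proof -
  define U where "U = {a - e<..<a + e} \<times> {b - e<..<b + e}"
  have "continuous_on U (\<lambda>p. y (fst p) (snd p))"
    using cont continuous_on_subset by blast
  moreover have "(\<lambda>p. y (fst p) (snd p)) ` U \<subseteq> chamber n"
    using yc unfolding U_def by (force simp: abs_less_iff)
  ultimately have "continuous_on U (\<lambda>p. g (y (fst p) (snd p)))"
    using continuous_on_compose2[OF g] by blast
  moreover have "open U" unfolding U_def by (intro open_Times) auto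
  moreover have "(a, b) \<in> U" unfolding U_def using e by auto
  ultimately have "continuous (at (a, b)) (\<lambda>p. g (y (fst p) (snd p)))"
    by (simp add: continuous_on_eq_continuous_at)
  then obtain d where d: "d > 0" "\<And>p. dist p (a, b) < d \<Longrightarrow> dist (g (y (fst p) (snd p))) (g (y a b)) < \<epsilon>"
    using \<epsilon> unfolding continuous_at by (auto simp: tendsto_iff eventually_at dist_commute) (metis dist_self fst_conv snd_conv)
  have "\<bar>g (y s t) - g (y a b)\<bar> < \<epsilon>" if "\<bar>s - a\<bar> < d/2" "\<bar>t - b\<bar> < d/2" for s t
  proof -
    have "dist (s,t) (a, b) \<le> \<bar>s - a\<bar> + \<bar>t - b\<bar>"
      unfolding dist_Pair_Pair by (simp add: dist_real_def sqrt_sum_squares_le_sum_abs)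
    then show ?thesis using d(2)[of "(s,t)"] that by (auto simp: dist_real_def)
  qed
  then show ?thesis using d(1) by (intro exI[of _ "d/2"]) auto
qed

lemma partial_commute:
  assumes f: "smooth_on_chamber n f" and x: "x \<in> chamber n" and ij: "i \<in> {1..n}" "j \<in> {1..n}"
  shows "partial i (partial j f) x = partial j (partial i f) x"
proof (cases "i = j")
  case False
  obtain e where e: "e > 0"
    "\<And>y. (\<And>i. i \<notin> {1..n} \<Longrightarrow> y i = undefined) \<Longrightarrow> (\<And>i. i \<in> {1..n} \<Longrightarrow> \<bar>y i - x i\<bar> < e) \<Longrightarrow> y \<in> chamber n"
    using chamber_open[OF x] by metis
  define y where "y = (\<lambda>s t. x(i := s, j := t))"
  have yc: "y s t \<in> chamber n" if "\<bar>s - x i\<bar> < e" "\<bar>t - x j\<bar> < e" for s t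
    by (rule e(2)) (use that x ij e(1) in \<open>auto simp: y_def chamber_mem_iff\<close>)
  have yx: "y (x i) (x j) = x" by (auto simp: y_def)
  have D1: "((\<lambda>s. g (y s t)) has_real_derivative partial i g (y s t)) (at s)"
    if "smooth_on_chamber n g" "\<bar>s - x i\<bar> < e" "\<bar>t - x j\<bar> < e" for g s t
  proof -
    have "((\<lambda>u. g ((y s t)(i := u))) has_real_derivative partial i g (y s t)) (at (y s t i))"
      using smooth_deriv_on[OF that(1) ij(1)] yc[OF that(2,3)] unfolding deriv_on_def by blast
    moreover have "(y s t)(i := u) = y u t" for u using False by (auto simp: y_def)
    moreover have "y s t i = s" using False by (auto simp: y_def)
    ultimately show ?thesis by simp
  qed
  have D2: "((\<lambda>t. g (y s t)) has_real_derivative partial j g (y s t)) (at t)"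
    if "smooth_on_chamber n g" "\<bar>s - x i\<bar> < e" "\<bar>t - x j\<bar> < e" for g s t
  proof -
    have "((\<lambda>u. g ((y s t)(j := u))) has_real_derivative partial j g (y s t)) (at (y s t j))"
      using smooth_deriv_on[OF that(1) ij(2)] yc[OF that(2,3)] unfolding deriv_on_def by blast
    moreover have "(y s t)(j := u) = y s u" for u using False by (auto simp: y_def)
    moreover have "y s t j = t" using False by (auto simp: y_def)
    ultimately show ?thesis by simp
  qed
  have C: "\<exists>\<delta>>0. \<forall>s t. \<bar>s - x i\<bar> < \<delta> \<longrightarrow> \<bar>t - x j\<bar> < \<delta> \<longrightarrow> \<bar>g (y s t) - g (y (x i) (x j))\<bar> < \<epsilon>"
    if "smooth_on_chamber n g" "\<epsilon> > 0" for g \<epsilon>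
  proof (rule chamber_section_cont[OF smooth_cont[OF that(1)] e(1) yc _ that(2)])
    show "continuous_on UNIV (\<lambda>p. y (fst p) (snd p))"
      unfolding y_def by (intro continuous_on_update continuous_intros)
  qed
  have "partial j (partial i f) (y (x i) (x j)) = partial i (partial j f) (y (x i) (x j))"
    by (rule schwarz_second_order[where e = e and g = "\<lambda>s t. f (y s t)" and ?g1.0 = "\<lambda>s t. partial i f (y s t)"
          and ?g2.0 = "\<lambda>s t. partial j f (y s t)"])
       (intro e(1) D1 D2 C smooth_partial f ij | assumption)+
  then show ?thesis by (simp add: yx)
qed auto


section \<open>Commuting operators\<close>

text \<open>Partial fraction decomposition in \<open>z\<close>: the inner product is the coefficient
  of the simple pole at \<open>x k\<close>. In the induction the pole at the new node
  \<open>x a\<close> is split off each term, and the induction hypothesis is needed both at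
  \<open>z\<close> and at \<open>x a\<close>.\<close>

lemma prod_partial_fractions:
  fixes x :: "'i \<Rightarrow> real"
  assumes "finite S" "S \<noteq> {}" "inj_on x S" "z \<notin> x ` S"
  shows "(\<Sum>k\<in>S. 1 / (x k - z) * (\<Prod>i\<in>S-{k}. 1 / (x i - x k))) = (\<Prod>i\<in>S. 1 / (x i - z))"
  using assms
proof (induction S arbitrary: z rule: finite_ne_induct)
  case (insert a S)
  define c where "c k = (\<Prod>i\<in>S-{k}. 1 / (x i - x k))" for k
  have neq: "x a \<noteq> x k" if "k \<in> S" for k using insert.prems insert.hyps that by (auto simp: inj_on_def)
  have za: "z \<noteq> x a" "\<And>k. k \<in> S \<Longrightarrow> z \<noteq> x k" using insert.prems by auto
  have IHz: "(\<Sum>k\<in>S. 1 / (x k - z) * c k) = (\<Prod>i\<in>S. 1 / (x i - z))"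
    unfolding c_def by (rule insert.IH) (use insert.prems in auto)
  have IHa: "(\<Sum>k\<in>S. 1 / (x k - x a) * c k) = (\<Prod>i\<in>S. 1 / (x i - x a))"
    unfolding c_def by (rule insert.IH) (use insert.prems neq in auto)
  have "(\<Sum>k\<in>insert a S. 1 / (x k - z) * (\<Prod>i\<in>insert a S-{k}. 1 / (x i - x k)))
     = 1 / (x a - z) * (\<Prod>i\<in>S. 1 / (x i - x a)) + (\<Sum>k\<in>S. 1 / (x k - z) * (1 / (x a - x k) * c k))"
  proof -
    have "(\<Prod>i\<in>insert a S-{k}. 1 / (x i - x k)) = 1 / (x a - x k) * c k" if "k \<in> S" for k
    proof -
      have "insert a S - {k} = insert a (S - {k})" using that insert.hyps by auto
      then show ?thesis using insert.hyps by (simp add: c_def)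
    qed
    moreover have "insert a S - {a} = S" using insert.hyps by auto
    ultimately show ?thesis using insert.hyps by (simp add: mult_ac)
  qed
  also have "(\<Sum>k\<in>S. 1 / (x k - z) * (1 / (x a - x k) * c k)) =
      (\<Sum>k\<in>S. 1 / (x a - z) * (1 / (x k - z) * c k) - 1 / (x a - z) * (1 / (x k - x a) * c k))"
  proof (rule sum.cong)
    fix k assume k: "k \<in> S"
    have "1 / (x k - z) * (1 / (x a - x k)) = 1 / (x a - z) * (1 / (x k - z)) - 1 / (x a - z) * (1 / (x k - x a))"
      using neq[OF k] za(1) za(2)[OF k] by (simp add: divide_simps) (simp add: algebra_simps)
    moreover have "p * (q * c') = r * (s * c') - r * (t * c')" if "p * q = r * s - r * t" for p q r s t c' :: real
      using that by algebra
    ultimately show "1 / (x k - z) * (1 / (x a - x k) * c k) = 1 / (x a - z) * (1 / (x k - z) * c k) - 1 / (x a - z) * (1 / (x k - x a) * c k)"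
      by blast
  qed simp
  also have "\<dots> = 1 / (x a - z) * (\<Prod>i\<in>S. 1 / (x i - z)) - 1 / (x a - z) * (\<Prod>i\<in>S. 1 / (x i - x a))"
    by (simp only: sum_subtractf IHz IHa flip: sum_distrib_left)
  finally show ?case using insert.hyps by simp
qed simp

text \<open>The derivative in \<open>z\<close> of \<open>prod_partial_fractions\<close>, obtained
  algebraically by the same induction.\<close>

lemma prod_partial_fractions_deriv:
  fixes x :: "'i \<Rightarrow> real"
  assumes "finite S" "inj_on x S" "z \<notin> x ` S"
  shows "(\<Sum>k\<in>S. 1 / (x k - z)\<^sup>2 * (\<Prod>i\<in>S-{k}. 1 / (x i - x k)))
    = (\<Sum>i\<in>S. 1 / (x i - z)) * (\<Prod>i\<in>S. 1 / (x i - z))"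
  using assms
proof (induction S rule: finite_induct)
  case (insert a S)
  show ?case
  proof (cases "S = {}")
    case False
  define c where "c k = (\<Prod>i\<in>S-{k}. 1 / (x i - x k))" for k
  have neq: "x a \<noteq> x k" if "k \<in> S" for k using insert.prems insert.hyps that by (auto simp: inj_on_def)
  have za: "z \<noteq> x a" "\<And>k. k \<in> S \<Longrightarrow> z \<noteq> x k" using insert.prems by auto
  have IHz: "(\<Sum>k\<in>S. 1 / (x k - z)\<^sup>2 * c k) = (\<Sum>i\<in>S. 1 / (x i - z)) * (\<Prod>i\<in>S. 1 / (x i - z))"
    unfolding c_def by (rule insert.IH) (use insert.prems in auto)
  have Fz: "(\<Sum>k\<in>S. 1 / (x k - z) * c k) = (\<Prod>i\<in>S. 1 / (x i - z))"
    unfolding c_def by (rule prod_partial_fractions) (use insert.prems insert.hyps False in auto)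
  have Fa: "(\<Sum>k\<in>S. 1 / (x k - x a) * c k) = (\<Prod>i\<in>S. 1 / (x i - x a))"
    unfolding c_def by (rule prod_partial_fractions) (use insert.prems insert.hyps neq False in auto)
  have "(\<Sum>k\<in>insert a S. 1 / (x k - z)\<^sup>2 * (\<Prod>i\<in>insert a S-{k}. 1 / (x i - x k)))
     = 1 / (x a - z)\<^sup>2 * (\<Prod>i\<in>S. 1 / (x i - x a)) + (\<Sum>k\<in>S. 1 / (x k - z)\<^sup>2 * (1 / (x a - x k) * c k))"
  proof -
    have "(\<Prod>i\<in>insert a S-{k}. 1 / (x i - x k)) = 1 / (x a - x k) * c k" if "k \<in> S" for k
    proof -
      have "insert a S - {k} = insert a (S - {k})" using that insert.hyps by auto
      then show ?thesis using insert.hyps by (simp add: c_def)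
    qed
    moreover have "insert a S - {a} = S" using insert.hyps by auto
    ultimately show ?thesis using insert.hyps by (simp add: mult_ac)
  qed
  also have "(\<Sum>k\<in>S. 1 / (x k - z)\<^sup>2 * (1 / (x a - x k) * c k)) =
      (\<Sum>k\<in>S. 1 / (x a - z) * (1 / (x k - z)\<^sup>2 * c k) + 1 / (x a - z)\<^sup>2 * (1 / (x k - z) * c k)
        - 1 / (x a - z)\<^sup>2 * (1 / (x k - x a) * c k))"
  proof (rule sum.cong)
    fix k assume k: "k \<in> S"
    have "1 / u\<^sup>2 * (1 / (w - u)) = 1 / w * (1 / u\<^sup>2) + 1 / w\<^sup>2 * (1 / u) - 1 / w\<^sup>2 * (1 / (u - w))"
      if "u \<noteq> 0" "w \<noteq> 0" "u \<noteq> w" for u w :: real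
      using that by (simp add: divide_simps) (simp add: algebra_simps power2_eq_square)
    from this[of "x k - z" "x a - z"]
    have "1 / (x k - z)\<^sup>2 * (1 / (x a - x k)) = 1 / (x a - z) * (1 / (x k - z)\<^sup>2) + 1 / (x a - z)\<^sup>2 * (1 / (x k - z)) - 1 / (x a - z)\<^sup>2 * (1 / (x k - x a))"
      using neq[OF k] za(1) za(2)[OF k] by simp
    moreover have "p * (q * c') = r * (s * c') + v * (t * c') - v * (w * c')" if "p * q = r * s + v * t - v * w" for p q r s t v w c' :: real
      using that by algebra
    ultimately show "1 / (x k - z)\<^sup>2 * (1 / (x a - x k) * c k) = 1 / (x a - z) * (1 / (x k - z)\<^sup>2 * c k) + 1 / (x a - z)\<^sup>2 * (1 / (x k - z) * c k)
        - 1 / (x a - z)\<^sup>2 * (1 / (x k - x a) * c k)"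
      by blast
  qed simp
  also have "\<dots> = 1 / (x a - z) * ((\<Sum>i\<in>S. 1 / (x i - z)) * (\<Prod>i\<in>S. 1 / (x i - z)))
       + 1 / (x a - z)\<^sup>2 * (\<Prod>i\<in>S. 1 / (x i - z)) - 1 / (x a - z)\<^sup>2 * (\<Prod>i\<in>S. 1 / (x i - x a))"
    by (simp only: sum_subtractf sum.distrib IHz Fz Fa flip: sum_distrib_left)
  finally show ?thesis using insert.hyps by (simp add: algebra_simps power2_eq_square)
  qed (use insert in \<open>simp add: power2_eq_square\<close>)
qed simp

text \<open>With at least two poles the product of the \<open>1 / (x i - z)\<close> decays at least
  quadratically at infinity, so its residues add up to zero. Formally, one node is singled out and
  takes the role of \<open>z\<close>.\<close>

lemma sum_prod_inverse_diff_eq_0: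
  fixes x :: "'i \<Rightarrow> real"
  assumes "finite S" "card S \<ge> 2" "inj_on x S"
  shows "(\<Sum>k\<in>S. \<Prod>i\<in>S-{k}. 1 / (x i - x k)) = 0"
proof -
  obtain a where a: "a \<in> S" using assms by fastforce
  define S' where "S' = S - {a}"
  have S: "S = insert a S'" "a \<notin> S'" "finite S'"
    using a assms(1) unfolding S'_def by auto
  moreover have "S' \<noteq> {}" using assms(2) S by auto
  ultimately have S: "S = insert a S'" "a \<notin> S'" "finite S'" "S' \<noteq> {}" by blast+
  have "(\<Prod>i\<in>S-{k}. 1 / (x i - x k)) = - (1 / (x k - x a) * (\<Prod>i\<in>S'-{k}. 1 / (x i - x k)))" if "k \<in> S'" for k
  proof -
    have "S - {k} = insert a (S' - {k})" using that S by auto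
    then have "(\<Prod>i\<in>S-{k}. 1 / (x i - x k)) = 1 / (x a - x k) * (\<Prod>i\<in>S'-{k}. 1 / (x i - x k))" using S by simp
    moreover have "1 / (x a - x k) = - (1 / (x k - x a))" by (metis minus_diff_eq minus_divide_right)
    ultimately show ?thesis by simp
  qed
  then have "(\<Sum>k\<in>S. \<Prod>i\<in>S-{k}. 1 / (x i - x k)) = (\<Prod>i\<in>S'. 1 / (x i - x a)) - (\<Sum>k\<in>S'. 1 / (x k - x a) * (\<Prod>i\<in>S'-{k}. 1 / (x i - x k)))"
    using S by (simp add: sum_negf)
  also have "\<dots> = 0"
  proof -
    have "inj_on x S'" "x a \<notin> x ` S'" using S assms(3) by (auto simp: inj_on_def)
    then show ?thesis using prod_partial_fractions[of S' x "x a"] S by simp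
  qed
  finally show ?thesis .
qed

lemma sum_antisymmetric:
  fixes f :: "'i \<Rightarrow> 'i \<Rightarrow> real"
  assumes "finite S" "\<And>i j. f i j = - f j i"
  shows "(\<Sum>i\<in>S. \<Sum>j\<in>S-{i}. f i j) = 0"
proof -
  have "f i i = 0" for i using assms(2)[of i i] by simp
  then have e: "(\<Sum>i\<in>S. \<Sum>j\<in>S-{i}. f i j) = (\<Sum>i\<in>S. \<Sum>j\<in>S. f i j)"
    using assms(1) by (simp add: sum_diff1)
  have "(\<Sum>i\<in>S. \<Sum>j\<in>S. f i j) = (\<Sum>j\<in>S. \<Sum>i\<in>S. f i j)" by (rule sum.swap)
  also have "\<dots> = (\<Sum>i\<in>S. \<Sum>j\<in>S. - f i j)"
    using assms(2) by (metis (no_types, lifting) sum.cong)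
  finally show ?thesis using e by (simp add: sum_negf)
qed

text \<open>\<open>lam - \<partial>\<^sub>i\<close>, cut off to \<open>0\<close> outside the chamber and on functions that are not smooth, so that
  these operators commute without side conditions.\<close>

definition opL :: "nat \<Rightarrow> real \<Rightarrow> nat \<Rightarrow> ((nat \<Rightarrow> real) \<Rightarrow> real) \<Rightarrow> (nat \<Rightarrow> real) \<Rightarrow> real" where
  "opL n lam i f = (\<lambda>x. if smooth_on_chamber n f \<and> x \<in> chamber n \<and> i \<in> {1..n} then lam * f x - partial i f x else 0)"

lemma opL_eq: "smooth_on_chamber n f \<Longrightarrow> x \<in> chamber n \<Longrightarrow> i \<in> {1..n} \<Longrightarrow> opL n lam i f x = lam * f x - partial i f x"
  by (simp add: opL_def)

lemma opL_outside: "x \<notin> chamber n \<Longrightarrow> opL n lam i f x = 0"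
  by (simp add: opL_def)

lemma smooth_opL: "smooth_on_chamber n (opL n lam i f)"
proof (cases "smooth_on_chamber n f \<and> i \<in> {1..n}")
  case True
  then have "smooth_on_chamber n (\<lambda>x. lam * f x - partial i f x)"
    by (intro smooth_diff smooth_cmult smooth_partial) auto
  then show ?thesis by (rule smooth_cong[rotated]) (use True in \<open>auto simp: opL_def\<close>)
next
  case False
  then have "opL n lam i f = (\<lambda>x. 0)" by (auto simp: opL_def fun_eq_iff)
  then show ?thesis by (simp add: smooth_const)
qed

lemma opL_cong:
  assumes "\<And>x. x \<in> chamber n \<Longrightarrow> f x = g x"
  shows "opL n lam i f = opL n lam i g"
proof
  fix x
  have "smooth_on_chamber n f \<longleftrightarrow> smooth_on_chamber n g"
    using smooth_cong[of n f g] smooth_cong[of n g f] assms by auto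
  then show "opL n lam i f x = opL n lam i g x"
    using partial_cong[of n f g] assms unfolding opL_def by auto
qed

lemma opL_partial:
  assumes "smooth_on_chamber n f" "i \<in> {1..n}" "deriv_on n i f f'" "x \<in> chamber n"
  shows "opL n lam i f x = lam * f x - f' x"
  using assms deriv_on_partial by (simp add: opL_eq)

text \<open>Products over index sets are formed with \<open>Finite_Set.fold\<close>, which calls for
  commutation on all functions and all indices. In the degenerate cases the cut-offs make both sides
  zero.\<close>

lemma opL_commute: "opL n lam i (opL n mu j f) = opL n mu j (opL n lam i f)"
proof (cases "smooth_on_chamber n f \<and> i \<in> {1..n} \<and> j \<in> {1..n}")
  case True
  have *: "opL n lam i (opL n mu j f) x = lam * (mu * f x - partial j f x) - (mu * partial i f x - partial i (partial j f) x)"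
    if x: "x \<in> chamber n" and ij: "i \<in> {1..n}" "j \<in> {1..n}" for x i j lam mu
  proof -
    have "opL n lam i (opL n mu j f) = opL n lam i (\<lambda>x. mu * f x - partial j f x)"
      by (rule opL_cong) (use True ij in \<open>auto simp: opL_eq\<close>)
    moreover have "deriv_on n i (\<lambda>x. mu * f x - partial j f x) (\<lambda>x. mu * partial i f x - partial i (partial j f) x)"
      using True ij by (intro deriv_on_minus deriv_on_cmult smooth_deriv_on smooth_partial) auto
    moreover have "smooth_on_chamber n (\<lambda>x. mu * f x - partial j f x)"
      using True ij by (intro smooth_diff smooth_cmult smooth_partial) auto
    ultimately show ?thesis using x ij by (simp add: opL_partial)
  qed
  show ?thesis
  proof
    fix x
    show "opL n lam i (opL n mu j f) x = opL n mu j (opL n lam i f) x"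
    proof (cases "x \<in> chamber n")
      case x: True
      show ?thesis using True *[OF x, of i j lam mu] *[OF x, of j i mu lam] partial_commute[of n f x i j] x
        by (simp add: algebra_simps)
    qed (simp add: opL_outside)
  qed
next
  case False
  have z: "opL n mu k (\<lambda>x. 0) = (\<lambda>x. 0)" for mu k
    unfolding opL_def by (auto simp: fun_eq_iff partial_def)
  have nz: "opL n mu k f = (\<lambda>x. 0)" if "\<not> (smooth_on_chamber n f \<and> k \<in> {1..n})" for mu k f
    using that unfolding opL_def by (auto simp: fun_eq_iff)
  show ?thesis
  proof (cases "smooth_on_chamber n f")
    case True
    then have "i \<notin> {1..n} \<or> j \<notin> {1..n}" using False by auto
    then show ?thesis using nz z by metis
  next
    case False
    then show ?thesis using nz z by metis
  qed
qed

lemma opL_sum: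
  assumes "\<And>k. k \<in> K \<Longrightarrow> smooth_on_chamber n (f k)"
  shows "opL n lam i (\<lambda>x. \<Sum>k\<in>K. f k x) = (\<lambda>x. \<Sum>k\<in>K. opL n lam i (f k) x)"
proof
  fix x
  show "opL n lam i (\<lambda>x. \<Sum>k\<in>K. f k x) x = (\<Sum>k\<in>K. opL n lam i (f k) x)"
  proof (cases "x \<in> chamber n \<and> i \<in> {1..n}")
    case True
    have "opL n lam i (\<lambda>x. \<Sum>k\<in>K. f k x) x = lam * (\<Sum>k\<in>K. f k x) - (\<Sum>k\<in>K. partial i (f k) x)"
      by (rule opL_partial) (use True assms in \<open>auto intro!: smooth_sum deriv_on_sum smooth_deriv_on\<close>)
    also have "\<dots> = (\<Sum>k\<in>K. opL n lam i (f k) x)"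
      using True assms by (simp add: opL_eq sum_subtractf sum_distrib_left)
    finally show ?thesis .
  qed (auto simp: opL_def)
qed

lemma opL_cmult:
  assumes "smooth_on_chamber n f"
  shows "opL n lam i (\<lambda>x. c * f x) = (\<lambda>x. c * opL n lam i f x)"
proof
  fix x
  show "opL n lam i (\<lambda>x. c * f x) x = c * opL n lam i f x"
  proof (cases "x \<in> chamber n \<and> i \<in> {1..n}")
    case True
    have "opL n lam i (\<lambda>x. c * f x) x = lam * (c * f x) - c * partial i f x"
      by (rule opL_partial) (use True assms in \<open>auto intro!: smooth_cmult deriv_on_cmult smooth_deriv_on\<close>)
    then show ?thesis
      using True assms by (simp add: opL_eq algebra_simps)
  qed (auto simp: opL_def)
qed

text \<open>The composition of the operators \<open>lam - \<partial>\<^sub>i\<close> over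
  \<open>i \<in> S\<close>. For \<open>lam = 0\<close> it is the product of the
  \<open>- \<partial>\<^sub>i\<close>, so sums of \<open>opLs n 0 T\<close> over all
  \<open>T\<close> of a given size are elementary symmetric polynomials up to sign.\<close>

definition opLs :: "nat \<Rightarrow> real \<Rightarrow> nat set \<Rightarrow> ((nat \<Rightarrow> real) \<Rightarrow> real) \<Rightarrow> (nat \<Rightarrow> real) \<Rightarrow> real" where
  "opLs n lam S f = Finite_Set.fold (opL n lam) f S"

lemma comp_fun_commute_opL: "comp_fun_commute (opL n lam)"
  by standard (auto simp: fun_eq_iff opL_commute)

lemma opLs_empty [simp]: "opLs n lam {} f = f"
  by (simp add: opLs_def)

lemma opLs_insert: "finite S \<Longrightarrow> i \<notin> S \<Longrightarrow> opLs n lam (insert i S) f = opL n lam i (opLs n lam S f)"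
  unfolding opLs_def by (rule comp_fun_commute_on.fold_insert[of UNIV]) (use comp_fun_commute_opL in \<open>auto simp: comp_fun_commute_def'\<close>)

lemma opLs_insert2: "finite S \<Longrightarrow> i \<notin> S \<Longrightarrow> opLs n lam (insert i S) f = opLs n lam S (opL n lam i f)"
  unfolding opLs_def by (rule comp_fun_commute_on.fold_insert2[of UNIV]) (use comp_fun_commute_opL in \<open>auto simp: comp_fun_commute_def'\<close>)

lemma smooth_opLs: "finite S \<Longrightarrow> smooth_on_chamber n f \<Longrightarrow> smooth_on_chamber n (opLs n lam S f)"
  by (induction S rule: finite_induct) (auto simp: opLs_insert smooth_opL)

lemma opLs_sum:
  assumes "finite S" "\<And>k. k \<in> K \<Longrightarrow> smooth_on_chamber n (f k)"
  shows "opLs n lam S (\<lambda>x. \<Sum>k\<in>K. f k x) = (\<lambda>x. \<Sum>k\<in>K. opLs n lam S (f k) x)"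
  using assms(1)
proof (induction S rule: finite_induct)
  case (insert i S)
  have "opLs n lam (insert i S) (\<lambda>x. \<Sum>k\<in>K. f k x) = opL n lam i (\<lambda>x. \<Sum>k\<in>K. opLs n lam S (f k) x)"
    using insert by (simp add: opLs_insert)
  also have "\<dots> = (\<lambda>x. \<Sum>k\<in>K. opL n lam i (opLs n lam S (f k)) x)"
    by (rule opL_sum) (use insert assms(2) smooth_opLs in auto)
  finally show ?case using insert by (simp add: opLs_insert)
qed simp

lemma opLs_cmult:
  assumes "finite S" "smooth_on_chamber n f"
  shows "opLs n lam S (\<lambda>x. c * f x) = (\<lambda>x. c * opLs n lam S f x)"
  using assms(1)
  by (induction S rule: finite_induct) (use assms(2) in \<open>auto simp: opLs_insert opL_cmult smooth_opLs\<close>)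

text \<open>The product is expanded in powers of \<open>lam\<close>; this makes it a generating
  function of elementary symmetric operators.\<close>

lemma opLs_expand:
  assumes S: "finite S" "S \<subseteq> {1..n}" and f: "smooth_on_chamber n f" and x: "x \<in> chamber n"
  shows "opLs n lam S f x = (\<Sum>T\<in>Pow S. lam ^ (card S - card T) * opLs n 0 T f x)"
  using S x
proof (induction S arbitrary: x rule: finite_induct)
  case (insert i S)
  have fin: "finite T" if "T \<in> Pow S" for T using that insert.hyps finite_subset by auto
  have i: "i \<in> {1..n}" and S: "S \<subseteq> {1..n}" using insert by auto
  have "opLs n lam (insert i S) f x = opL n lam i (\<lambda>x. \<Sum>T\<in>Pow S. lam ^ (card S - card T) * opLs n 0 T f x) x"
    using insert opL_cong[of n "opLs n lam S f"] by (simp add: opLs_insert)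
  also have "\<dots> = (\<Sum>T\<in>Pow S. lam ^ (card S - card T) * opL n lam i (opLs n 0 T f) x)"
    using opL_sum[of "Pow S" n "\<lambda>T x. lam ^ (card S - card T) * opLs n 0 T f x"] fin f
    by (simp add: smooth_cmult smooth_opLs opL_cmult)
  also have "\<dots> = (\<Sum>T\<in>Pow S. lam ^ (card (insert i S) - card T) * opLs n 0 T f x + lam ^ (card (insert i S) - card (insert i T)) * opLs n 0 (insert i T) f x)"
  proof (rule sum.cong)
    fix T assume T: "T \<in> Pow S"
    then have "card T \<le> card S" "i \<notin> T" using insert.hyps by (auto intro: card_mono)
    moreover have "opL n lam i (opLs n 0 T f) x = lam * opLs n 0 T f x + opLs n 0 (insert i T) f x"
      using smooth_opLs[OF fin[OF T] f] insert.prems fin[OF T] \<open>i \<notin> T\<close> i by (simp add: opLs_insert opL_eq)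
    ultimately show "lam ^ (card S - card T) * opL n lam i (opLs n 0 T f) x = lam ^ (card (insert i S) - card T) * opLs n 0 T f x + lam ^ (card (insert i S) - card (insert i T)) * opLs n 0 (insert i T) f x"
      using insert.hyps fin[OF T] by (simp add: Suc_diff_le algebra_simps)
  qed simp
  also have "\<dots> = (\<Sum>T\<in>Pow (insert i S). lam ^ (card (insert i S) - card T) * opLs n 0 T f x)"
  proof -
    have "inj_on (insert i) (Pow S)" using insert.hyps by (auto simp: inj_on_def)
    moreover have "Pow S \<inter> insert i ` Pow S = {}" using insert.hyps by auto
    ultimately show ?thesis
      using insert.hyps by (simp add: Pow_insert sum.union_disjoint sum.reindex sum.distrib o_def)
  qed
  finally show ?case .
qed simp


section \<open>The null-state equations and elementary symmetric operators\<close>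

lemma sum_offdiag_swap:
  assumes "finite S"
  shows "(\<Sum>k\<in>S. \<Sum>l\<in>S-{k}. f k l) = (\<Sum>l\<in>S. \<Sum>k\<in>S-{l}. f k l)"
proof -
  have "S - {k} = {l. l \<in> S \<and> k \<noteq> l}" "S - {k} = {l. l \<in> S \<and> l \<noteq> k}" for k by auto
  then show ?thesis using sum.swap_restrict[OF assms assms, of f "\<lambda>k l. k \<noteq> l"] by simp
qed

lemma smooth_inverse_diff:
  assumes "i \<in> {1..n}" "k \<in> {1..n}" "i \<noteq> k"
  shows "smooth_on_chamber n (\<lambda>x. 1 / (x i - x k))"
proof (cases "i < k")
  case True
  show ?thesis
  proof (rule smooth_cong)
    show "smooth_on_chamber n (\<lambda>x. (-1) * (x k - x i) powr (-1))"
      using assms True by (intro smooth_cmult smooth_diff_powr)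
    show "(-1) * (y k - y i) powr (-1) = 1 / (y i - y k)" if "y \<in> chamber n" for y
      using chamber_less[OF that assms(1,2) True] by (simp add: powr_minus divide_simps)
  qed
next
  case False
  then have "k < i" using assms by auto
  show ?thesis
  proof (rule smooth_cong)
    show "smooth_on_chamber n (\<lambda>x. (x i - x k) powr (-1))"
      using assms \<open>k < i\<close> by (intro smooth_diff_powr)
    show "(y i - y k) powr (-1) = 1 / (y i - y k)" if "y \<in> chamber n" for y
      using chamber_less[OF that assms(2,1) \<open>k < i\<close>] by (simp add: powr_minus divide_simps)
  qed
qed

lemma deriv_on_inverse_diff:
  assumes "i \<in> {1..n}" "k \<in> {1..n}" "i \<noteq> k"
  shows "deriv_on n k (\<lambda>x. 1 / (x i - x k)) (\<lambda>x. (1 / (x i - x k))\<^sup>2)"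
  using assms chamber_neq[of _ n i k] unfolding deriv_on_def
  by (auto intro!: derivative_eq_intros simp: power2_eq_square)

lemma opL_mult:
  assumes "smooth_on_chamber n f" "smooth_on_chamber n r" "deriv_on n i r r'" "x \<in> chamber n" "i \<in> {1..n}"
  shows "opL n lam i (\<lambda>x. f x * r x) x = r x * opL n lam i f x - r' x * f x"
proof -
  have "opL n lam i (\<lambda>x. f x * r x) x = lam * (f x * r x) - (partial i f x * r x + f x * r' x)"
    by (rule opL_partial) (use assms in \<open>auto intro!: smooth_mult deriv_on_mult smooth_deriv_on\<close>)
  then show ?thesis using assms by (simp add: opL_eq algebra_simps)
qed

lemma opLs_add:
  assumes "finite S" "smooth_on_chamber n f" "smooth_on_chamber n g"
  shows "opLs n lam S (\<lambda>x. f x + g x) = (\<lambda>x. opLs n lam S f x + opLs n lam S g x)"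
  using opLs_sum[OF assms(1), of "UNIV :: bool set" n "\<lambda>b. if b then f else g" lam] assms(2,3)
  by (simp add: UNIV_bool add.commute)

text \<open>The chamber version of \<open>T\<^sub>k\<^sup>2 F = 0\<close> for
  \<open>F = H / V\<close> extended symmetrically, where \<open>T\<^sub>k F\<close> is
  \<open>\<partial>\<^sub>k F\<close> plus the sum over \<open>l\<close> of
  \<open>(F - s\<^sub>k\<^sub>l F) / (x\<^sub>k - x\<^sub>l)\<close>. By symmetry
  \<open>T\<^sub>k F = \<partial>\<^sub>k F\<close>, and \<open>A k\<close> is \<open>V\<close>
  times this function. As \<open>s\<^sub>k\<^sub>l\<close> exchanges \<open>T\<^sub>k F\<close> and
  \<open>T\<^sub>l F\<close>, the second application of \<open>T\<^sub>k\<close> gives zero exactly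
  if \<open>partial_A\<close> holds.\<close>

locale null_system =
  fixes n :: nat and H :: "(nat \<Rightarrow> real) \<Rightarrow> real" and A :: "nat \<Rightarrow> (nat \<Rightarrow> real) \<Rightarrow> real"
  assumes smooth_H: "smooth_on_chamber n H"
    and smooth_A: "\<And>k. k \<in> {1..n} \<Longrightarrow> smooth_on_chamber n (A k)"
    and A_eq: "\<And>x k. x \<in> chamber n \<Longrightarrow> k \<in> {1..n} \<Longrightarrow>
       A k x = partial k H x - (\<Sum>l\<in>{1..n}-{k}. 1 / (x k - x l)) * H x"
    and partial_A: "\<And>x k. x \<in> chamber n \<Longrightarrow> k \<in> {1..n} \<Longrightarrow>
       partial k (A k) x = (\<Sum>l\<in>{1..n}-{k}. A l x / (x k - x l))"
    and translation: "\<And>x. x \<in> chamber n \<Longrightarrow> (\<Sum>k\<in>{1..n}. partial k H x) = 0"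
begin

text \<open>This is \<open>V (lam + T\<^sub>k) F\<close>. Because
  \<open>T\<^sub>k\<^sup>2 F = 0\<close>, the operator \<open>lam - T\<^sub>k\<close> sends
  \<open>(lam + T\<^sub>k) F\<close> to \<open>lam\<^sup>2 F\<close>; in terms of
  \<open>\<partial>\<^sub>k\<close> this becomes \<open>opL_Q\<close>, with an additional sum that
  comes from the reflections.\<close>

definition Q :: "real \<Rightarrow> nat \<Rightarrow> (nat \<Rightarrow> real) \<Rightarrow> real" where
  "Q lam k = (\<lambda>x. lam * H x + A k x)"

text \<open>The weight is the partial fraction coefficient at \<open>x k\<close> for the node set
  \<open>S\<close>. The value 0 outside the chamber turns identities on the chamber into equalities
  of functions, to which \<open>opLs\<close> can be applied.\<close>

definition q :: "real \<Rightarrow> nat set \<Rightarrow> nat \<Rightarrow> (nat \<Rightarrow> real) \<Rightarrow> real" where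
  "q lam S k x = (if x \<in> chamber n then Q lam k x * (\<Prod>i\<in>S-{k}. 1 / (x i - x k)) else 0)"

lemma smooth_Q: "k \<in> {1..n} \<Longrightarrow> smooth_on_chamber n (Q lam k)"
  unfolding Q_def by (intro smooth_add smooth_cmult smooth_H smooth_A)

lemma smooth_q:
  assumes "S \<subseteq> {1..n}" "k \<in> {1..n}"
  shows "smooth_on_chamber n (q lam S k)"
proof (rule smooth_cong)
  show "smooth_on_chamber n (\<lambda>x. Q lam k x * (\<Prod>i\<in>S-{k}. 1 / (x i - x k)))"
    using assms by (intro smooth_mult smooth_Q smooth_prod smooth_inverse_diff) auto
qed (auto simp: q_def)

lemma opL_Q:
  assumes "x \<in> chamber n" "k \<in> {1..n}"
  shows "opL n lam k (Q lam k) x = lam\<^sup>2 * H x - (\<Sum>l\<in>{1..n}-{k}. Q lam l x / (x k - x l))"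
proof -
  have "opL n lam k (Q lam k) x = lam * Q lam k x - (lam * partial k H x + partial k (A k) x)"
    by (rule opL_partial[OF smooth_Q _ _ assms(1)])
       (use assms smooth_H smooth_A in \<open>auto simp: Q_def intro!: deriv_on_add deriv_on_cmult smooth_deriv_on\<close>)
  also have "\<dots> = lam\<^sup>2 * H x - (lam * ((\<Sum>l\<in>{1..n}-{k}. 1 / (x k - x l)) * H x) + (\<Sum>l\<in>{1..n}-{k}. A l x / (x k - x l)))"
  proof -
    have "partial k H x = A k x + (\<Sum>l\<in>{1..n}-{k}. 1 / (x k - x l)) * H x" using A_eq[OF assms] by simp
    then show ?thesis unfolding partial_A[OF assms] Q_def by (simp only: power2_eq_square) (simp add: algebra_simps)
  qed
  also have "lam * ((\<Sum>l\<in>{1..n}-{k}. 1 / (x k - x l)) * H x) + (\<Sum>l\<in>{1..n}-{k}. A l x / (x k - x l))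
      = (\<Sum>l\<in>{1..n}-{k}. Q lam l x / (x k - x l))"
    by (simp add: Q_def add_divide_distrib sum.distrib sum_distrib_left sum_distrib_right)
  finally show ?thesis .
qed

lemma opL_q:
  assumes "x \<in> chamber n" "k \<in> S" "S \<subseteq> {1..n}"
  shows "opL n lam k (q lam S k) x =
    (\<Prod>i\<in>S-{k}. 1 / (x i - x k)) * (lam\<^sup>2 * H x - (\<Sum>l\<in>{1..n}-{k}. Q lam l x / (x k - x l)))
    - (\<Sum>i\<in>S-{k}. 1 / (x i - x k)) * (\<Prod>i\<in>S-{k}. 1 / (x i - x k)) * Q lam k x"
proof -
  have fin: "finite (S - {k})" and k: "k \<in> {1..n}" using assms finite_subset[of S "{1..n}"] by auto
  define r where "r x = (\<Prod>i\<in>S-{k}. 1 / (x i - x k))" for x :: "nat \<Rightarrow> real"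
  define r' where "r' x = (\<Sum>j\<in>S-{k}. (1 / (x j - x k))\<^sup>2 * (\<Prod>i\<in>S-{k}-{j}. 1 / (x i - x k)))" for x :: "nat \<Rightarrow> real"
  have sr: "smooth_on_chamber n r"
    unfolding r_def using assms k by (intro smooth_prod smooth_inverse_diff) auto
  have dr: "deriv_on n k r r'"
    unfolding r_def r'_def using assms k fin by (intro deriv_on_prod deriv_on_inverse_diff) auto
  have "r' x = (\<Sum>j\<in>S-{k}. (1 / (x j - x k)) * r x)"
    unfolding r'_def
  proof (rule sum.cong)
    fix j assume "j \<in> S - {k}"
    then show "(1 / (x j - x k))\<^sup>2 * (\<Prod>i\<in>S-{k}-{j}. 1 / (x i - x k)) = (1 / (x j - x k)) * r x"
      unfolding r_def using prod.remove[OF fin, of j "\<lambda>i. 1 / (x i - x k)"] by (simp only: power2_eq_square mult.assoc)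
  qed simp
  then have r': "r' x = (\<Sum>j\<in>S-{k}. 1 / (x j - x k)) * r x" by (simp only: sum_distrib_right)
  have "opL n lam k (q lam S k) x = opL n lam k (\<lambda>x. Q lam k x * r x) x"
    using opL_cong[of n "q lam S k" "\<lambda>x. Q lam k x * r x"] by (simp add: q_def r_def)
  also have "\<dots> = r x * opL n lam k (Q lam k) x - r' x * Q lam k x"
    by (rule opL_mult[OF smooth_Q[OF k] sr dr assms(1) k])
  finally show ?thesis unfolding opL_Q[OF assms(1) k] r' r_def .
qed

text \<open>The terms with \<open>H\<close> drop out because the weights add up to zero. The terms
  with \<open>l \<in> S\<close> cancel against the derivatives of the weights, by the differentiated
  partial fractions. In the remaining terms, with \<open>l\<close> outside \<open>S\<close>, partial
  fractions recombine the weights into those of the larger set \<open>insert l S\<close>.\<close>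

lemma sum_opL_q:
  assumes S: "card S \<ge> 2" "S \<subseteq> {1..n}" and x: "x \<in> chamber n"
  shows "(\<Sum>k\<in>S. opL n lam k (q lam S k) x) = - (\<Sum>l\<in>{1..n}-S. q lam (insert l S) l x)"
proof -
  have fin: "finite S" using S finite_subset by auto
  have inj: "inj_on x {1..n}" using chamber_neq[OF x] by (meson inj_onI)
  define P where "P k = (\<Prod>i\<in>S-{k}. 1 / (x i - x k))" for k
  have P0: "(\<Sum>k\<in>S. P k) = 0"
    unfolding P_def by (rule sum_prod_inverse_diff_eq_0[OF fin S(1) inj_on_subset[OF inj S(2)]])
  have split: "(\<Sum>l\<in>{1..n}-{k}. Q lam l x / (x k - x l)) =
      (\<Sum>l\<in>S-{k}. Q lam l x / (x k - x l)) + (\<Sum>l\<in>{1..n}-S. Q lam l x / (x k - x l))" if "k \<in> S" for k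
  proof -
    have "{1..n}-{k} = (S-{k}) \<union> ({1..n}-S)" "(S-{k}) \<inter> ({1..n}-S) = {}" using S that by auto
    then show ?thesis using fin by (simp add: sum.union_disjoint)
  qed
  have "(\<Sum>k\<in>S. opL n lam k (q lam S k) x) =
     (\<Sum>k\<in>S. P k * (lam\<^sup>2 * H x) - (\<Sum>l\<in>{1..n}-S. P k * (Q lam l x / (x k - x l)))
        - (\<Sum>l\<in>S-{k}. P k * (Q lam l x / (x k - x l))) - (\<Sum>i\<in>S-{k}. 1 / (x i - x k)) * P k * Q lam k x)"
  proof (rule sum.cong)
    fix k assume k: "k \<in> S"
    show "opL n lam k (q lam S k) x = P k * (lam\<^sup>2 * H x) - (\<Sum>l\<in>{1..n}-S. P k * (Q lam l x / (x k - x l)))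
        - (\<Sum>l\<in>S-{k}. P k * (Q lam l x / (x k - x l))) - (\<Sum>i\<in>S-{k}. 1 / (x i - x k)) * P k * Q lam k x"
      unfolding opL_q[OF x k S(2)] P_def[symmetric] split[OF k] sum_distrib_left[symmetric] by (simp add: algebra_simps)
  qed simp
  also have "\<dots> = (\<Sum>k\<in>S. P k) * (lam\<^sup>2 * H x) - (\<Sum>k\<in>S. \<Sum>l\<in>{1..n}-S. P k * (Q lam l x / (x k - x l)))
        - (\<Sum>k\<in>S. \<Sum>l\<in>S-{k}. P k * (Q lam l x / (x k - x l))) - (\<Sum>k\<in>S. (\<Sum>i\<in>S-{k}. 1 / (x i - x k)) * P k * Q lam k x)"
    by (simp add: sum_subtractf sum_distrib_right)
  also have "(\<Sum>k\<in>S. \<Sum>l\<in>{1..n}-S. P k * (Q lam l x / (x k - x l))) = (\<Sum>l\<in>{1..n}-S. q lam (insert l S) l x)"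
  proof -
    have "(\<Sum>k\<in>S. P k * (Q lam l x / (x k - x l))) = q lam (insert l S) l x" if l: "l \<in> {1..n}-S" for l
    proof -
      have "(\<Sum>k\<in>S. P k * (Q lam l x / (x k - x l))) = Q lam l x * (\<Sum>k\<in>S. 1 / (x k - x l) * P k)"
        by (simp add: sum_distrib_left mult_ac)
      also have "(\<Sum>k\<in>S. 1 / (x k - x l) * P k) = (\<Prod>i\<in>S. 1 / (x i - x l))"
        unfolding P_def
      proof (rule prod_partial_fractions[OF fin _ inj_on_subset[OF inj S(2)]])
        show "S \<noteq> {}" using S(1) by auto
        show "x l \<notin> x ` S" using inj_on_image_mem_iff[OF inj _ S(2), of l] l by auto
      qed
      moreover have "insert l S - {l} = S" using l by auto
      ultimately show ?thesis using x by (simp add: q_def)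
    qed
    then show ?thesis by (subst sum.swap) simp
  qed
  also have "(\<Sum>k\<in>S. \<Sum>l\<in>S-{k}. P k * (Q lam l x / (x k - x l))) = (\<Sum>l\<in>S. \<Sum>k\<in>S-{l}. P k * (Q lam l x / (x k - x l)))"
    by (rule sum_offdiag_swap[OF fin])
  also have "\<dots> = - (\<Sum>l\<in>S. (\<Sum>i\<in>S-{l}. 1 / (x i - x l)) * P l * Q lam l x)"
    unfolding sum_negf[symmetric]
  proof (rule sum.cong)
    fix l assume l: "l \<in> S"
    have P: "P k = 1 / (x l - x k) * (\<Prod>i\<in>S-{l}-{k}. 1 / (x i - x k))" if "k \<in> S - {l}" for k
    proof -
      have "S - {k} = insert l (S-{l}-{k})" using l that by auto
      then show ?thesis unfolding P_def using fin by simp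
    qed
    have "(\<Sum>k\<in>S-{l}. P k * (Q lam l x / (x k - x l))) =
       (\<Sum>k\<in>S-{l}. - (Q lam l x * (1 / (x k - x l)\<^sup>2 * (\<Prod>i\<in>S-{l}-{k}. 1 / (x i - x k)))))"
    proof (rule sum.cong)
      fix k assume k: "k \<in> S - {l}"
      have "x k \<noteq> x l" by (rule chamber_neq[OF x]) (use k l S(2) in auto)
      then have "1 / (x l - x k) * (1 / (x k - x l)) = - (1 / (x k - x l)\<^sup>2)"
        by (simp add: divide_simps power2_eq_square)
      moreover have "(r * t) * (Q' / s) = - (Q' * (u * t))" if "r * (1 / s) = - u" for r s t u Q' :: real
      proof -
        have "(r * t) * (Q' / s) = (r * (1 / s)) * (t * Q')" by simp
        then show ?thesis unfolding that by simp
      qed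
      ultimately show "P k * (Q lam l x / (x k - x l)) = - (Q lam l x * (1 / (x k - x l)\<^sup>2 * (\<Prod>i\<in>S-{l}-{k}. 1 / (x i - x k))))"
        unfolding P[OF k] by blast
    qed simp
    also have "\<dots> = - (Q lam l x * (\<Sum>k\<in>S-{l}. 1 / (x k - x l)\<^sup>2 * (\<Prod>i\<in>S-{l}-{k}. 1 / (x i - x k))))"
      by (simp add: sum_negf sum_distrib_left)
    also have "(\<Sum>k\<in>S-{l}. 1 / (x k - x l)\<^sup>2 * (\<Prod>i\<in>S-{l}-{k}. 1 / (x i - x k)))
       = (\<Sum>i\<in>S-{l}. 1 / (x i - x l)) * (\<Prod>i\<in>S-{l}. 1 / (x i - x l))"
    proof (rule prod_partial_fractions_deriv)
      have "S - {l} \<subseteq> {1..n}" using S(2) by auto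
      then show "inj_on x (S - {l})" by (rule inj_on_subset[OF inj])
      show "x l \<notin> x ` (S - {l})"
      proof
        assume "x l \<in> x ` (S - {l})"
        then obtain k where "k \<in> S - {l}" "x l = x k" by blast
        then show False using chamber_neq[OF x, of l k] l S(2) by blast
      qed
    qed (use fin in auto)
    finally show "(\<Sum>k\<in>S-{l}. P k * (Q lam l x / (x k - x l))) = - ((\<Sum>i\<in>S-{l}. 1 / (x i - x l)) * P l * Q lam l x)"
      by (simp add: P_def mult_ac)
  qed simp
  finally show ?thesis using P0 by simp
qed

text \<open>The correction terms after reflections have involved \<open>m\<close> indices: the
  indices in \<open>S\<close> are entangled by the weights, while those outside \<open>S\<close>
  still carry their factors \<open>lam - \<partial>\<^sub>i\<close>. By \<open>sum_opL_q\<close>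
  each stage is the negative of the next one.\<close>

definition X :: "real \<Rightarrow> nat \<Rightarrow> (nat \<Rightarrow> real) \<Rightarrow> real" where
  "X lam m = (\<lambda>x. \<Sum>S | S \<subseteq> {1..n} \<and> card S = m. \<Sum>k\<in>S. opLs n lam ({1..n} - S) (opL n lam k (q lam S k)) x)"

text \<open>Pairs of \<open>S\<close> and a new index \<open>l\<close> correspond to pairs of the
  enlarged set and a distinguished element of it. The factor of \<open>l\<close> is taken out of the
  product over the complement and becomes the inner \<open>opL n lam l\<close>.\<close>

lemma sum_insert_eq_X:
  "(\<Sum>S | S \<subseteq> {1..n} \<and> card S = m. \<Sum>l\<in>{1..n}-S. opLs n lam ({1..n} - S) (q lam (insert l S) l) x) = X lam (Suc m) x"
proof -
  have "(\<Sum>S | S \<subseteq> {1..n} \<and> card S = m. \<Sum>l\<in>{1..n}-S. opLs n lam ({1..n} - S) (q lam (insert l S) l) x)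
    = (\<Sum>(S,l)\<in>Sigma {S. S \<subseteq> {1..n} \<and> card S = m} (\<lambda>S. {1..n}-S). opLs n lam ({1..n} - S) (q lam (insert l S) l) x)"
    by (rule sum.Sigma) auto
  also have "\<dots> = (\<Sum>(S,k)\<in>Sigma {S. S \<subseteq> {1..n} \<and> card S = Suc m} (\<lambda>S. S). opLs n lam ({1..n} - S) (opL n lam k (q lam S k)) x)"
  proof (rule sum.reindex_bij_witness[where i = "\<lambda>(S,l). (S - {l}, l)" and j = "\<lambda>(S,l). (insert l S, l)"])
    fix a assume a: "a \<in> Sigma {S. S \<subseteq> {1..n} \<and> card S = m} (\<lambda>S. {1..n}-S)"
    obtain S l where [simp]: "a = (S,l)" by (cases a)
    have S: "S \<subseteq> {1..n}" "card S = m" "l \<in> {1..n}" "l \<notin> S" "finite S" using a finite_subset[of S "{1..n}"] by auto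
    show "(case case a of (S, l) \<Rightarrow> (insert l S, l) of (S, l) \<Rightarrow> (S - {l}, l)) = a" using S by auto
    show "(case a of (S, l) \<Rightarrow> (insert l S, l)) \<in> Sigma {S. S \<subseteq> {1..n} \<and> card S = Suc m} (\<lambda>S. S)"
      using S by auto
    have "{1..n} - S = insert l ({1..n} - insert l S)" using S by auto
    then have "opLs n lam ({1..n} - S) f = opLs n lam ({1..n} - insert l S) (opL n lam l f)" for f
      using opLs_insert2[of "{1..n} - insert l S" l n lam f] by (metis Diff_iff finite_Diff finite_atLeastAtMost insertI1)
    then show "(case case a of (S, l) \<Rightarrow> (insert l S, l) of (S, k) \<Rightarrow> opLs n lam ({1..n} - S) (opL n lam k (q lam S k)) x) =
        (case a of (S, l) \<Rightarrow> opLs n lam ({1..n} - S) (q lam (insert l S) l) x)"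
      by (simp del: atLeastAtMost_iff One_nat_def)
  next
    fix b assume b: "b \<in> Sigma {S. S \<subseteq> {1..n} \<and> card S = Suc m} (\<lambda>S. S)"
    obtain S l where [simp]: "b = (S,l)" by (cases b)
    have "finite S" using b finite_subset[of S "{1..n}"] by auto
    then show "(case case b of (S, l) \<Rightarrow> (S - {l}, l) of (S, l) \<Rightarrow> (insert l S, l)) = b"
      "(case b of (S, l) \<Rightarrow> (S - {l}, l)) \<in> Sigma {S. S \<subseteq> {1..n} \<and> card S = m} (\<lambda>S. {1..n}-S)"
      using b by (auto simp: insert_absorb)
  qed
  also have "\<dots> = X lam (Suc m) x"
    unfolding X_def by (rule sum.Sigma[symmetric]) (auto intro: finite_subset)
  finally show ?thesis .
qed

lemma X_step:
  assumes m: "m \<ge> 2"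
  shows "X lam m x = - X lam (Suc m) x"
proof -
  have "(\<Sum>k\<in>S. opLs n lam ({1..n} - S) (opL n lam k (q lam S k)) x) = - (\<Sum>l\<in>{1..n}-S. opLs n lam ({1..n} - S) (q lam (insert l S) l) x)"
    if S: "S \<subseteq> {1..n}" "card S = m" for S
  proof -
    have sq: "smooth_on_chamber n (q lam (insert l S) l)" if "l \<in> {1..n} - S" for l
      by (rule smooth_q) (use that S in auto)
    have "(\<Sum>k\<in>S. opLs n lam ({1..n} - S) (opL n lam k (q lam S k)) x)
       = opLs n lam ({1..n} - S) (\<lambda>x. \<Sum>k\<in>S. opL n lam k (q lam S k) x) x"
      by (subst opLs_sum) (auto simp: smooth_opL)
    also have "(\<lambda>x. \<Sum>k\<in>S. opL n lam k (q lam S k) x) = (\<lambda>x. (-1) * (\<Sum>l\<in>{1..n}-S. q lam (insert l S) l x))"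
    proof
      fix x show "(\<Sum>k\<in>S. opL n lam k (q lam S k) x) = (-1) * (\<Sum>l\<in>{1..n}-S. q lam (insert l S) l x)"
        using sum_opL_q[of S x lam] S m by (cases "x \<in> chamber n") (auto simp: opL_outside q_def)
    qed
    also have "opLs n lam ({1..n} - S) \<dots> x = (-1) * opLs n lam ({1..n} - S) (\<lambda>x. \<Sum>l\<in>{1..n}-S. q lam (insert l S) l x) x"
      by (subst opLs_cmult) (auto intro!: smooth_sum sq)
    also have "\<dots> = - (\<Sum>l\<in>{1..n}-S. opLs n lam ({1..n} - S) (q lam (insert l S) l) x)"
      by (subst opLs_sum) (auto simp: sq)
    finally show ?thesis .
  qed
  then have "X lam m x = (\<Sum>S | S \<subseteq> {1..n} \<and> card S = m. - (\<Sum>l\<in>{1..n}-S. opLs n lam ({1..n} - S) (q lam (insert l S) l) x))"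
    unfolding X_def by (intro sum.cong refl) blast
  then show ?thesis by (simp only: sum_negf sum_insert_eq_X)
qed

lemma X_eq_0: "X lam 2 x = 0"
proof -
  have "X lam m x = 0" if "2 \<le> m" "m \<le> n + 2" for m
    using that(2,1)
  proof (induction m rule: inc_induct)
    \<comment> \<open>No set of indices has more than \<open>n\<close> elements. The bound
      \<open>n + 2\<close> keeps the range of the induction nonempty for every
      \<open>n\<close>.\<close>
    case base
    have "card S \<noteq> n + 2" if "S \<subseteq> {1..n}" for S
      using card_mono[OF _ that] by simp
    then have "{S. S \<subseteq> {1..n} \<and> card S = n + 2} = {}" by blast
    then show ?case by (simp only: X_def sum.empty)
  next
    case (step m)
    then show ?case using X_step[of m lam x] by simp
  qed
  then show ?thesis by simp
qed

text \<open>Let \<open>E(lam)\<close> be the product of all \<open>lam - T\<^sub>k\<close>. On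
  \<open>F\<close>, dividing by \<open>lam - T\<^sub>k\<close> amounts to applying
  \<open>(lam + T\<^sub>k) / lam\<^sup>2\<close>, and the sum of the \<open>T\<^sub>k F\<close> is
  zero by translation invariance. Hence \<open>lam\<^sup>2 E'(lam) = n lam E(lam)\<close> on
  \<open>F\<close>; this is the same equation with \<open>\<partial>\<^sub>k\<close> and
  \<open>H\<close>. The reflections contribute \<open>X lam 2\<close>, which is zero.\<close>

lemma opLs_main_identity:
  assumes x: "x \<in> chamber n"
  shows "real n * lam * opLs n lam {1..n} H x = lam\<^sup>2 * (\<Sum>k\<in>{1..n}. opLs n lam ({1..n} - {k}) H x)"
proof -
  \<comment> \<open>The same cut-off as in \<open>q\<close>, needed for an equality of functions
    with the sum of the \<open>q lam {k} k\<close>.\<close>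
  define H0 where "H0 x = (if x \<in> chamber n then H x else 0)" for x
  have sH0: "smooth_on_chamber n H0"
    by (rule smooth_cong[OF _ smooth_H]) (simp add: H0_def)
  have opLs_H0: "opLs n lam S H0 x = opLs n lam S H x" if "finite S" for S
  proof (cases "S = {}")
    case False
    then obtain a where "insert a (S - {a}) = S" by blast
    then show ?thesis
      using opLs_insert2[of "S - {a}" a n lam] opL_cong[of n H0 H lam a] that by (simp add: H0_def)
  qed (simp add: H0_def x)
  have sQ: "(\<Sum>k\<in>{1..n}. Q lam k x) = real n * lam * H x" if "x \<in> chamber n" for x
  proof -
    have "(\<Sum>k\<in>{1..n}. \<Sum>l\<in>{1..n}-{k}. 1 / (x k - x l)) = 0"
    proof (rule sum_antisymmetric)
      show "1 / (x i - x j) = - (1 / (x j - x i))" for i j by (metis minus_diff_eq minus_divide_right)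
    qed simp
    then have "(\<Sum>k\<in>{1..n}. A k x) = 0"
      using translation[OF that] that by (simp add: A_eq sum_subtractf flip: sum_distrib_right)
    then show ?thesis by (simp add: Q_def sum.distrib)
  qed
  have "real n * lam * opLs n lam {1..n} H x = opLs n lam {1..n} (\<lambda>x. (real n * lam) * H0 x) x"
    using sH0 by (simp add: opLs_cmult opLs_H0)
  also have "(\<lambda>x. (real n * lam) * H0 x) = (\<lambda>x. \<Sum>k\<in>{1..n}. q lam {k} k x)"
    using sQ by (auto simp: fun_eq_iff H0_def q_def)
  also have "opLs n lam {1..n} \<dots> x = (\<Sum>k\<in>{1..n}. opLs n lam {1..n} (q lam {k} k) x)"
    by (subst opLs_sum) (auto intro: smooth_q)
  also have "\<dots> = (\<Sum>k\<in>{1..n}. lam\<^sup>2 * opLs n lam ({1..n} - {k}) H x -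
        (\<Sum>l\<in>{1..n}-{k}. opLs n lam ({1..n} - {k}) (q lam (insert l {k}) l) x))"
  proof (rule sum.cong)
    fix k assume k: "k \<in> {1..n}"
    then have "insert k ({1..n} - {k}) = {1..n}" by auto
    then have "opLs n lam {1..n} (q lam {k} k) x = opLs n lam ({1..n} - {k}) (opL n lam k (q lam {k} k)) x"
      using opLs_insert2[of "{1..n} - {k}" k n lam "q lam {k} k"] by simp
    also have "opL n lam k (q lam {k} k) = (\<lambda>x. lam\<^sup>2 * H0 x + (\<Sum>l\<in>{1..n}-{k}. (-1) * q lam (insert l {k}) l x))"
    proof
      fix x
      show "opL n lam k (q lam {k} k) x = lam\<^sup>2 * H0 x + (\<Sum>l\<in>{1..n}-{k}. (-1) * q lam (insert l {k}) l x)"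
      proof (cases "x \<in> chamber n")
        case True
        have "q lam (insert l {k}) l x = Q lam l x / (x k - x l)" if "l \<in> {1..n}-{k}" for l
        proof -
          have "insert l {k} - {l} = {k}" using that by auto
          then show ?thesis using True by (simp add: q_def)
        qed
        then show ?thesis using True k by (simp add: opL_q H0_def sum_negf)
      qed (simp add: opL_outside H0_def q_def)
    qed
    also have "opLs n lam ({1..n} - {k}) \<dots> x = lam\<^sup>2 * opLs n lam ({1..n} - {k}) H x +
        (\<Sum>l\<in>{1..n}-{k}. (-1) * opLs n lam ({1..n} - {k}) (q lam (insert l {k}) l) x)"
    proof -
      have sq: "smooth_on_chamber n (q lam (insert l {k}) l)" if "l \<in> {1..n}-{k}" for l
        by (rule smooth_q) (use that k in auto)
      have "opLs n lam ({1..n} - {k}) (\<lambda>x. lam\<^sup>2 * H0 x + (\<Sum>l\<in>{1..n}-{k}. (-1) * q lam (insert l {k}) l x)) x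
        = opLs n lam ({1..n} - {k}) (\<lambda>x. lam\<^sup>2 * H0 x) x + opLs n lam ({1..n} - {k}) (\<lambda>x. \<Sum>l\<in>{1..n}-{k}. (-1) * q lam (insert l {k}) l x) x"
        by (subst opLs_add) (rule finite_Diff finite_atLeastAtMost smooth_cmult sH0 smooth_sum sq refl | assumption)+
      also have "opLs n lam ({1..n} - {k}) (\<lambda>x. lam\<^sup>2 * H0 x) x = lam\<^sup>2 * opLs n lam ({1..n} - {k}) H x"
        using sH0 by (simp add: opLs_cmult opLs_H0)
      also have "opLs n lam ({1..n} - {k}) (\<lambda>x. \<Sum>l\<in>{1..n}-{k}. (-1) * q lam (insert l {k}) l x) x =
         (\<Sum>l\<in>{1..n}-{k}. opLs n lam ({1..n} - {k}) (\<lambda>x. (-1) * q lam (insert l {k}) l x) x)"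
        by (subst opLs_sum) (rule finite_Diff finite_atLeastAtMost smooth_cmult sH0 smooth_sum sq refl | assumption)+
      also have "\<dots> = (\<Sum>l\<in>{1..n}-{k}. (-1) * opLs n lam ({1..n} - {k}) (q lam (insert l {k}) l) x)"
        by (rule sum.cong[OF refl], subst opLs_cmult) (rule finite_Diff finite_atLeastAtMost smooth_cmult sH0 smooth_sum sq refl | assumption)+
      finally show ?thesis .
    qed
    also have "\<dots> = lam\<^sup>2 * opLs n lam ({1..n} - {k}) H x -
        (\<Sum>l\<in>{1..n}-{k}. opLs n lam ({1..n} - {k}) (q lam (insert l {k}) l) x)"
      by (simp add: sum_negf)
    finally show "opLs n lam {1..n} (q lam {k} k) x = lam\<^sup>2 * opLs n lam ({1..n} - {k}) H x -
        (\<Sum>l\<in>{1..n}-{k}. opLs n lam ({1..n} - {k}) (q lam (insert l {k}) l) x)" .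
  qed simp
  also have "\<dots> = lam\<^sup>2 * (\<Sum>k\<in>{1..n}. opLs n lam ({1..n} - {k}) H x) -
      (\<Sum>k\<in>{1..n}. \<Sum>l\<in>{1..n}-{k}. opLs n lam ({1..n} - {k}) (q lam (insert l {k}) l) x)"
    by (simp add: sum_subtractf sum_distrib_left)
  also have "(\<Sum>k\<in>{1..n}. \<Sum>l\<in>{1..n}-{k}. opLs n lam ({1..n} - {k}) (q lam (insert l {k}) l) x) = X lam 2 x"
  proof -
    have "{S. S \<subseteq> {1..n} \<and> card S = 1} = (\<lambda>k. {k}) ` {1..n}"
      by (auto simp: card_1_singleton_iff)
    then have "(\<Sum>S | S \<subseteq> {1..n} \<and> card S = 1. \<Sum>l\<in>{1..n}-S. opLs n lam ({1..n} - S) (q lam (insert l S) l) x) =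
       (\<Sum>k\<in>{1..n}. \<Sum>l\<in>{1..n}-{k}. opLs n lam ({1..n} - {k}) (q lam (insert l {k}) l) x)"
      by (simp add: sum.reindex)
    then show ?thesis using sum_insert_eq_X[where m = 1 and lam = lam and x = x] by (simp add: numeral_2_eq_2)
  qed
  finally show ?thesis by (simp add: X_eq_0)
qed

text \<open>Double counting: a subset \<open>T\<close> occurs once for every index that it
  omits.\<close>

lemma sum_subsets_remove:
  assumes "finite N"
  shows "(\<Sum>k\<in>N. \<Sum>T\<in>Pow (N - {k}). g T) = (\<Sum>T\<in>Pow N. real (card N - card T) * g T)"
proof -
  have "Pow (N - {k}) = {T. T \<in> Pow N \<and> k \<notin> T}" for k by auto
  then have "(\<Sum>k\<in>N. \<Sum>T\<in>Pow (N - {k}). g T) = (\<Sum>T\<in>Pow N. \<Sum>k | k \<in> N \<and> k \<notin> T. g T)"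
    using sum.swap_restrict[of N "Pow N" "\<lambda>k T. g T" "\<lambda>k T. k \<notin> T"] assms by simp
  also have "\<dots> = (\<Sum>T\<in>Pow N. real (card N - card T) * g T)"
  proof (rule sum.cong)
    fix T assume "T \<in> Pow N"
    moreover have "{k. k \<in> N \<and> k \<notin> T} = N - T" by auto
    ultimately show "(\<Sum>k | k \<in> N \<and> k \<notin> T. g T) = real (card N - card T) * g T"
      using assms by (simp add: card_Diff_subset finite_subset)
  qed simp
  finally show ?thesis .
qed

text \<open>Compare coefficients in \<open>opLs_main_identity\<close>: at
  \<open>lam ^ (n + 1 - m)\<close> the elementary symmetric operator of degree \<open>m\<close> has
  the factor \<open>n\<close> on the left and \<open>n - m\<close> on the right, so \<open>m\<close>
  times it vanishes on \<open>H\<close>.\<close>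

lemma elementary_symmetric_eq_0:
  assumes x: "x \<in> chamber n" and m: "m \<in> {1..n}"
  shows "(\<Sum>T | T \<subseteq> {1..n} \<and> card T = m. opLs n 0 T H x) = 0"
proof -
  define E where "E m = (\<Sum>T | T \<subseteq> {1..n} \<and> card T = m. opLs n 0 T H x)" for m
  define c where "c i = (if i = 0 then 0 else real (n + 1 - i) * E (n + 1 - i))" for i
  have "(\<Sum>i\<le>n+1. c i * lam ^ i) = 0" for lam
  proof -
    define g where "g T = lam ^ (n - 1 - card T) * opLs n 0 T H x" for T
    have card_le: "card T \<le> n" if "T \<in> Pow {1..n}" for T
      using card_mono[of "{1..n}" T] that by simp
    have "real n * lam * opLs n lam {1..n} H x = lam\<^sup>2 * (\<Sum>k\<in>{1..n}. \<Sum>T\<in>Pow ({1..n} - {k}). g T)"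
      unfolding opLs_main_identity[OF x]
    proof (intro arg_cong2[of _ _ _ _ "(*)"] refl sum.cong)
      fix k assume k: "k \<in> {1..n}"
      have "opLs n lam ({1..n} - {k}) H x = (\<Sum>T\<in>Pow ({1..n} - {k}). lam ^ (card ({1..n} - {k}) - card T) * opLs n 0 T H x)"
        by (rule opLs_expand) (auto simp: smooth_H x)
      then show "opLs n lam ({1..n} - {k}) H x = (\<Sum>T\<in>Pow ({1..n} - {k}). g T)"
        using k by (simp add: g_def)
    qed
    also have "\<dots> = (\<Sum>T\<in>Pow {1..n}. lam\<^sup>2 * (real (n - card T) * g T))"
      by (subst sum_subsets_remove) (simp_all add: sum_distrib_left)
    also have "\<dots> = (\<Sum>T\<in>Pow {1..n}. real (n - card T) * lam ^ (n + 1 - card T) * opLs n 0 T H x)"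
    proof (rule sum.cong)
      fix T assume "T \<in> Pow {1..n}"
      \<comment> \<open>For \<open>card T = n\<close> the exponent \<open>n - 1 - card T\<close> is
        truncated, but then the factor \<open>n - card T\<close> is zero.\<close>
      then have "card T = n \<or> n + 1 - card T = n - 1 - card T + 2" using card_le[of T] by auto
      then show "lam\<^sup>2 * (real (n - card T) * g T) = real (n - card T) * lam ^ (n + 1 - card T) * opLs n 0 T H x"
        by (auto simp: g_def power_add power2_eq_square)
    qed simp
    also have "real n * lam * opLs n lam {1..n} H x = (\<Sum>T\<in>Pow {1..n}. real n * lam ^ (n + 1 - card T) * opLs n 0 T H x)"
    proof -
      have "opLs n lam {1..n} H x = (\<Sum>T\<in>Pow {1..n}. lam ^ (card {1..n} - card T) * opLs n 0 T H x)"
        by (rule opLs_expand) (auto simp: smooth_H x)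
      then show ?thesis unfolding sum_distrib_left
      proof (simp only: sum_distrib_left, intro sum.cong refl)
        fix T assume "T \<in> Pow {1..n}"
        then have "n + 1 - card T = Suc (n - card T)" using card_le[of T] by auto
        then show "real n * lam * (lam ^ (card {1..n} - card T) * opLs n 0 T H x) = real n * lam ^ (n + 1 - card T) * opLs n 0 T H x"
          by simp
      qed
    qed
    finally have "(\<Sum>T\<in>Pow {1..n}. real n * lam ^ (n + 1 - card T) * opLs n 0 T H x - real (n - card T) * lam ^ (n + 1 - card T) * opLs n 0 T H x) = 0"
      by (simp add: sum_subtractf)
    also have "(\<Sum>T\<in>Pow {1..n}. real n * lam ^ (n + 1 - card T) * opLs n 0 T H x - real (n - card T) * lam ^ (n + 1 - card T) * opLs n 0 T H x)
       = (\<Sum>T\<in>Pow {1..n}. real (card T) * lam ^ (n + 1 - card T) * opLs n 0 T H x)"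
      by (intro sum.cong refl) (use card_le in \<open>simp add: of_nat_diff algebra_simps\<close>)
    also have "\<dots> = (\<Sum>m\<in>{..n}. \<Sum>T | T \<in> Pow {1..n} \<and> card T = m. real (card T) * lam ^ (n + 1 - card T) * opLs n 0 T H x)"
      by (rule sum.group[symmetric]) (use card_le in auto)
    also have "\<dots> = (\<Sum>m\<in>{..n}. real m * lam ^ (n + 1 - m) * E m)"
      by (intro sum.cong refl) (simp add: E_def sum_distrib_left)
    also have "\<dots> = (\<Sum>i\<in>{1..n+1}. c i * lam ^ i)"
      by (rule sum.reindex_bij_witness[where i = "\<lambda>i. n + 1 - i" and j = "\<lambda>m. n + 1 - m"]) (auto simp: c_def)
    also have "\<dots> = (\<Sum>i\<le>n+1. c i * lam ^ i)"
      by (rule sum.mono_neutral_left) (auto simp: c_def)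
    finally show ?thesis .
  qed
  then have "\<forall>i\<le>n+1. c i = 0"
    using polyfun_eq_0[where n = "n+1" and c = c] by blast
  then have "c (n + 1 - m) = 0" by simp
  then show ?thesis using m unfolding c_def E_def by auto
qed

lemma smooth_funpow_partial: "i \<in> {1..n} \<Longrightarrow> smooth_on_chamber n ((partial i ^^ m) H)"
  by (induction m) (auto intro: smooth_H smooth_partial)

text \<open>An elementary symmetric polynomial splits according to whether the index
  \<open>i\<close> is used. As the full ones vanish on \<open>H\<close>, the one of degree
  \<open>m + 1\<close> without \<open>i\<close> is \<open>\<partial>\<^sub>i\<close> applied to the
  one of degree \<open>m\<close> without \<open>i\<close>; the sign is that of
  \<open>opL n 0 i\<close>, which is \<open>- \<partial>\<^sub>i\<close>.\<close>

lemma elementary_symmetric_remove: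
  assumes "x \<in> chamber n" "i \<in> {1..n}" "m \<le> n"
  shows "(\<Sum>T | T \<subseteq> {1..n} - {i} \<and> card T = m. opLs n 0 T H x) = (partial i ^^ m) H x"
  using assms(1,3)
proof (induction m arbitrary: x)
  case 0
  have "{T. T \<subseteq> {1..n} - {i} \<and> card T = 0} = {{}}"
    using finite_subset[of _ "{1..n} - {i}"] by auto
  then show ?case by simp
next
  case (Suc m)
  define N where "N = {1..n}"
  define F where "F m = {T. T \<subseteq> N - {i} \<and> card T = m}" for m
  have finN: "finite N" and iN: "i \<in> N" using assms by (auto simp: N_def)
  have fin: "finite (F m)" for m unfolding F_def using finN by (auto intro: finite_subset[of _ "Pow N"])
  have finT: "finite T" "i \<notin> T" if "T \<in> F m" for T m
    using that finN finite_subset[of T N] by (auto simp: F_def)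
  have "{T. T \<subseteq> N \<and> card T = Suc m} = F (Suc m) \<union> insert i ` F m"
  proof (intro set_eqI iffI)
    fix T assume T: "T \<in> {T. T \<subseteq> N \<and> card T = Suc m}"
    show "T \<in> F (Suc m) \<union> insert i ` F m"
    proof (cases "i \<in> T")
      case True
      then have "T = insert i (T - {i})" "T - {i} \<in> F m" using T finN finite_subset[of T N] by (auto simp: F_def)
      then show ?thesis by blast
    qed (use T in \<open>auto simp: F_def\<close>)
  next
    fix T assume "T \<in> F (Suc m) \<union> insert i ` F m"
    then consider "T \<in> F (Suc m)" | T' where "T' \<in> F m" "T = insert i T'" by blast
    then show "T \<in> {T. T \<subseteq> N \<and> card T = Suc m}"
    proof cases
      case 2
      then show ?thesis using finT(1)[OF 2(1)] finT(2)[OF 2(1)] iN by (auto simp: F_def)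
    qed (auto simp: F_def)
  qed
  moreover have "F (Suc m) \<inter> insert i ` F m = {}" by (auto simp: F_def)
  moreover have "inj_on (insert i) (F m)"
    by (rule inj_onI) (use finT(2) in \<open>metis insert_ident\<close>)
  moreover have "(\<Sum>T | T \<subseteq> N \<and> card T = Suc m. opLs n 0 T H x) = 0"
    unfolding N_def by (rule elementary_symmetric_eq_0) (use Suc.prems in auto)
  ultimately have "(\<Sum>T\<in>F (Suc m). opLs n 0 T H x) + (\<Sum>T\<in>F m. opLs n 0 (insert i T) H x) = 0"
    using fin by (simp add: sum.union_disjoint sum.reindex)
  also have "(\<Sum>T\<in>F m. opLs n 0 (insert i T) H x) = opL n 0 i (\<lambda>x. \<Sum>T\<in>F m. opLs n 0 T H x) x"
  proof -
    have "smooth_on_chamber n (opLs n 0 T H)" if "T \<in> F m" for T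
      by (rule smooth_opLs[OF finT(1)[OF that] smooth_H])
    then have "opL n 0 i (\<lambda>x. \<Sum>T\<in>F m. opLs n 0 T H x) x = (\<Sum>T\<in>F m. opL n 0 i (opLs n 0 T H) x)"
      by (subst opL_sum) auto
    also have "\<dots> = (\<Sum>T\<in>F m. opLs n 0 (insert i T) H x)"
      by (intro sum.cong refl, subst opLs_insert) (use finT in blast)+
    finally show ?thesis by simp
  qed
  also have "opL n 0 i (\<lambda>x. \<Sum>T\<in>F m. opLs n 0 T H x) = opL n 0 i ((partial i ^^ m) H)"
    by (rule opL_cong) (use Suc in \<open>auto simp: F_def N_def\<close>)
  also have "opL n 0 i ((partial i ^^ m) H) x = - (partial i ^^ Suc m) H x"
    using Suc.prems assms(2) smooth_funpow_partial by (simp add: opL_eq)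
  finally show ?case by (simp add: F_def N_def)
qed

text \<open>The remaining \<open>n - 1\<close> indices have no subset with \<open>n\<close>
  elements.\<close>

lemma funpow_partial_eq_0:
  assumes "x \<in> chamber n" "i \<in> {1..n}"
  shows "(partial i ^^ n) H x = 0"
proof -
  have "card T \<noteq> n" if "T \<subseteq> {1..n} - {i}" for T
    using card_mono[OF _ that] assms(2) by auto
  then have E: "{T. T \<subseteq> {1..n} - {i} \<and> card T = n} = {}" by blast
  show ?thesis using elementary_symmetric_remove[OF assms order_refl] unfolding E by simp
qed

text \<open>By \<open>elementary_symmetric_remove\<close>,
  \<open>\<partial>\<^sub>i\<^sup>2 H\<close> is a sum over the pairs that avoid \<open>i\<close>.
  In the sum over \<open>i\<close> each pair occurs \<open>n - 2\<close> times, which leaves a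
  multiple of the vanishing second elementary symmetric operator.\<close>

lemma harmonic:
  assumes "x \<in> chamber n" "n \<ge> 2"
  shows "(\<Sum>i\<in>{1..n}. partial i (partial i H) x) = 0"
proof -
  define g where "g T = (if card T = 2 then opLs n 0 T H x else 0)" for T
  have "(\<Sum>i\<in>{1..n}. partial i (partial i H) x) = (\<Sum>i\<in>{1..n}. \<Sum>T\<in>Pow ({1..n}-{i}). g T)"
  proof (rule sum.cong)
    fix i assume "i \<in> {1..n}"
    then have "partial i (partial i H) x = (\<Sum>T | T \<subseteq> {1..n} - {i} \<and> card T = 2. opLs n 0 T H x)"
      using elementary_symmetric_remove[of x i 2] assms by (simp add: numeral_2_eq_2)
    also have "\<dots> = (\<Sum>T\<in>Pow ({1..n}-{i}). g T)"
      unfolding g_def by (subst sum.inter_filter[symmetric]) (auto intro: sum.cong)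
    finally show "partial i (partial i H) x = (\<Sum>T\<in>Pow ({1..n}-{i}). g T)" .
  qed simp
  also have "\<dots> = (\<Sum>T\<in>Pow {1..n}. real (n - card T) * g T)"
    by (subst sum_subsets_remove) auto
  also have "\<dots> = real (n - 2) * (\<Sum>T\<in>Pow {1..n}. g T)"
    unfolding sum_distrib_left by (intro sum.cong) (auto simp: g_def)
  also have "(\<Sum>T\<in>Pow {1..n}. g T) = (\<Sum>T | T \<subseteq> {1..n} \<and> card T = 2. opLs n 0 T H x)"
    unfolding g_def by (subst sum.inter_filter[symmetric]) (auto intro: sum.cong)
  also have "\<dots> = 0" by (rule elementary_symmetric_eq_0) (use assms in auto)
  finally show ?thesis by simp
qed

end


section \<open>From the partial differential equations to a null system\<close>

text \<open>The factor \<open>\<surd>V\<close>, kept as a product of powers so that it matches the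
  form of the conformal blocks.\<close>

definition sq :: "nat \<Rightarrow> (nat \<Rightarrow> real) \<Rightarrow> real" where
  "sq n x = (\<Prod>b\<in>{1..n}. \<Prod>a\<in>{1..<b}. (x b - x a) powr (1/2))"

lemma sq_pos: "x \<in> chamber n \<Longrightarrow> sq n x > 0"
  unfolding sq_def by (auto intro!: prod_pos simp: chamber_neq)

lemma smooth_sq: "smooth_on_chamber n (sq n)"
proof -
  have "sq n = (\<lambda>x. \<Prod>b\<in>{1..n}. \<Prod>a\<in>{1..<b}. (x b - x a) powr (1/2))" by (auto simp: sq_def)
  then show ?thesis by (auto intro!: smooth_prod smooth_diff_powr)
qed

text \<open>Logarithmic differentiation without division: \<open>g k\<close> stands for the
  logarithmic derivative of \<open>f k\<close>.\<close>

lemma deriv_on_prod_log: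
  assumes "finite K" "\<And>k. k \<in> K \<Longrightarrow> deriv_on n i (f k) (\<lambda>x. g k x * f k x)"
  shows "deriv_on n i (\<lambda>x. \<Prod>k\<in>K. f k x) (\<lambda>x. (\<Sum>k\<in>K. g k x) * (\<Prod>k\<in>K. f k x))"
  using assms
proof (induction K)
  case (insert a K)
  have "deriv_on n i (\<lambda>x. f a x * (\<Prod>k\<in>K. f k x))
     (\<lambda>x. (g a x * f a x) * (\<Prod>k\<in>K. f k x) + f a x * ((\<Sum>k\<in>K. g k x) * (\<Prod>k\<in>K. f k x)))"
    by (rule deriv_on_mult) (use insert in auto)
  then show ?case using insert by (simp add: algebra_simps)
qed (simp add: deriv_on_const)

lemma deriv_on_cong:
  assumes "deriv_on n i f f'" "\<And>x. x \<in> chamber n \<Longrightarrow> f' x = g' x"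
  shows "deriv_on n i f g'"
  using assms unfolding deriv_on_def by auto

text \<open>Logarithmic derivative in \<open>x k\<close> of a product of powers of differences. Only
  pairs containing \<open>k\<close> contribute, and the sign that depends on whether
  \<open>k\<close> is the larger or the smaller index is absorbed into
  \<open>x k - x l\<close>.\<close>

lemma sum_pairs_at:
  fixes x :: "nat \<Rightarrow> real" and c :: "nat \<Rightarrow> nat \<Rightarrow> real"
  assumes k: "k \<in> {1..n}" and sym: "\<And>a b. c a b = c b a"
  shows "(\<Sum>b\<in>{1..n}. \<Sum>a\<in>{1..<b}. ((if k = b then c a b else 0) - (if k = a then c a b else 0)) / (x b - x a))
     = (\<Sum>l\<in>{1..n}-{k}. c k l / (x k - x l))"
proof -
  have s: "{1..n}-{k} = {1..<k} \<union> {k<..n}" using k by auto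
  have "(\<Sum>b\<in>{1..n}. \<Sum>a\<in>{1..<b}. (if k = b then c a b else 0) / (x b - x a)) = (\<Sum>b\<in>{1..n}. if k = b then (\<Sum>a\<in>{1..<k}. c k a / (x k - x a)) else 0)"
    using sym by (intro sum.cong) auto
  also have "\<dots> = (\<Sum>a\<in>{1..<k}. c k a / (x k - x a))" using k by (subst sum.delta') auto
  finally have 1: "(\<Sum>b\<in>{1..n}. \<Sum>a\<in>{1..<b}. (if k = b then c a b else 0) / (x b - x a)) = (\<Sum>a\<in>{1..<k}. c k a / (x k - x a))" .
  have "(\<Sum>b\<in>{1..n}. \<Sum>a\<in>{1..<b}. (if k = a then c a b else 0) / (x b - x a)) = (\<Sum>b\<in>{1..n}. \<Sum>a\<in>{1..<b}. if k = a then c k b / (x b - x k) else 0)"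
    by (intro sum.cong) auto
  also have "\<dots> = (\<Sum>b\<in>{1..n}. if k < b then c k b / (x b - x k) else 0)"
    by (intro sum.cong refl, subst sum.delta') (use k in auto)
  also have "\<dots> = (\<Sum>b | b \<in> {1..n} \<and> k < b. c k b / (x b - x k))" by (rule sum.inter_filter[symmetric]) simp
  also have "{b. b \<in> {1..n} \<and> k < b} = {k<..n}" using k by auto
  also have "(\<Sum>b\<in>{k<..n}. c k b / (x b - x k)) = (\<Sum>b\<in>{k<..n}. - (c k b / (x k - x b)))"
    by (intro sum.cong refl) (metis minus_diff_eq minus_divide_right)
  finally have 2: "(\<Sum>b\<in>{1..n}. \<Sum>a\<in>{1..<b}. (if k = a then c a b else 0) / (x b - x a)) = - (\<Sum>b\<in>{k<..n}. c k b / (x k - x b))"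
    by (simp only: sum_negf)
  have "(\<Sum>b\<in>{1..n}. \<Sum>a\<in>{1..<b}. ((if k = b then c a b else 0) - (if k = a then c a b else 0)) / (x b - x a))
     = (\<Sum>a\<in>{1..<k}. c k a / (x k - x a)) + (\<Sum>b\<in>{k<..n}. c k b / (x k - x b))"
    by (simp only: diff_divide_distrib sum_subtractf 1 2 diff_minus_eq_add)
  also have "\<dots> = (\<Sum>l\<in>{1..n}-{k}. c k l / (x k - x l))"
    unfolding s by (rule sum.union_disjoint[symmetric]) auto
  finally show ?thesis .
qed

lemma deriv_on_sq:
  assumes "k \<in> {1..n}"
  shows "deriv_on n k (sq n) (\<lambda>x. 1/2 * (\<Sum>l\<in>{1..n}-{k}. 1 / (x k - x l)) * sq n x)"
proof -
  have sq: "sq n = (\<lambda>x. \<Prod>b\<in>{1..n}. \<Prod>a\<in>{1..<b}. (x b - x a) powr (1/2))" by (auto simp: sq_def)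
  have "deriv_on n k (\<lambda>x. (x b - x a) powr (1/2))
     (\<lambda>x. ((if k = b then 1/2 else 0) - (if k = a then 1/2 else 0)) / (x b - x a) * (x b - x a) powr (1/2))"
    if ab: "a \<in> {1..n}" "b \<in> {1..n}" "a < b" for a b
  proof (rule deriv_on_cong[OF deriv_on_diff_powr[OF ab]])
    fix x assume "x \<in> chamber n"
    then have "x b - x a > 0" using ab chamber_less by simp
    then have "(x b - x a) powr (1/2 - 1) = (x b - x a) powr (1/2) / (x b - x a)"
      using powr_diff[of "x b - x a" "1/2" 1] by simp
    then show "((if k = b then 1/2 else 0) - (if k = a then 1/2 else 0)) * (x b - x a) powr (1/2 - 1)
       = ((if k = b then 1/2 else 0) - (if k = a then 1/2 else 0)) / (x b - x a) * (x b - x a) powr (1/2)"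
      by (simp only: times_divide_eq_right times_divide_eq_left)
  qed
  then have "deriv_on n k (sq n) (\<lambda>x. (\<Sum>b\<in>{1..n}. \<Sum>a\<in>{1..<b}. ((if k = b then 1/2 else 0) - (if k = a then 1/2 else 0)) / (x b - x a)) * sq n x)"
    unfolding sq by (intro deriv_on_prod_log) auto
  moreover have "(\<Sum>l\<in>{1..n}-{k}. (1/2) / (x k - x l)) = 1/2 * (\<Sum>l\<in>{1..n}-{k}. 1 / (x k - x l))" for x :: "nat \<Rightarrow> real"
    by (simp add: sum_distrib_left)
  ultimately show ?thesis by (simp only: sum_pairs_at[OF assms, of "\<lambda>_ _. 1/2", OF refl])
qed

text \<open>For distinct \<open>k\<close>, \<open>l\<close>, \<open>m\<close> one has
  \<open>r k l * r l m + r k m * r m l = r k l * r k m\<close>. So the off-diagonal part of the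
  square is twice the sum over paths from \<open>k\<close> through \<open>l\<close> to a third index
  \<open>m\<close>. The term \<open>m = k\<close> of the last sum contributes
  \<open>- (r k l)\<^sup>2\<close>; compensating for it raises the coefficient of the squares from 1
  to 3.\<close>

lemma triple_sum_identity:
  fixes r :: "'a \<Rightarrow> 'a \<Rightarrow> real"
  assumes K: "finite K" "k \<in> K" and inj: "inj_on x K"
    and r: "\<And>i j. r i j = 1 / (x i - x j)"
  shows "(\<Sum>l\<in>K-{k}. r k l)\<^sup>2 = 3 * (\<Sum>l\<in>K-{k}. (r k l)\<^sup>2) + 2 * (\<Sum>l\<in>K-{k}. r k l * (\<Sum>m\<in>K-{l}. r l m))"
proof -
  define L where "L = K - {k}"
  have L: "finite L" "k \<notin> L" using K by (auto simp: L_def)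
  have neq: "x i \<noteq> x j" if "i \<in> K" "j \<in> K" "i \<noteq> j" for i j using inj that by (auto dest: inj_onD)
  define T where "T = (\<Sum>l\<in>L. \<Sum>m\<in>L-{l}. r k l * r l m)"
  define U where "U = (\<Sum>l\<in>L. \<Sum>m\<in>L-{l}. r k l * r k m)"
  have "T = (\<Sum>l\<in>L. \<Sum>m\<in>L-{l}. r k m * r m l)"
    unfolding T_def by (rule sum_offdiag_swap[OF L(1)])
  then have "2 * T = (\<Sum>l\<in>L. \<Sum>m\<in>L-{l}. r k l * r l m + r k m * r m l)"
    by (simp add: T_def sum.distrib)
  also have "\<dots> = U" unfolding U_def
  proof (intro sum.cong refl)
    fix l m assume lm: "l \<in> L" "m \<in> L - {l}"
    then have "x k \<noteq> x l" "x k \<noteq> x m" "x l \<noteq> x m" using neq K by (auto simp: L_def)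
    then show "r k l * r l m + r k m * r m l = r k l * r k m"
      unfolding r by (simp add: divide_simps) (simp add: algebra_simps)
  qed
  finally have TU: "2 * T = U" .
  have "(\<Sum>l\<in>L. r k l)\<^sup>2 = (\<Sum>l\<in>L. r k l * (r k l + (\<Sum>m\<in>L-{l}. r k m)))"
    unfolding power2_eq_square sum_distrib_right
    by (intro sum.cong refl) (simp add: L(1) sum.remove[of L])
  then have 1: "(\<Sum>l\<in>L. r k l)\<^sup>2 = (\<Sum>l\<in>L. (r k l)\<^sup>2) + U"
    by (simp add: U_def sum.distrib distrib_left sum_distrib_left power2_eq_square)
  have "(\<Sum>l\<in>L. r k l * (\<Sum>m\<in>K-{l}. r l m)) = (\<Sum>l\<in>L. - (r k l)\<^sup>2 + (\<Sum>m\<in>L-{l}. r k l * r l m))"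
  proof (intro sum.cong refl)
    fix l assume l: "l \<in> L"
    have "K - {l} = insert k (L - {l})" using l K by (auto simp: L_def)
    then have A: "(\<Sum>m\<in>K-{l}. r l m) = r l k + (\<Sum>m\<in>L-{l}. r l m)" using L by simp
    have B: "r l k = - r k l" unfolding r by (metis minus_diff_eq minus_divide_right)
    show "r k l * (\<Sum>m\<in>K-{l}. r l m) = - (r k l)\<^sup>2 + (\<Sum>m\<in>L-{l}. r k l * r l m)"
      unfolding A B distrib_left sum_distrib_left by (simp add: power2_eq_square)
  qed
  then have "(\<Sum>l\<in>L. r k l * (\<Sum>m\<in>K-{l}. r l m)) = - (\<Sum>l\<in>L. (r k l)\<^sup>2) + T"
    by (simp only: sum.distrib sum_negf T_def)
  with 1 TU show ?thesis unfolding L_def by simp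
qed

lemma deriv_on_log_sum:
  assumes "k \<in> {1..n}"
  shows "deriv_on n k (\<lambda>x. \<Sum>l\<in>{1..n}-{k}. 1 / (x k - x l)) (\<lambda>x. - (\<Sum>l\<in>{1..n}-{k}. (1 / (x k - x l))\<^sup>2))"
proof -
  have "deriv_on n k (\<lambda>x. \<Sum>l\<in>{1..n}-{k}. 1 / (x k - x l)) (\<lambda>x. \<Sum>l\<in>{1..n}-{k}. - (1 / (x k - x l))\<^sup>2)"
  proof (rule deriv_on_sum)
    fix l assume "l \<in> {1..n}-{k}"
    then show "deriv_on n k (\<lambda>x. 1 / (x k - x l)) (\<lambda>x. - (1 / (x k - x l))\<^sup>2)"
      using assms chamber_neq[of _ n k l] unfolding deriv_on_def
      by (auto intro!: derivative_eq_intros simp: power2_eq_square)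
  qed
  then show ?thesis by (simp add: sum_negf)
qed

text \<open>A chain rule along the diagonal under weak assumptions: differentiability in the first
  variable only at one point, and continuity of the derivative in the second one. It lets
  \<open>deriv_translation\<close> add one moving coordinate at a time.\<close>

lemma deriv_diagonal:
  fixes \<Phi> \<Phi>s :: "real \<Rightarrow> real \<Rightarrow> real"
  assumes e: "e > 0" and d0: "((\<lambda>t. \<Phi> t 0) has_real_derivative D) (at 0)"
    and ds: "\<And>s t. \<bar>t\<bar> < e \<Longrightarrow> \<bar>s\<bar> < e \<Longrightarrow> ((\<lambda>s. \<Phi> t s) has_real_derivative \<Phi>s t s) (at s)"
    and cont: "\<And>\<epsilon>. \<epsilon> > 0 \<Longrightarrow> \<exists>\<delta>>0. \<forall>t s. \<bar>t\<bar> < \<delta> \<longrightarrow> \<bar>s\<bar> < \<delta> \<longrightarrow> \<bar>\<Phi>s t s - \<Phi>s 0 0\<bar> < \<epsilon>"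
  shows "((\<lambda>t. \<Phi> t t) has_real_derivative D + \<Phi>s 0 0) (at 0)"
proof -
  have "((\<lambda>t. \<Phi> t t - \<Phi> t 0) has_real_derivative \<Phi>s 0 0) (at 0)"
    unfolding DERIV_def
  proof (rule LIM_I)
    fix r :: real assume r: "r > 0"
    obtain \<delta> where \<delta>: "\<delta> > 0" "\<And>t s. \<bar>t\<bar> < \<delta> \<Longrightarrow> \<bar>s\<bar> < \<delta> \<Longrightarrow> \<bar>\<Phi>s t s - \<Phi>s 0 0\<bar> < r/2"
      using cont[of "r/2"] r by auto
    have "norm ((\<Phi> (0 + h) (0 + h) - \<Phi> (0 + h) 0 - (\<Phi> 0 0 - \<Phi> 0 0)) / h - \<Phi>s 0 0) < r"
      if h: "h \<noteq> 0 \<and> norm (h - 0) < min e \<delta>" for h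
    proof -
      have S: "((\<lambda>s. \<Phi> h s - \<Phi>s 0 0 * s) has_field_derivative (\<Phi>s h s - \<Phi>s 0 0)) (at s within {-\<bar>h\<bar>..\<bar>h\<bar>})"
        if "s \<in> {-\<bar>h\<bar>..\<bar>h\<bar>}" for s
      proof -
        have "\<bar>h\<bar> < e" "\<bar>s\<bar> < e" using that h by auto
        from ds[OF this] have "((\<lambda>s. \<Phi> h s) has_field_derivative \<Phi>s h s) (at s within {-\<bar>h\<bar>..\<bar>h\<bar>})"
          by (rule has_field_derivative_at_within)
        then show ?thesis by (auto intro!: derivative_eq_intros)
      qed
      have "norm ((\<Phi> h h - \<Phi>s 0 0 * h) - (\<Phi> h 0 - \<Phi>s 0 0 * 0)) \<le> r/2 * norm (h - 0)"
      proof (rule field_differentiable_bound[OF _ S])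
        show "norm (\<Phi>s h s - \<Phi>s 0 0) \<le> r/2" if "s \<in> {-\<bar>h\<bar>..\<bar>h\<bar>}" for s
        proof -
          have "\<bar>h\<bar> < \<delta>" "\<bar>s\<bar> < \<delta>" using that h by auto
          from \<delta>(2)[OF this] show ?thesis by simp
        qed
      qed auto
      then have "\<bar>(\<Phi> h h - \<Phi> h 0) - \<Phi>s 0 0 * h\<bar> \<le> r/2 * \<bar>h\<bar>" by (simp add: algebra_simps)
      moreover have "(\<Phi> h h - \<Phi> h 0) / h - \<Phi>s 0 0 = ((\<Phi> h h - \<Phi> h 0) - \<Phi>s 0 0 * h) / h"
        using h by (simp add: field_simps)
      ultimately have "\<bar>(\<Phi> h h - \<Phi> h 0) / h - \<Phi>s 0 0\<bar> \<le> r/2"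
        using h by (simp add: divide_le_eq)
      then show ?thesis using r by simp
    qed
    then show "\<exists>s>0. \<forall>x. x \<noteq> 0 \<and> norm (x - 0) < s \<longrightarrow> norm ((\<Phi> (0 + x) (0 + x) - \<Phi> (0 + x) 0 - (\<Phi> 0 0 - \<Phi> 0 0)) / x - \<Phi>s 0 0) < r"
      using e \<delta>(1) by (intro exI[of _ "min e \<delta>"]) auto
  qed
  from DERIV_add[OF d0 this] show ?thesis by simp
qed

lemma deriv_translation:
  assumes g: "smooth_on_chamber n g" and x: "x \<in> chamber n" and m: "m \<le> n"
  shows "((\<lambda>t. g (\<lambda>i. if i \<in> {1..m} then x i + t else x i)) has_real_derivative (\<Sum>k\<in>{1..m}. partial k g x)) (at 0)"
  using m
proof (induction m)
  case (Suc m)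
  define y where "y t = (\<lambda>i. if i \<in> {1..m} then x i + t else x i)" for t :: real
  \<comment> \<open>The first parameter moves the coordinates up to \<open>m\<close>, the second one
    moves coordinate \<open>Suc m\<close>; on the diagonal all of them are translated
    together.\<close>
  define z where "z t s = (y t)(Suc m := x (Suc m) + s)" for t s :: real
  obtain e where e: "e > 0"
    "\<And>y. (\<And>i. i \<notin> {1..n} \<Longrightarrow> y i = undefined) \<Longrightarrow> (\<And>i. i \<in> {1..n} \<Longrightarrow> \<bar>y i - x i\<bar> < e) \<Longrightarrow> y \<in> chamber n"
    using chamber_open[OF x] by metis
  have zc: "z t s \<in> chamber n" if "\<bar>t - 0\<bar> < e" "\<bar>s - 0\<bar> < e" for t s
    by (rule e(2)) (use that x e(1) Suc.prems in \<open>auto simp: z_def y_def chamber_mem_iff\<close>)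
  have Sm: "Suc m \<in> {1..n}" using Suc.prems by auto
  have z0: "z 0 0 = x" by (auto simp: z_def y_def)
  have cont: "continuous_on UNIV (\<lambda>p. z (fst p) (snd p))"
  proof -
    have "continuous_on UNIV (\<lambda>p::real \<times> real. y (fst p))"
      unfolding y_def
    proof (rule continuous_on_coordinatewise_then_product)
      show "continuous_on UNIV (\<lambda>p::real \<times> real. if i \<in> {1..m} then x i + fst p else x i)" for i
        by (cases "i \<in> {1..m}") (auto intro!: continuous_intros)
    qed
    then show ?thesis unfolding z_def
      by (rule continuous_on_update) (intro continuous_intros)
  qed
  have "((\<lambda>t. g (z t t)) has_real_derivative (\<Sum>k\<in>{1..m}. partial k g x) + partial (Suc m) g (z 0 0)) (at 0)"
  proof (rule deriv_diagonal[OF e(1), where \<Phi> = "\<lambda>t s. g (z t s)" and \<Phi>s = "\<lambda>t s. partial (Suc m) g (z t s)"])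
    have "z t 0 = y t" for t by (auto simp: z_def y_def)
    then show "((\<lambda>t. g (z t 0)) has_real_derivative (\<Sum>k\<in>{1..m}. partial k g x)) (at 0)"
      using Suc by (simp add: y_def)
    fix s t :: real assume st: "\<bar>t\<bar> < e" "\<bar>s\<bar> < e"
    have "((\<lambda>u. g ((z t s)(Suc m := u))) has_real_derivative partial (Suc m) g (z t s)) (at (z t s (Suc m)))"
      using smooth_deriv_on[OF g Sm] zc[of t s] st unfolding deriv_on_def by auto
    moreover have "((\<lambda>u. x (Suc m) + u) has_real_derivative 1) (at s)"
      by (auto intro!: derivative_eq_intros)
    ultimately have "((\<lambda>u. g ((z t s)(Suc m := x (Suc m) + u))) has_real_derivative partial (Suc m) g (z t s)) (at s)"
      using DERIV_chain2[of "\<lambda>u. g ((z t s)(Suc m := u))" _ "\<lambda>u. x (Suc m) + u" s 1 UNIV]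
      by (simp add: z_def)
    then show "((\<lambda>s. g (z t s)) has_real_derivative partial (Suc m) g (z t s)) (at s)"
      by (simp add: z_def)
  next
    fix \<epsilon> :: real assume "\<epsilon> > 0"
    with chamber_section_cont[where y = z and a = 0 and b = 0, OF smooth_cont[OF smooth_partial[OF g Sm]] e(1) _ cont] zc
    have "\<exists>\<delta>>0. \<forall>t s. \<bar>t - 0\<bar> < \<delta> \<longrightarrow> \<bar>s - 0\<bar> < \<delta> \<longrightarrow> \<bar>partial (Suc m) g (z t s) - partial (Suc m) g (z 0 0)\<bar> < \<epsilon>"
      by blast
    then show "\<exists>\<delta>>0. \<forall>t s. \<bar>t\<bar> < \<delta> \<longrightarrow> \<bar>s\<bar> < \<delta> \<longrightarrow> \<bar>partial (Suc m) g (z t s) - partial (Suc m) g (z 0 0)\<bar> < \<epsilon>"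
      by (simp only: diff_0_right)
  qed
  then have D: "((\<lambda>t. g (z t t)) has_real_derivative (\<Sum>k\<in>{1..m}. partial k g x) + partial (Suc m) g x) (at 0)"
    unfolding z0 .
  have "z t t = (\<lambda>i. if i \<in> {1..Suc m} then x i + t else x i)" for t
    by (auto simp: z_def y_def)
  then show ?case using D by (simp add: add.commute)
qed simp

lemma sum_partial_translation_invariant:
  assumes g: "smooth_on_chamber n g" and x: "x \<in> chamber n"
    and inv: "\<And>t. g (\<lambda>i. if i \<in> {1..n} then x i + t else x i) = g x"
  shows "(\<Sum>k\<in>{1..n}. partial k g x) = 0"
  using deriv_translation[OF g x order_refl] unfolding inv by (metis DERIV_const DERIV_unique)

lemma COV_translation:
  assumes "COV n f" "x \<in> chamber n"
  shows "f (\<lambda>i. if i \<in> {1..n} then x i + t else x i) = f x"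
proof -
  have m: "moebius 1 t 0 1 = (\<lambda>z::real. z + t)" by (auto simp: moebius_def)
  have d: "deriv (\<lambda>z::real. z + t) z = 1" for z by (rule DERIV_imp_deriv) (auto intro!: derivative_eq_intros)
  have e: "(\<lambda>i\<in>{1..n}. x i + t) = (\<lambda>i. if i \<in> {1..n} then x i + t else x i)"
    using assms(2) by (auto simp: chamber_mem_iff restrict_def)
  have "f x = (\<Prod>i\<in>{1..n}. deriv (moebius 1 t 0 1) (x i) powr (1/4)) * f (\<lambda>i\<in>{1..n}. moebius 1 t 0 1 (x i))"
    using assms(1)[unfolded COV_def, rule_format, OF assms(2), of 1 1 t 0]
    using assms(2) by (simp add: m strict_mono_on_def chamber_less)
  then show ?thesis unfolding m d e by simp
qed

text \<open>Differentiating \<open>\<surd>V\<close> produces half of the sum \<open>W k\<close> of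
  the \<open>1 / (x k - x l)\<close>, and subtracting \<open>W k\<close> leaves the coefficient
  \<open>- 1/2\<close> in \<open>A k\<close>. For \<open>partial_A\<close> the second derivative is
  eliminated by the differential equation, whose potential contributes \<open>1/4\<close> of the sum
  \<open>R\<close> of the squares. With \<open>1/2\<close> from the derivative of \<open>W k\<close>
  this makes \<open>3/4\<close>, which is exactly what \<open>triple_sum_identity\<close> removes
  from \<open>(W k)\<^sup>2 / 4\<close>. This is where the value of \<kappa> enters.\<close>

theorem null_system_sq:
  assumes f: "smooth_on_chamber n f" and pde: "PDE n f" and cov: "COV n f"
  shows "null_system n (\<lambda>x. f x * sq n x)
    (\<lambda>k x. sq n x * (partial k f x - 1/2 * (\<Sum>l\<in>{1..n}-{k}. 1 / (x k - x l)) * f x))"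
proof
  show "smooth_on_chamber n (\<lambda>x. f x * sq n x)" by (intro smooth_mult f smooth_sq)
  show "smooth_on_chamber n (\<lambda>x. sq n x * (partial k f x - 1/2 * (\<Sum>l\<in>{1..n}-{k}. 1 / (x k - x l)) * f x))"
    if "k \<in> {1..n}" for k
    using that by (intro smooth_mult smooth_sq smooth_diff smooth_partial f smooth_const smooth_sum smooth_inverse_diff) auto
  have dH: "partial k (\<lambda>x. f x * sq n x) x = partial k f x * sq n x + f x * (1/2 * (\<Sum>l\<in>{1..n}-{k}. 1 / (x k - x l)) * sq n x)"
    if "x \<in> chamber n" "k \<in> {1..n}" for x k
    using that by (intro deriv_on_partial[where n=n] deriv_on_mult smooth_deriv_on f deriv_on_sq)
  show "sq n x * (partial k f x - 1/2 * (\<Sum>l\<in>{1..n}-{k}. 1 / (x k - x l)) * f x)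
     = partial k (\<lambda>x. f x * sq n x) x - (\<Sum>l\<in>{1..n}-{k}. 1 / (x k - x l)) * (f x * sq n x)"
    if "x \<in> chamber n" "k \<in> {1..n}" for x k
    unfolding dH[OF that] by (simp add: algebra_simps)
  show "(\<Sum>k\<in>{1..n}. partial k (\<lambda>x. f x * sq n x) x) = 0" if x: "x \<in> chamber n" for x
  proof (rule sum_partial_translation_invariant[OF _ x])
    show "smooth_on_chamber n (\<lambda>x. f x * sq n x)" by (intro smooth_mult f smooth_sq)
    show "f (\<lambda>i. if i \<in> {1..n} then x i + t else x i) * sq n (\<lambda>i. if i \<in> {1..n} then x i + t else x i) = f x * sq n x" for t
    proof -
      have "sq n (\<lambda>i. if i \<in> {1..n} then x i + t else x i) = sq n x"
        unfolding sq_def by (intro prod.cong) auto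
      then show ?thesis using COV_translation[OF cov x] by simp
    qed
  qed
  show "partial k (\<lambda>x. sq n x * (partial k f x - 1/2 * (\<Sum>l\<in>{1..n}-{k}. 1 / (x k - x l)) * f x)) x =
    (\<Sum>l\<in>{1..n}-{k}. sq n x * (partial l f x - 1/2 * (\<Sum>m\<in>{1..n}-{l}. 1 / (x l - x m)) * f x) / (x k - x l))"
    if x: "x \<in> chamber n" and k: "k \<in> {1..n}" for x k
  proof -
    define r where "r i j = 1 / (x i - x j)" for i j
    define W where "W i = (\<Sum>j\<in>{1..n}-{i}. r i j)" for i
    define R where "R = (\<Sum>l\<in>{1..n}-{k}. (r k l)\<^sup>2)"
    define P where "P = (\<Sum>l\<in>{1..n}-{k}. r k l * partial l f x)"
    have "deriv_on n k (\<lambda>x. sq n x * (partial k f x - 1/2 * (\<Sum>l\<in>{1..n}-{k}. 1 / (x k - x l)) * f x))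
      (\<lambda>x. 1/2 * (\<Sum>l\<in>{1..n}-{k}. 1 / (x k - x l)) * sq n x * (partial k f x - 1/2 * (\<Sum>l\<in>{1..n}-{k}. 1 / (x k - x l)) * f x)
        + sq n x * (partial k (partial k f) x - ((1/2 * (- (\<Sum>l\<in>{1..n}-{k}. (1 / (x k - x l))\<^sup>2))) * f x + 1/2 * (\<Sum>l\<in>{1..n}-{k}. 1 / (x k - x l)) * partial k f x)))"
      using k by (intro deriv_on_mult deriv_on_sq deriv_on_minus smooth_deriv_on smooth_partial f deriv_on_cmult deriv_on_log_sum)
    from deriv_on_partial[OF this x]
    have L: "partial k (\<lambda>x. sq n x * (partial k f x - 1/2 * (\<Sum>l\<in>{1..n}-{k}. 1 / (x k - x l)) * f x)) x =
       sq n x * (partial k (partial k f) x + 1/2 * R * f x - 1/4 * (W k)\<^sup>2 * f x)"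
      unfolding R_def W_def r_def by (simp add: algebra_simps power2_eq_square)
    have "2 * partial k (partial k f) x + (\<Sum>j\<in>{1..n}-{k}. 2 / (x j - x k) * partial j f x - 1 / (2 * (x j - x k)\<^sup>2) * f x) = 0"
      using pde x k unfolding PDE_def by blast
    also have "(\<Sum>j\<in>{1..n}-{k}. 2 / (x j - x k) * partial j f x - 1 / (2 * (x j - x k)\<^sup>2) * f x)
      = (\<Sum>j\<in>{1..n}-{k}. - 2 * (r k j * partial j f x) - 1/2 * ((r k j)\<^sup>2 * f x))"
    proof (intro sum.cong refl)
      fix j assume "j \<in> {1..n}-{k}"
      have A: "2 / (x j - x k) = - 2 * r k j"
        unfolding r_def by (metis minus_diff_eq minus_divide_right mult_minus_left mult_minus_right times_divide_eq_right mult.right_neutral)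
      have B: "1 / (2 * (x j - x k)\<^sup>2) = 1/2 * (r k j)\<^sup>2"
        unfolding r_def by (simp add: power_divide power2_commute)
      show "2 / (x j - x k) * partial j f x - 1 / (2 * (x j - x k)\<^sup>2) * f x = - 2 * (r k j * partial j f x) - 1/2 * ((r k j)\<^sup>2 * f x)"
        unfolding A B by simp
    qed
    also have "\<dots> = - 2 * P - 1/2 * (R * f x)"
      unfolding P_def R_def by (simp only: sum_subtractf sum_distrib_left sum_distrib_right)
    finally have E: "partial k (partial k f) x = P + 1/4 * R * f x" by simp
    have "inj_on x {1..n}" using chamber_neq[OF x] by (meson inj_onI)
    from triple_sum_identity[OF _ k this, of r]
    have T: "(W k)\<^sup>2 = 3 * R + 2 * (\<Sum>l\<in>{1..n}-{k}. r k l * W l)"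
      unfolding W_def R_def by (simp add: r_def)
    have "(\<Sum>l\<in>{1..n}-{k}. sq n x * (partial l f x - 1/2 * (\<Sum>m\<in>{1..n}-{l}. 1 / (x l - x m)) * f x) / (x k - x l))
      = (\<Sum>l\<in>{1..n}-{k}. sq n x * (r k l * partial l f x) - 1/2 * (sq n x * f x) * (r k l * W l))"
      by (intro sum.cong refl) (simp add: W_def r_def diff_divide_distrib right_diff_distrib mult_ac)
    also have "\<dots> = sq n x * P - 1/2 * (sq n x * f x) * (\<Sum>l\<in>{1..n}-{k}. r k l * W l)"
      by (simp only: sum_subtractf P_def sum_distrib_left)
    also have "\<dots> = sq n x * (partial k (partial k f) x + 1/2 * R * f x - 1/4 * (W k)\<^sup>2 * f x)"
      unfolding E T by (simp add: algebra_simps)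
    finally show ?thesis using L by simp
  qed
qed


section \<open>Polynomial functions\<close>

text \<open>Polynomials are kept as functions, so that \<open>partial\<close>, exchanges of
  coordinates and restrictions to walls or lines apply to them directly. Univariate polynomials
  appear only as restrictions to lines.\<close>

inductive polyfun :: "nat \<Rightarrow> ((nat \<Rightarrow> real) \<Rightarrow> real) \<Rightarrow> bool" for n where
  polyfun_const: "polyfun n (\<lambda>x. c)"
| polyfun_coord: "i \<in> {1..n} \<Longrightarrow> polyfun n (\<lambda>x. x i)"
| polyfun_add: "polyfun n P \<Longrightarrow> polyfun n R \<Longrightarrow> polyfun n (\<lambda>x. P x + R x)"
| polyfun_mult: "polyfun n P \<Longrightarrow> polyfun n R \<Longrightarrow> polyfun n (\<lambda>x. P x * R x)"

lemma polyfun_cmult: "polyfun n P \<Longrightarrow> polyfun n (\<lambda>x. c * P x)"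
  by (intro polyfun_mult polyfun_const)

lemma polyfun_diff: "polyfun n P \<Longrightarrow> polyfun n R \<Longrightarrow> polyfun n (\<lambda>x. P x - R x)"
  using polyfun_add[OF _ polyfun_cmult[of n R "-1"], of P] by simp

lemma polyfun_sum: "(\<And>k. k \<in> K \<Longrightarrow> polyfun n (f k)) \<Longrightarrow> polyfun n (\<lambda>x. \<Sum>k\<in>K. f k x)"
  by (induction K rule: infinite_finite_induct) (auto intro: polyfun.intros)

lemma polyfun_prod: "(\<And>k. k \<in> K \<Longrightarrow> polyfun n (f k)) \<Longrightarrow> polyfun n (\<lambda>x. \<Prod>k\<in>K. f k x)"
  by (induction K rule: infinite_finite_induct) (auto intro: polyfun.intros)

lemma polyfun_power: "polyfun n P \<Longrightarrow> polyfun n (\<lambda>x. P x ^ k)"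
  by (induction k) (auto intro: polyfun.intros)

lemma polyfun_cong_arg: "polyfun n P \<Longrightarrow> (\<And>i. i \<in> {1..n} \<Longrightarrow> x i = y i) \<Longrightarrow> P x = P y"
  by (induction rule: polyfun.induct) auto

lemma polyfun_comp: "polyfun n P \<Longrightarrow> (\<And>i. i \<in> {1..n} \<Longrightarrow> polyfun m (g i)) \<Longrightarrow> polyfun m (\<lambda>x. P (\<lambda>i. g i x))"
  by (induction rule: polyfun.induct) (auto intro: polyfun.intros)

lemma polyfun_update:
  assumes "polyfun n P" "polyfun n R"
  shows "polyfun n (\<lambda>x. P (x(k := R x)))"
proof -
  have "polyfun n (\<lambda>x. P (\<lambda>i. (if i = k then R else (\<lambda>x. x i)) x))"
    by (rule polyfun_comp[OF assms(1)]) (use assms(2) polyfun_coord in auto)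
  moreover have "(\<lambda>i. (if i = k then R else (\<lambda>x. x i)) x) = x(k := R x)" for x by auto
  ultimately show ?thesis by simp
qed

lemma polyfun_line: "polyfun n P \<Longrightarrow> \<exists>p. \<forall>t. P (\<lambda>i. a i + t * b i) = poly p t"
proof (induction rule: polyfun.induct)
  case (polyfun_const c)
  show ?case by (rule exI[of _ "[:c:]"]) simp
next
  case (polyfun_coord i)
  show ?case by (rule exI[of _ "[:a i, b i:]"]) simp
next
  case (polyfun_add P R)
  then obtain p q where "\<forall>t. P (\<lambda>i. a i + t * b i) = poly p t" "\<forall>t. R (\<lambda>i. a i + t * b i) = poly q t" by auto
  then show ?case by (intro exI[of _ "p + q"]) simp
next
  case (polyfun_mult P R)
  then obtain p q where "\<forall>t. P (\<lambda>i. a i + t * b i) = poly p t" "\<forall>t. R (\<lambda>i. a i + t * b i) = poly q t" by auto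
  then show ?case by (intro exI[of _ "p * q"]) simp
qed

lemma polyfun_update_poly:
  assumes "polyfun n P"
  shows "\<exists>p. \<forall>t. P (x(k := t)) = poly p t"
proof -
  have "(\<lambda>i. (x(k := 0)) i + t * (if i = k then 1 else 0)) = x(k := t)" for t by auto
  then show ?thesis using polyfun_line[OF assms, of "x(k := 0)" "\<lambda>i. if i = k then 1 else 0"] by simp
qed

lemma polyfun_partial_ex:
  "polyfun n P \<Longrightarrow> \<exists>P'. polyfun n P' \<and> (\<forall>x. ((\<lambda>t. P (x(i := t))) has_real_derivative P' x) (at (x i)))"
proof (induction rule: polyfun.induct)
  case (polyfun_const c)
  show ?case by (rule exI[of _ "\<lambda>x. 0"]) (auto intro: polyfun.intros)
next
  case (polyfun_coord j)
  show ?case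
    by (rule exI[of _ "\<lambda>x. if i = j then 1 else 0"]) (auto intro: polyfun.intros)
next
  case (polyfun_add P R)
  then obtain P' R' where "polyfun n P'" "polyfun n R'" "\<forall>x. ((\<lambda>t. P (x(i := t))) has_real_derivative P' x) (at (x i))"
    "\<forall>x. ((\<lambda>t. R (x(i := t))) has_real_derivative R' x) (at (x i))" by blast
  then show ?case
    by (intro exI[of _ "\<lambda>x. P' x + R' x"] conjI allI DERIV_add polyfun.polyfun_add) blast+
next
  case (polyfun_mult P R)
  then obtain P' R' where "polyfun n P'" "polyfun n R'" "\<forall>x. ((\<lambda>t. P (x(i := t))) has_real_derivative P' x) (at (x i))"
    "\<forall>x. ((\<lambda>t. R (x(i := t))) has_real_derivative R' x) (at (x i))" by blast
  then have "((\<lambda>t. P (x(i := t)) * R (x(i := t))) has_real_derivative P' x * R (x(i := x i)) + R' x * P (x(i := x i))) (at (x i))" for x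
    by (intro DERIV_mult) blast+
  then have D: "((\<lambda>t. P (x(i := t)) * R (x(i := t))) has_real_derivative P' x * R x + R' x * P x) (at (x i))" for x
    by (simp only: fun_upd_triv)
  have "polyfun n (\<lambda>x. P' x * R x + R' x * P x)"
    using polyfun_mult.hyps \<open>polyfun n P'\<close> \<open>polyfun n R'\<close> by (intro polyfun.polyfun_add polyfun.polyfun_mult)
  with D show ?case by blast
qed

lemma polyfun_partial_deriv:
  assumes "polyfun n P"
  shows "((\<lambda>t. P (x(i := t))) has_real_derivative partial i P x) (at (x i))"
  using polyfun_partial_ex[OF assms, of i] unfolding partial_def by (metis DERIV_imp_deriv)

lemma polyfun_partial:
  assumes "polyfun n P"
  shows "polyfun n (partial i P)"
proof -
  obtain P' where P': "polyfun n P'" "\<forall>x. ((\<lambda>t. P (x(i := t))) has_real_derivative P' x) (at (x i))"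
    using polyfun_partial_ex[OF assms] by blast
  then have "partial i P = P'" unfolding partial_def by (auto intro: DERIV_imp_deriv)
  then show ?thesis using P'(1) by simp
qed

lemma partial_eqI: "((\<lambda>t. P (x(i := t))) has_real_derivative D) (at (x i)) \<Longrightarrow> partial i P x = D"
  unfolding partial_def by (rule DERIV_imp_deriv)

lemma polyfun_partial_add: "polyfun n P \<Longrightarrow> polyfun n R \<Longrightarrow> partial i (\<lambda>x. P x + R x) x = partial i P x + partial i R x"
  by (rule partial_eqI) (intro DERIV_add polyfun_partial_deriv)

lemma polyfun_partial_mult: "polyfun n P \<Longrightarrow> polyfun n R \<Longrightarrow> partial i (\<lambda>x. P x * R x) x = partial i P x * R x + P x * partial i R x"
  using DERIV_mult[OF polyfun_partial_deriv[of n P x i] polyfun_partial_deriv[of n R x i]]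
  by (intro partial_eqI) (simp add: mult.commute)

lemma polyfun_partial_cmult: "polyfun n P \<Longrightarrow> partial i (\<lambda>x. c * P x) x = c * partial i P x"
  by (rule partial_eqI) (intro DERIV_cmult polyfun_partial_deriv)

lemma polyfun_partial_sum: "(\<And>k. k \<in> K \<Longrightarrow> polyfun n (f k)) \<Longrightarrow> partial i (\<lambda>x. \<Sum>k\<in>K. f k x) x = (\<Sum>k\<in>K. partial i (f k) x)"
  by (rule partial_eqI) (intro DERIV_sum polyfun_partial_deriv)

lemma polyfun_line_deriv:
  "polyfun n P \<Longrightarrow> ((\<lambda>t. P (\<lambda>i. a i + t * b i)) has_real_derivative (\<Sum>i\<in>{1..n}. b i * partial i P (\<lambda>i. a i + t * b i))) (at t)"
proof (induction rule: polyfun.induct)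
  case (polyfun_const c)
  have "partial i (\<lambda>x. c) x = 0" for i x by (rule partial_eqI) auto
  then show ?case by simp
next
  case (polyfun_coord j)
  have "partial i (\<lambda>x. x j) x = (if i = j then 1 else 0)" for i x by (rule partial_eqI) auto
  then show ?case using polyfun_coord by (auto intro!: derivative_eq_intros simp: if_distrib[of "(*) _"] cong: if_cong)
next
  case (polyfun_add P R)
  show ?case
    using DERIV_add[OF polyfun_add.IH] by (simp add: polyfun_partial_add[OF polyfun_add.hyps] distrib_left sum.distrib)
next
  case (polyfun_mult P R)
  show ?case
    using DERIV_mult[OF polyfun_mult.IH]
    by (simp add: polyfun_partial_mult[OF polyfun_mult.hyps] distrib_left sum.distrib sum_distrib_left sum_distrib_right mult_ac)
qed

lemma polyfun_smooth: "polyfun n P \<Longrightarrow> smooth_on_chamber n P"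
proof (induction rule: polyfun.induct)
  case (polyfun_coord i)
  have "Ck_on_chamber n k (\<lambda>x. x i)" for k
  proof (cases k)
    case (Suc m)
    show ?thesis unfolding Suc
    proof (rule Ck_SucI[where f' = "\<lambda>j x. if j = i then 1 else 0"])
      show "deriv_on n j (\<lambda>x. x i) (\<lambda>x. if j = i then 1 else 0)" for j
        unfolding deriv_on_def by auto
      show "Ck_on_chamber n m (\<lambda>x. if j = i then 1 else 0)" for j by (rule Ck_const)
    qed (rule continuous_on_coordinate)
  qed (simp add: continuous_on_coordinate)
  then show ?case by (simp add: smooth_on_chamber_def)
qed (auto intro: smooth_const smooth_add smooth_mult)

text \<open>Along the line from \<open>x0\<close> to an arbitrary \<open>y\<close> the restriction
  is a univariate polynomial with infinitely many zeros. The point \<open>y\<close> need not lie in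
  the chamber, and this carries identities from the chamber to the whole space.\<close>

lemma polyfun_zero_near:
  assumes P: "polyfun n P" and x0: "x0 \<in> chamber n" and e: "e > 0"
    and zero: "\<And>x. x \<in> chamber n \<Longrightarrow> (\<And>i. i \<in> {1..n} \<Longrightarrow> \<bar>x i - x0 i\<bar> < e) \<Longrightarrow> P x = 0"
  shows "P y = 0"
proof -
  define b where "b i = y i - x0 i" for i
  obtain p where p: "\<And>t. P (\<lambda>i. x0 i + t * b i) = poly p t" using polyfun_line[OF P] by blast
  obtain e' where e': "e' > 0"
    "\<And>y. (\<And>i. i \<notin> {1..n} \<Longrightarrow> y i = undefined) \<Longrightarrow> (\<And>i. i \<in> {1..n} \<Longrightarrow> \<bar>y i - x0 i\<bar> < e') \<Longrightarrow> y \<in> chamber n"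
    using chamber_open[OF x0] by metis
  \<comment> \<open>A bound on the speed of the line in every coordinate; the summand 1 makes it
    strict and positive.\<close>
  define B where "B = (\<Sum>i\<in>{1..n}. \<bar>b i\<bar>) + 1"
  have B: "\<bar>b i\<bar> < B" if "i \<in> {1..n}" for i
    using member_le_sum[of i "{1..n}" "\<lambda>i. \<bar>b i\<bar>"] that by (simp add: B_def)
  have Bpos: "B > 0" unfolding B_def by (smt (verit) sum_nonneg abs_ge_zero)
  have z: "poly p t = 0" if t: "t \<in> {0<..<min e e' / B}" for t
  proof -
    define z where "z = (\<lambda>i. if i \<in> {1..n} then x0 i + t * b i else undefined)"
    have zz: "\<bar>z i - x0 i\<bar> < min e e'" if i: "i \<in> {1..n}" for i
    proof -
      have "\<bar>t * b i\<bar> \<le> t * B" using t B[OF i] by (simp add: abs_mult)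
      also have "t * B < min e e'" using t Bpos by (simp add: pos_less_divide_eq)
      finally show ?thesis using i by (simp add: z_def)
    qed
    have "z \<in> chamber n" by (rule e'(2)) (use zz in \<open>auto simp: z_def\<close>)
    then have "P z = 0" by (rule zero) (use zz in auto)
    moreover have "P (\<lambda>i. x0 i + t * b i) = P z" by (rule polyfun_cong_arg[OF P]) (auto simp: z_def)
    ultimately show ?thesis by (simp add: p)
  qed
  have "min e e' / B > 0" using e e'(1) Bpos by simp
  then have "infinite {0<..<min e e' / B}" by simp
  then have "infinite {t. poly p t = 0}" by (rule infinite_super[rotated]) (use z in auto)
  then have "p = 0" using poly_roots_finite by blast
  then have "P (\<lambda>i. x0 i + 1 * b i) = 0" by (simp only: p) simp
  then show ?thesis by (simp add: b_def)
qed

lemma real_in_chamber: "(\<lambda>i. if i \<in> {1..n} then real i + c else undefined) \<in> chamber n"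
  by (auto simp: chamber_mem_iff)

lemma polyfun_zero_chamber:
  assumes "polyfun n P" "\<And>x. x \<in> chamber n \<Longrightarrow> P x = 0"
  shows "P y = 0"
  using polyfun_zero_near[OF assms(1) real_in_chamber[of n 0], of 1] assms(2) by auto

text \<open>Known on the chamber from Schwarz's theorem, and true everywhere because the difference
  is a polynomial.\<close>

lemma polyfun_partial_commute:
  assumes P: "polyfun n P" and ij: "i \<in> {1..n}" "j \<in> {1..n}"
  shows "partial i (partial j P) x = partial j (partial i P) x"
proof -
  have "partial i (partial j P) x - partial j (partial i P) x = 0"
    by (rule polyfun_zero_chamber[of n])
       (use partial_commute[OF polyfun_smooth[OF P] _ ij] in \<open>auto intro!: polyfun_diff polyfun_partial P\<close>)
  then show ?thesis by simp
qed

lemma smooth_funpow: "smooth_on_chamber n G \<Longrightarrow> i \<in> {1..n} \<Longrightarrow> smooth_on_chamber n ((partial i ^^ m) G)"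
  by (induction m) (auto intro: smooth_partial)

lemma funpow_partial_commute1:
  assumes "smooth_on_chamber n G" "i \<in> {1..n}" "j \<in> {1..n}"
  shows "x \<in> chamber n \<Longrightarrow> (partial i ^^ m) (partial j G) x = partial j ((partial i ^^ m) G) x"
proof (induction m arbitrary: x)
  case (Suc m)
  then have "(partial i ^^ Suc m) (partial j G) x = partial i (partial j ((partial i ^^ m) G)) x"
    using partial_cong[of n "(partial i ^^ m) (partial j G)" "partial j ((partial i ^^ m) G)"] assms by simp
  also have "\<dots> = partial j ((partial i ^^ Suc m) G) x"
    using partial_commute[OF smooth_funpow[OF assms(1,2)] Suc.prems assms(2,3)] by simp
  finally show ?case .
qed auto

lemma funpow_partial_zero:
  assumes G: "smooth_on_chamber n G" and ij: "i \<in> {1..n}" "j \<in> {1..n}"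
    and z: "\<And>x. x \<in> chamber n \<Longrightarrow> (partial i ^^ m) G x = 0"
  shows "x \<in> chamber n \<Longrightarrow> (partial i ^^ m) ((partial j ^^ k) G) x = 0"
proof (induction k arbitrary: x)
  case (Suc k)
  have "(partial i ^^ m) ((partial j ^^ Suc k) G) x = partial j ((partial i ^^ m) ((partial j ^^ k) G)) x"
    using funpow_partial_commute1[OF smooth_funpow[OF G ij(2)] ij Suc.prems] by simp
  also have "\<dots> = partial j (\<lambda>x. 0) x"
    by (rule partial_cong[of n]) (use Suc ij in auto)
  also have "\<dots> = 0" by (simp add: partial_def)
  finally show ?case .
qed (use z in auto)

text \<open>A one-variable Taylor expansion about a point above \<open>y i\<close>; the remainder is
  zero because the derivative of order \<open>m\<close> vanishes along the section.\<close>

lemma taylor_section: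
  assumes G: "smooth_on_chamber n G" and i: "i \<in> {1..n}" and n: "m > 0"
    and z: "\<And>x. x \<in> chamber n \<Longrightarrow> (partial i ^^ m) G x = 0"
    and y: "\<And>t. t \<in> {y i..c} \<Longrightarrow> y(i := t) \<in> chamber n" and le: "y i \<le> c"
  shows "G y = (\<Sum>k<m. (y i - c) ^ k / fact k * (partial i ^^ k) G (y(i := c)))"
proof (cases "y i = c")
  case True
  have "(\<Sum>k<m. (y i - c) ^ k / fact k * (partial i ^^ k) G (y(i := c))) =
      (\<Sum>k\<in>{0}. (y i - c) ^ k / fact k * (partial i ^^ k) G (y(i := c)))"
    by (rule sum.mono_neutral_right) (use n True in auto)
  then show ?thesis using True by (simp add: fun_upd_idem)
next
  case False
  have "\<exists>t. y i < t \<and> t < c \<and> G (y(i := y i)) = (\<Sum>k<m. ((partial i ^^ k) G (y(i := c)) / fact k) * (y i - c) ^ k) +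
       ((partial i ^^ m) G (y(i := t)) / fact m) * (y i - c) ^ m"
  proof (rule Taylor_down[where b = c and f = "\<lambda>t. G (y(i := t))" and diff = "\<lambda>k t. (partial i ^^ k) G (y(i := t))"])
    show "\<forall>k t. k < m \<and> y i \<le> t \<and> t \<le> c \<longrightarrow>
       DERIV (\<lambda>t. (partial i ^^ k) G (y(i := t))) t :> (partial i ^^ Suc k) G (y(i := t))"
    proof (intro allI impI)
      fix k t assume "k < m \<and> y i \<le> t \<and> t \<le> c"
      then have "y(i := t) \<in> chamber n" using y by auto
      then have "((\<lambda>s. (partial i ^^ k) G ((y(i := t))(i := s))) has_real_derivative partial i ((partial i ^^ k) G) (y(i := t))) (at ((y(i := t)) i))"
        using smooth_deriv_on[OF smooth_funpow[OF G i] i] unfolding deriv_on_def by blast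
      then show "DERIV (\<lambda>t. (partial i ^^ k) G (y(i := t))) t :> (partial i ^^ Suc k) G (y(i := t))" by simp
    qed
  qed (use n False le in simp_all)
  then obtain t where t: "y i < t" "t < c" "G y = (\<Sum>k<m. ((partial i ^^ k) G (y(i := c)) / fact k) * (y i - c) ^ k) +
       ((partial i ^^ m) G (y(i := t)) / fact m) * (y i - c) ^ m" by auto
  moreover have "(partial i ^^ m) G (y(i := t)) = 0" using z y t by auto
  ultimately show ?thesis by (simp add: mult.commute)
qed

text \<open>Coordinates are raised to those of \<open>q\<close> one after the other, starting from
  the last one. The chamber is not a box, so the order matters: when coordinate \<open>j\<close>
  moves up to \<open>q j\<close>, the higher ones already agree with \<open>q\<close> and stay above
  it. The derivatives of \<open>G\<close> in direction \<open>j\<close> satisfy the same hypotheses,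
  which is why \<open>G\<close> is generalised in the induction.\<close>

lemma taylor_polyfun_below:
  assumes q: "q \<in> chamber n" and n: "n > 0"
    and G: "smooth_on_chamber n G" and z: "\<And>x i. x \<in> chamber n \<Longrightarrow> i \<in> {1..n} \<Longrightarrow> (partial i ^^ n) G x = 0"
    and m: "m \<le> n"
  shows "\<exists>P. polyfun n P \<and> (\<forall>y\<in>chamber n. (\<forall>i\<in>{1..n}. y i \<le> q i) \<longrightarrow> (\<forall>i\<in>{m<..n}. y i = q i) \<longrightarrow> G y = P y)"
  using m G z
proof (induction m arbitrary: G)
  case 0
  have "y = q" if "y \<in> chamber n" "\<forall>i\<in>{0<..n}. y i = q i" for y
  proof
    fix i show "y i = q i"
      by (cases "i \<in> {1..n}") (use that q in \<open>simp_all add: chamber_mem_iff\<close>)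
  qed
  then show ?case by (intro exI[of _ "\<lambda>x. G q"] conjI polyfun_const) blast
next
  case (Suc m)
  define j where "j = Suc m"
  have j: "j \<in> {1..n}" using Suc.prems by (auto simp: j_def)
  define Gk where "Gk k = (partial j ^^ k) G" for k
  have "\<exists>P. polyfun n P \<and> (\<forall>y\<in>chamber n. (\<forall>i\<in>{1..n}. y i \<le> q i) \<longrightarrow> (\<forall>i\<in>{m<..n}. y i = q i) \<longrightarrow> Gk k y = P y)" for k
    unfolding Gk_def
    by (rule Suc.IH) (use Suc.prems j in \<open>auto intro: smooth_funpow intro!: funpow_partial_zero[OF Suc.prems(2)]\<close>)
  then obtain Pk where Pk: "\<And>k. polyfun n (Pk k)"
    "\<And>k y. y \<in> chamber n \<Longrightarrow> (\<forall>i\<in>{1..n}. y i \<le> q i) \<Longrightarrow> (\<forall>i\<in>{m<..n}. y i = q i) \<Longrightarrow> Gk k y = Pk k y"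
    by metis
  define P where "P y = (\<Sum>k<n. (1 / fact k * (y j - q j) ^ k) * Pk k (y(j := q j)))" for y
  have "polyfun n P" unfolding P_def
    by (intro polyfun_sum polyfun_mult polyfun_const polyfun_power polyfun_diff polyfun_coord j polyfun_update Pk(1))
  moreover have "G y = P y" if y: "y \<in> chamber n" "\<forall>i\<in>{1..n}. y i \<le> q i" "\<forall>i\<in>{Suc m<..n}. y i = q i" for y
  proof -
    have yt: "y(j := t) \<in> chamber n" if t: "t \<in> {y j..q j}" for t
    proof -
      have "(y(j := t)) a < (y(j := t)) b" if ab: "a \<in> {1..n}" "b \<in> {1..n}" "a < b" for a b
      proof -
        have "y a < y b" using chamber_less[OF y(1)] ab by simp
        moreover have "t < y b" if "a = j"
        proof -
          have "y b = q b" using y(3) ab that by (auto simp: j_def)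
          moreover have "q j < q b" using chamber_less[OF q j ab(2)] ab that by simp
          ultimately show ?thesis using t by simp
        qed
        ultimately show ?thesis using t ab by auto
      qed
      then show ?thesis using y(1) j by (auto simp: chamber_mem_iff)
    qed
    have "G y = (\<Sum>k<n. (y j - q j) ^ k / fact k * Gk k (y(j := q j)))"
      unfolding Gk_def by (rule taylor_section[OF Suc.prems(2) j n Suc.prems(3) yt]) (use j y in auto)
    also have "\<dots> = P y" unfolding P_def
    proof (intro sum.cong refl)
      fix k
      have "Gk k (y(j := q j)) = Pk k (y(j := q j))"
        by (rule Pk(2)) (use yt[of "q j"] y j in \<open>auto simp: j_def\<close>)
      then show "(y j - q j) ^ k / fact k * Gk k (y(j := q j)) = 1 / fact k * (y j - q j) ^ k * Pk k (y(j := q j))" by simp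
    qed
    finally show ?thesis .
  qed
  ultimately show ?case by blast
qed

text \<open>The polynomials found below different points \<open>q\<close> have to be identified. Any
  two points of the family \<open>q0\<close> have a common open set of chamber points below them,
  and this determines the polynomial.\<close>

theorem polyfun_if_funpow_partial_zero:
  assumes n: "n > 0" and G: "smooth_on_chamber n G"
    and z: "\<And>x i. x \<in> chamber n \<Longrightarrow> i \<in> {1..n} \<Longrightarrow> (partial i ^^ n) G x = 0"
  shows "\<exists>P. polyfun n P \<and> (\<forall>y\<in>chamber n. G y = P y)"
proof -
  have ex: "\<exists>P. polyfun n P \<and> (\<forall>y\<in>chamber n. (\<forall>i\<in>{1..n}. y i \<le> q i) \<longrightarrow> G y = P y)"
    if "q \<in> chamber n" for q
    using taylor_polyfun_below[OF that n G z, of n] by auto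
  define q0 where "q0 c = (\<lambda>i. if i \<in> {1..n} then real i + c else undefined)" for c
  have q0: "q0 c \<in> chamber n" for c unfolding q0_def by (rule real_in_chamber)
  obtain P0 where P0: "polyfun n P0" "\<And>y. y \<in> chamber n \<Longrightarrow> (\<forall>i\<in>{1..n}. y i \<le> q0 0 i) \<Longrightarrow> G y = P0 y"
    using ex[OF q0[of 0]] by auto
  have "G y = P0 y" if y: "y \<in> chamber n" for y
  proof -
    define c where "c = (\<Sum>i\<in>{1..n}. \<bar>y i\<bar>)"
    have c: "y i \<le> q0 c i" if "i \<in> {1..n}" for i
      using member_le_sum[of i "{1..n}" "\<lambda>i. \<bar>y i\<bar>"] that by (simp add: c_def q0_def)
    have c0: "c \<ge> 0" by (simp add: c_def sum_nonneg)
    obtain P where P: "polyfun n P" "\<And>y. y \<in> chamber n \<Longrightarrow> (\<forall>i\<in>{1..n}. y i \<le> q0 c i) \<Longrightarrow> G y = P y"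
      using ex[OF q0[of c]] by auto
    \<comment> \<open>Points within distance 1 of \<open>q0 (-1)\<close> lie below
      \<open>q0 0\<close>, hence also below \<open>q0 c\<close>, so both polynomials equal
      \<open>G\<close> there.\<close>
    have "P y - P0 y = 0"
    proof (rule polyfun_zero_near[OF polyfun_diff[OF P(1) P0(1)] q0[of "-1"], of 1])
      fix x assume x: "x \<in> chamber n" "\<And>i. i \<in> {1..n} \<Longrightarrow> \<bar>x i - q0 (-1) i\<bar> < 1"
      have "x i \<le> q0 0 i \<and> x i \<le> q0 c i" if "i \<in> {1..n}" for i
        using x(2)[OF that] that c0 by (auto simp: q0_def)
      then show "P x - P0 x = 0" using P(2)[OF x(1)] P0(2)[OF x(1)] by auto
    qed simp
    then show ?thesis using P(2)[OF y] c by auto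
  qed
  then show ?thesis using P0(1) by blast
qed

text \<open>The growth is measured at minus infinity because the first coordinate of a chamber point
  can only escape in this direction.\<close>

lemma degree_le_if_power_bound:
  fixes p :: "real poly"
  assumes "\<And>t. t < T \<Longrightarrow> \<bar>poly p t\<bar> \<le> M * (c - t) ^ d" 
  shows "degree p \<le> d"
proof (rule ccontr)
  assume "\<not> degree p \<le> d"
  then obtain k where k: "degree p = d + Suc k" by (metis add_Suc_right less_iff_Suc_add not_le)
  have "((\<lambda>t. poly p t / t ^ degree p) \<longlongrightarrow> lead_coeff p) at_bot"
    by (rule tendsto_mono[OF _ poly_divide_tendsto_aux]) (simp add: at_bot_le_at_infinity)
  then have "((\<lambda>t. \<bar>poly p t / t ^ degree p\<bar>) \<longlongrightarrow> \<bar>lead_coeff p\<bar>) at_bot" by (rule tendsto_rabs)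
  moreover have "((\<lambda>t. \<bar>poly p t / t ^ degree p\<bar>) \<longlongrightarrow> 0) at_bot"
  proof (rule tendsto_sandwich)
    show "\<forall>\<^sub>F t in at_bot. (0::real) \<le> \<bar>poly p t / t ^ degree p\<bar>" by simp
    have "\<forall>\<^sub>F t::real in at_bot. t < min T (min 0 c)" by (rule eventually_gt_at_bot)
    then show "\<forall>\<^sub>F t in at_bot. \<bar>poly p t / t ^ degree p\<bar> \<le> \<bar>M\<bar> * \<bar>(c / t - 1) ^ d * (1 / t) ^ Suc k\<bar>"
    proof eventually_elim
      case (elim t)
      have "\<bar>poly p t / t ^ degree p\<bar> \<le> \<bar>M * (c - t) ^ d\<bar> / \<bar>t ^ degree p\<bar>"
        using assms[of t] elim by (auto simp: abs_divide intro!: divide_right_mono)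
      also have "\<dots> = \<bar>M\<bar> * \<bar>((c - t) / t) ^ d * (1 / t) ^ Suc k\<bar>"
        by (simp add: k abs_mult power_add power_divide abs_divide)
      also have "(c - t) / t = c / t - 1" using elim by (simp add: field_simps)
      finally show ?case .
    qed
    have inf: "((\<lambda>t. a / t) \<longlongrightarrow> 0) at_bot" for a :: real
      by (rule tendsto_divide_0[OF tendsto_const]) (simp add: filterlim_at_bot_imp_at_infinity filterlim_ident)
    have "((\<lambda>t. \<bar>M\<bar> * \<bar>(c / t - 1) ^ d * (1 / t) ^ Suc k\<bar>) \<longlongrightarrow> \<bar>M\<bar> * \<bar>(0 - 1) ^ d * 0 ^ Suc k\<bar>) at_bot"
      by (intro tendsto_intros inf)
    then show "((\<lambda>t. \<bar>M\<bar> * \<bar>(c / t - 1) ^ d * (1 / t) ^ Suc k\<bar>) \<longlongrightarrow> 0) at_bot" by simp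
  qed auto
  ultimately have "\<bar>lead_coeff p\<bar> = 0" by (rule tendsto_unique[OF trivial_limit_at_bot_linorder])
  then have "p = 0" by (simp only: abs_eq_0 leading_coeff_0_iff)
  then show False using k by simp
qed


section \<open>Uniqueness of harmonic polynomials vanishing on the walls\<close>

definition lap :: "nat \<Rightarrow> ((nat \<Rightarrow> real) \<Rightarrow> real) \<Rightarrow> (nat \<Rightarrow> real) \<Rightarrow> real" where
  "lap n P = (\<lambda>x. \<Sum>i\<in>{1..n}. partial i (partial i P) x)"

lemma lap_add:
  assumes "polyfun n P" "polyfun n R"
  shows "lap n (\<lambda>x. P x + R x) x = lap n P x + lap n R x"
proof -
  have "partial i (\<lambda>x. P x + R x) = (\<lambda>x. partial i P x + partial i R x)" for i
    using polyfun_partial_add[OF assms] by blast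
  then show ?thesis
    using polyfun_partial_add[OF polyfun_partial[OF assms(1)] polyfun_partial[OF assms(2)]]
    by (simp add: lap_def sum.distrib)
qed

lemma lap_cmult:
  assumes "polyfun n P"
  shows "lap n (\<lambda>x. c * P x) x = c * lap n P x"
proof -
  have "partial i (\<lambda>x. c * P x) = (\<lambda>x. c * partial i P x)" for i
    using polyfun_partial_cmult[OF assms] by blast
  then show ?thesis
    using polyfun_partial_cmult[OF polyfun_partial[OF assms(1)]]
    by (simp add: lap_def sum_distrib_left)
qed

lemma lap_sum:
  assumes "finite K" "\<And>k. k \<in> K \<Longrightarrow> polyfun n (f k)"
  shows "lap n (\<lambda>x. \<Sum>k\<in>K. f k x) x = (\<Sum>k\<in>K. lap n (f k) x)"
  using assms
proof (induction K)
  case empty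
  then show ?case by (simp add: lap_def partial_def)
next
  case (insert a K)
  then show ?case using lap_add[of n "f a" "\<lambda>x. \<Sum>k\<in>K. f k x" x] by (auto intro: polyfun_sum)
qed

lemma polyfun_lap: "polyfun n P \<Longrightarrow> polyfun n (lap n P)"
  unfolding lap_def by (intro polyfun_sum polyfun_partial)

lemma lap_partial:
  assumes P: "polyfun n P" and a: "a \<in> {1..n}" and z: "\<And>x. lap n P x = 0"
  shows "lap n (partial a P) x = 0"
proof -
  have e: "partial i (partial i (partial a P)) x = partial a (partial i (partial i P)) x" if "i \<in> {1..n}" for i
  proof -
    have "partial i (partial a P) = partial a (partial i P)"
      using polyfun_partial_commute[OF P that a] by blast
    then show ?thesis using polyfun_partial_commute[OF polyfun_partial[OF P] that a] by simp
  qed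
  have "lap n (partial a P) x = (\<Sum>i\<in>{1..n}. partial a (partial i (partial i P)) x)"
    unfolding lap_def using e by (rule sum.cong[OF refl])
  also have "\<dots> = partial a (lap n P) x"
    unfolding lap_def by (rule polyfun_partial_sum[where n = n, symmetric]) (intro polyfun_partial P)
  also have "lap n P = (\<lambda>x. 0)" using z by blast
  also have "partial a (\<lambda>x. 0) x = 0" by (simp add: partial_def)
  finally show ?thesis .
qed

lemma constant_poly_eq_0:
  assumes "degree p = 0" "poly p 0 = 0"
  shows "p = 0"
  using assms by (auto elim: degree_eq_zeroE)

section \<open>Reflection of harmonic polynomials at one wall\<close>

locale wall =
  fixes n j :: nat
  assumes j: "1 \<le> j" "Suc j \<le> n"
begin

definition swap :: "(nat \<Rightarrow> real) \<Rightarrow> (nat \<Rightarrow> real)" where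
  "swap x = (\<lambda>i. x (Transposition.transpose j (Suc j) i))"

lemma jn: "j \<in> {1..n}" "Suc j \<in> {1..n}"
  using j by auto

lemma transpose_mem: "i \<in> {1..n} \<Longrightarrow> Transposition.transpose j (Suc j) i \<in> {1..n}"
  using j by (auto simp: Transposition.transpose_def)

lemma swap_swap [simp]: "swap (swap x) = x"
  by (simp add: swap_def)

lemma polyfun_swap:
  assumes "polyfun n P" shows "polyfun n (\<lambda>x. P (swap x))"
  unfolding swap_def by (rule polyfun_comp[OF assms]) (intro polyfun_coord transpose_mem)

lemma partial_swap: "partial i (\<lambda>x. P (swap x)) x = partial (Transposition.transpose j (Suc j) i) P (swap x)"
proof -
  have "swap (x(i := t)) = (swap x)(Transposition.transpose j (Suc j) i := t)" for t
  proof
    fix k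
    have "Transposition.transpose j (Suc j) k = i \<longleftrightarrow> k = Transposition.transpose j (Suc j) i"
      by (auto simp: Transposition.transpose_def)
    then show "swap (x(i := t)) k = ((swap x)(Transposition.transpose j (Suc j) i := t)) k"
      unfolding swap_def fun_upd_apply by presburger
  qed
  moreover have "swap x (Transposition.transpose j (Suc j) i) = x i" by (simp add: swap_def)
  ultimately show ?thesis by (simp add: partial_def)
qed

lemma lap_swap: "lap n (\<lambda>x. P (swap x)) x = lap n P (swap x)"
proof -
  let ?t = "Transposition.transpose j (Suc j)"
  have "partial i (\<lambda>x. P (swap x)) = (\<lambda>x. partial (?t i) P (swap x))" for i
    using partial_swap by blast
  then have "lap n (\<lambda>x. P (swap x)) x = (\<Sum>i\<in>{1..n}. partial (?t i) (partial (?t i) P) (swap x))"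
    by (simp add: lap_def partial_swap)
  also have "\<dots> = (\<Sum>i\<in>{1..n}. partial i (partial i P) (swap x))"
    by (rule sum.reindex_bij_witness[where i = ?t and j = ?t]) (use transpose_mem in auto)
  finally show ?thesis by (simp add: lap_def)
qed

definition vanish :: "((nat \<Rightarrow> real) \<Rightarrow> real) \<Rightarrow> bool" where
  "vanish P \<longleftrightarrow> (\<forall>x. x j = x (Suc j) \<longrightarrow> P x = 0)"

lemma vanish_partial:
  assumes "vanish P" "i \<noteq> j" "i \<noteq> Suc j"
  shows "vanish (partial i P)"
  using assms unfolding vanish_def by (auto simp: partial_def)

text \<open>This derivative is taken along a direction tangential to the wall, on which
  \<open>P\<close> is identically zero.\<close>

lemma vanish_partial_sum:
  assumes P: "polyfun n P" and v: "vanish P"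
  shows "vanish (\<lambda>x. partial j P x + partial (Suc j) P x)"
  unfolding vanish_def
proof (intro allI impI)
  fix x :: "nat \<Rightarrow> real" assume x: "x j = x (Suc j)"
  define b :: "nat \<Rightarrow> real" where "b i = (if i = j \<or> i = Suc j then 1 else 0)" for i
  have "((\<lambda>t. P (\<lambda>i. x i + t * b i)) has_real_derivative (\<Sum>i\<in>{1..n}. b i * partial i P (\<lambda>i. x i + 0 * b i))) (at 0)"
    by (rule polyfun_line_deriv[OF P])
  moreover have "P (\<lambda>i. x i + t * b i) = 0" for t
    using v x unfolding vanish_def b_def by auto
  ultimately have "((\<lambda>t. 0) has_real_derivative (\<Sum>i\<in>{1..n}. b i * partial i P x)) (at 0)" by simp
  then have "(\<Sum>i\<in>{1..n}. b i * partial i P x) = 0" using DERIV_const DERIV_unique by blast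
  moreover have "(\<Sum>i\<in>{1..n}. b i * partial i P x) = (\<Sum>i\<in>{j, Suc j}. b i * partial i P x)"
    by (rule sum.mono_neutral_right) (use j in \<open>auto simp: b_def\<close>)
  ultimately show "partial j P x + partial (Suc j) P x = 0" by (simp add: b_def)
qed

text \<open>Chosen to be stable under two normal derivatives, which makes an induction on the degree
  along normal lines possible. Every member turns out to be zero.\<close>

definition cls :: "((nat \<Rightarrow> real) \<Rightarrow> real) \<Rightarrow> bool" where
  "cls P \<longleftrightarrow> polyfun n P \<and> (\<forall>x. lap n P x = 0) \<and> (\<forall>x. P (swap x) = P x) \<and> vanish P"

text \<open>The derivative normal to the wall, without normalisation. The difference is written as a
  sum with factor \<open>-1\<close> to match the rules for sums and scalar multiples.\<close>

definition nd :: "((nat \<Rightarrow> real) \<Rightarrow> real) \<Rightarrow> (nat \<Rightarrow> real) \<Rightarrow> real" where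
  "nd P = (\<lambda>x. partial (Suc j) P x + (-1) * partial j P x)"

lemma polyfun_nd: "polyfun n P \<Longrightarrow> polyfun n (nd P)"
  unfolding nd_def by (intro polyfun_add polyfun_cmult polyfun_partial)

lemma polyfun_normal_deriv:
  assumes P: "polyfun n P"
  shows "((\<lambda>t. P (\<lambda>i. a i + t * (if i = Suc j then 1 else if i = j then -1 else 0))) has_real_derivative
     nd P (\<lambda>i. a i + t * (if i = Suc j then 1 else if i = j then -1 else 0))) (at t)"
proof -
  define b :: "nat \<Rightarrow> real" where "b i = (if i = Suc j then 1 else if i = j then -1 else 0)" for i
  have "(\<Sum>i\<in>{1..n}. b i * partial i P x) = (\<Sum>i\<in>{j, Suc j}. b i * partial i P x)" for x
    by (rule sum.mono_neutral_right) (use j in \<open>auto simp: b_def\<close>)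
  then have "(\<Sum>i\<in>{1..n}. b i * partial i P x) = nd P x" for x by (simp add: b_def nd_def)
  then show ?thesis using polyfun_line_deriv[OF P, of a b t] unfolding b_def by simp
qed

lemma nd_nd:
  assumes P: "polyfun n P"
  shows "nd (nd P) x = partial (Suc j) (partial (Suc j) P) x - 2 * partial j (partial (Suc j) P) x + partial j (partial j P) x"
proof -
  have "partial i (nd P) x = partial i (partial (Suc j) P) x + (-1) * partial i (partial j P) x" for i
  proof -
    have "partial i (nd P) x = partial i (partial (Suc j) P) x + partial i (\<lambda>x. (-1) * partial j P x) x"
      unfolding nd_def by (rule polyfun_partial_add[where n = n]) (intro polyfun_cmult polyfun_partial P)+
    then show ?thesis by (simp only: polyfun_partial_cmult[OF polyfun_partial[OF P]])
  qed
  then show ?thesis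
    using polyfun_partial_commute[OF P jn] unfolding nd_def[of "nd P"] by simp
qed

lemma lap_nd:
  assumes P: "polyfun n P" and z: "\<And>x. lap n P x = 0"
  shows "lap n (nd P) x = 0"
proof -
  have "lap n (nd P) x = lap n (partial (Suc j) P) x + lap n (\<lambda>x. (-1) * partial j P x) x"
    unfolding nd_def by (rule lap_add) (intro polyfun_cmult polyfun_partial P)+
  then show ?thesis
    by (simp only: lap_cmult[OF polyfun_partial[OF P]] lap_partial[OF P jn(1) z] lap_partial[OF P jn(2) z])
qed

lemma nd_swap:
  assumes P: "polyfun n P"
  shows "nd P (swap x) = - nd (\<lambda>x. P (swap x)) x"
  by (simp add: nd_def partial_swap)

text \<open>On the wall the second tangential derivatives of \<open>P\<close> vanish, and so do
  those in the unrelated coordinates. Harmonicity then leaves \<open>\<partial>\<^sub>j\<^sup>2 +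
  \<partial>\<^sub>j\<^sub>+\<^sub>1\<^sup>2 = 0\<close> there; together with the vanishing of the
  square of \<open>\<partial>\<^sub>j + \<partial>\<^sub>j\<^sub>+\<^sub>1\<close> this kills the
  mixed derivative, and hence the second normal derivative.\<close>

lemma cls_nd_nd:
  assumes "cls P"
  shows "cls (nd (nd P))"
proof -
  have P: "polyfun n P" and z: "\<And>x. lap n P x = 0" and s: "\<And>x. P (swap x) = P x" and v: "vanish P"
    using assms by (auto simp: cls_def)
  have sym: "nd P (swap x) = - nd P x" for x using nd_swap[OF P] s by simp
  have sym2: "nd (nd P) (swap x) = nd (nd P) x" for x
  proof -
    have "nd (nd P) (swap x) = - nd (\<lambda>x. nd P (swap x)) x" by (rule nd_swap[OF polyfun_nd[OF P]])
    also have "(\<lambda>x. nd P (swap x)) = (\<lambda>x. (-1) * nd P x)" using sym by simp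
    also have "nd (\<lambda>x. (-1) * nd P x) x = - nd (nd P) x"
      unfolding nd_def[of "\<lambda>x. (-1) * nd P x"] nd_def[of "nd P"] polyfun_partial_cmult[OF polyfun_nd[OF P]] by simp
    finally show ?thesis by simp
  qed
  have "vanish (nd (nd P))"
    unfolding vanish_def
  proof (intro allI impI)
    fix x :: "nat \<Rightarrow> real" assume x: "x j = x (Suc j)"
    define R where "R = (\<lambda>x. partial j P x + partial (Suc j) P x)"
    have R: "polyfun n R" unfolding R_def by (intro polyfun_add polyfun_partial P)
    have "vanish R" unfolding R_def by (rule vanish_partial_sum[OF P v])
    from vanish_partial_sum[OF R this] x
    have "partial j R x + partial (Suc j) R x = 0" by (simp add: vanish_def)
    moreover have "partial i R x = partial i (partial j P) x + partial i (partial (Suc j) P) x" for i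
      unfolding R_def by (rule polyfun_partial_add[OF polyfun_partial[OF P] polyfun_partial[OF P]])
    ultimately have t: "partial j (partial j P) x + 2 * partial j (partial (Suc j) P) x + partial (Suc j) (partial (Suc j) P) x = 0"
      using polyfun_partial_commute[OF P jn, of x] by simp
    have "partial i (partial i P) x = 0" if "i \<in> {1..n} - {j, Suc j}" for i
      using vanish_partial[OF vanish_partial[OF v, of i], of i] x that by (auto simp: vanish_def)
    then have "(\<Sum>i\<in>{1..n}. partial i (partial i P) x) = (\<Sum>i\<in>{j, Suc j}. partial i (partial i P) x)"
      by (intro sum.mono_neutral_right) (use j in auto)
    then have "partial j (partial j P) x + partial (Suc j) (partial (Suc j) P) x = 0"
      using z[of x] by (simp add: lap_def)
    with t show "nd (nd P) x = 0" unfolding nd_nd[OF P] by simp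
  qed
  then show ?thesis
    unfolding cls_def using polyfun_nd[OF polyfun_nd[OF P]] lap_nd[OF polyfun_nd[OF P] lap_nd[OF P z]] sym2 by blast
qed

text \<open>Let \<open>p\<close> be the restriction to the normal line through the wall point
  \<open>a\<close>. Then \<open>p\<close> has value 0 at 0 because \<open>P\<close> vanishes on the
  wall, and derivative 0 at 0 because \<open>P\<close> is symmetric. Its second derivative comes
  from a member of the same class and is zero by induction on the degree.\<close>

lemma cls_line_zero:
  assumes "cls P" "a j = a (Suc j)" "\<And>t. P (\<lambda>i. a i + t * (if i = Suc j then 1 else if i = j then -1 else 0)) = poly p t"
  shows "p = 0"
  using assms
proof (induction "degree p" arbitrary: P p rule: less_induct)
  case less
  define l where "l t = (\<lambda>i. a i + t * (if i = Suc j then 1 else if i = j then -1 else 0))" for t :: real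
  have P: "polyfun n P" and s: "\<And>x. P (swap x) = P x" and v: "vanish P"
    using less.prems(1) by (auto simp: cls_def)
  have l0: "l 0 = a" by (auto simp: l_def)
  have p0: "poly p 0 = 0" using less.prems(3)[of 0] v less.prems(2) by (simp add: vanish_def)
  have d: "nd R (l t) = poly (pderiv q) t" if R: "polyfun n R" and q: "\<And>t. R (l t) = poly q t" for R q t
  proof -
    have "((\<lambda>t. R (l t)) has_real_derivative nd R (l t)) (at t)"
      unfolding l_def by (rule polyfun_normal_deriv[OF R])
    then show ?thesis unfolding q using poly_DERIV DERIV_unique by blast
  qed
  have d1: "nd P (l t) = poly (pderiv p) t" for t
    by (rule d[OF P]) (use less.prems(3) in \<open>simp add: l_def\<close>)
  have d2: "nd (nd P) (l t) = poly (pderiv (pderiv p)) t" for t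
    by (rule d[OF polyfun_nd[OF P] d1])
  show ?case
  proof (cases "degree p = 0")
    case True
    then show ?thesis using p0 by (rule constant_poly_eq_0)
  next
    case False
    have "pderiv (pderiv p) = 0"
      by (rule less.hyps[OF _ cls_nd_nd[OF less.prems(1)] less.prems(2)])
         (use False d2 in \<open>auto simp: degree_pderiv l_def\<close>)
    then have dg: "degree (pderiv p) = 0" by (simp add: pderiv_eq_0_iff)
    have "swap a = a" using less.prems(2) by (auto simp: swap_def Transposition.transpose_def)
    then have "nd P a = 0" using nd_swap[OF P, of a] s by simp
    then have "poly (pderiv p) 0 = 0" using d1[of 0] l0 by simp
    with dg have "pderiv p = 0" by (rule constant_poly_eq_0)
    then show ?thesis using False by (simp add: pderiv_eq_0_iff)
  qed
qed

text \<open>The Schwarz reflection principle for polynomials: the sum of \<open>P\<close> and its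
  reflection belongs to \<open>cls\<close>, and each point lies on a normal line through the
  wall.\<close>

lemma harmonic_antisymmetric:
  assumes P: "polyfun n P" and z: "\<And>x. lap n P x = 0" and v: "vanish P"
  shows "P (swap x) = - P x"
proof -
  define R where "R x = P x + P (swap x)" for x
  have "vanish R" using v unfolding vanish_def R_def by (auto simp: swap_def)
  then have c: "cls R"
    unfolding cls_def R_def
    using P z by (auto intro!: polyfun_add polyfun_swap simp: lap_add polyfun_swap lap_swap)
  \<comment> \<open>The orthogonal projection of \<open>x\<close> to the wall.\<close>
  define a where "a = x(j := (x j + x (Suc j)) / 2, Suc j := (x j + x (Suc j)) / 2)"
  define b :: "nat \<Rightarrow> real" where "b i = (if i = Suc j then 1 else if i = j then -1 else 0)" for i
  obtain p where p: "\<And>t. R (\<lambda>i. a i + t * b i) = poly p t"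
    using polyfun_line[of n R] c unfolding cls_def by blast
  have "p = 0" by (rule cls_line_zero[OF c _ p[unfolded b_def]]) (simp add: a_def)
  then have "R (\<lambda>i. a i + (x (Suc j) - x j) / 2 * b i) = 0" unfolding p by simp
  moreover have "(\<lambda>i. a i + (x (Suc j) - x j) / 2 * b i) = x"
    by (rule ext) (simp add: a_def b_def field_simps)
  ultimately have "R x = 0" by simp
  then show ?thesis by (simp add: R_def)
qed

end

theorem harmonic_polyfun_eq_0:
  assumes P: "polyfun n P" and n: "n \<ge> 2"
    and harm: "\<And>x. x \<in> chamber n \<Longrightarrow> lap n P x = 0"
    and walls: "\<And>x j. x \<in> chamber n \<Longrightarrow> 1 \<le> j \<Longrightarrow> Suc j \<le> n \<Longrightarrow> P (x(j := x (Suc j))) = 0"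
    and deg: "\<And>x p. x \<in> chamber n \<Longrightarrow> (\<And>t. P (x(1 := t)) = poly p t) \<Longrightarrow> degree p < n - 1"
  shows "P y = 0"
proof -
  have z: "lap n P x = 0" for x by (rule polyfun_zero_chamber[OF polyfun_lap[OF P] harm])
  have v: "wall.vanish j P" if j: "1 \<le> j" "Suc j \<le> n" for j
  proof -
    interpret wall n j using j by unfold_locales
    have "P (x(j := x (Suc j))) = 0" for x
      by (rule polyfun_zero_chamber[OF polyfun_update[OF P polyfun_coord[OF jn(2)]]]) (rule walls[OF _ j])
    then show ?thesis unfolding vanish_def by (metis fun_upd_triv)
  qed
  \<comment> \<open>The zero at \<open>x 1 = x 2\<close> is passed on from \<open>x 1 = x k\<close>
    to \<open>x 1 = x (k + 1)\<close> by the reflection at the wall between \<open>k\<close> and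
    \<open>k + 1\<close>.\<close>
  have eq1: "P x = 0" if "2 \<le> k" "k \<le> n" "x 1 = x k" for x k
    using that
  proof (induction k arbitrary: x rule: dec_induct)
    case base
    interpret wall n 1 using base n by unfold_locales auto
    show ?case using v[of 1] base n unfolding vanish_def by (simp add: numeral_2_eq_2)
  next
    case (step k)
    interpret wall n k using step by unfold_locales auto
    have "P (swap x) = 0" by (rule step.IH) (use step in \<open>auto simp: swap_def Transposition.transpose_def\<close>)
    moreover have "P (swap x) = - P x" by (rule harmonic_antisymmetric[OF P z v]) (use step in auto)
    ultimately show ?case by simp
  qed
  show ?thesis
  proof (rule polyfun_zero_chamber[OF P])
    fix x assume x: "x \<in> chamber n"
    obtain p where p: "\<And>t. P (x(1 := t)) = poly p t" using polyfun_update_poly[OF P] by blast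
    have "p = 0"
    proof (rule ccontr)
      assume "p \<noteq> 0"
      have "x ` {2..n} \<subseteq> {t. poly p t = 0}"
      proof
        fix t assume "t \<in> x ` {2..n}"
        then obtain k where k: "k \<in> {2..n}" "t = x k" by blast
        then have "P (x(1 := t)) = 0" using eq1[of k "x(1 := t)"] by auto
        then show "t \<in> {t. poly p t = 0}" using p by simp
      qed
      then have "card (x ` {2..n}) \<le> card {t. poly p t = 0}"
        by (rule card_mono[OF poly_roots_finite[OF \<open>p \<noteq> 0\<close>]])
      also have "\<dots> \<le> degree p" by (rule card_poly_roots_bound[OF \<open>p \<noteq> 0\<close>])
      also have "\<dots> < n - 1" by (rule deg[OF x p])
      also have "card (x ` {2..n}) = n - 1"
      proof -
        have "inj_on x {2..n}" using chamber_neq[OF x] by (intro inj_onI) (metis atLeastAtMost_iff one_le_numeral order_trans)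
        then show ?thesis by (simp add: card_image)
      qed
      finally show False by simp
    qed
    then have "P (x(1 := x 1)) = 0" unfolding p by simp
    then show "P x = 0" by simp
  qed
qed

section \<open>The degree bound from Moebius covariance\<close>

lemma COV_inversion:
  assumes cov: "COV n f" and x: "x \<in> chamber n" and q: "\<And>i. i \<in> {1..n} \<Longrightarrow> x i < q"
  shows "f x = (\<Prod>i\<in>{1..n}. (q - x i) powr (-1/2)) * f (\<lambda>i\<in>{1..n}. 1 / (q - x i))"
proof -
  \<comment> \<open>This map is increasing to the left of its pole \<open>q\<close> and has
    derivative \<open>(q - z) powr (-2)\<close>, which becomes the exponent \<open>-1/2\<close>
    under the fourth root.\<close>
  have m: "moebius 0 (-1) 1 (- q) = (\<lambda>z::real. 1 / (q - z))"
    by (rule ext) (simp add: moebius_def, metis minus_diff_eq minus_divide_right)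
  have d: "deriv (\<lambda>z::real. 1 / (q - z)) (x i) powr (1/4) = (q - x i) powr (-1/2)" if i: "i \<in> {1..n}" for i
  proof -
    have "deriv (\<lambda>z::real. 1 / (q - z)) (x i) = 1 / (q - x i)\<^sup>2"
      by (rule DERIV_imp_deriv) (use q[OF i] in \<open>auto intro!: derivative_eq_intros simp: power2_eq_square\<close>)
    also have "\<dots> = (q - x i) powr (-2)"
      using q[OF i] by (simp add: powr_minus divide_inverse powr_numeral)
    finally show ?thesis by (simp add: powr_powr)
  qed
  have "strict_mono_on {1..n} (\<lambda>i. 1 / (q - x i))"
    unfolding strict_mono_on_def using q chamber_less[OF x] by (auto intro!: divide_strict_left_mono mult_pos_pos)
  moreover have "\<forall>i\<in>{1..n}. 1 * x i + - q \<noteq> 0" using q by force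
  ultimately have "f x = (\<Prod>i\<in>{1..n}. deriv (moebius 0 (-1) 1 (- q)) (x i) powr (1/4)) * f (\<lambda>i\<in>{1..n}. moebius 0 (-1) 1 (- q) (x i))"
    using cov[unfolded COV_def, rule_format, OF x, of 0 "-q" "-1" 1] unfolding m by simp
  then show ?thesis unfolding m using d by simp
qed

text \<open>Let the first point \<open>t\<close> tend to minus infinity. After an inversion with
  pole \<open>q\<close> beyond the last point its image tends to 0, while the other images stay
  fixed, so the value of \<open>f\<close> at the image remains bounded. Covariance contributes
  \<open>(q - t) powr (-1/2)\<close> and \<open>sq\<close> contributes \<open>2 * N - 1\<close>
  factors of at most \<open>(q - t) powr (1/2)\<close>, altogether the power
  \<open>N - 1\<close>.\<close>

theorem COV_degree_bound:
  assumes N: "N \<ge> 1" and f: "smooth_on_chamber (2*N) f" and cov: "COV (2*N) f" and x: "x \<in> chamber (2*N)"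
    and p: "\<And>t. x(1 := t) \<in> chamber (2*N) \<Longrightarrow> poly p t = f (x(1 := t)) * sq (2*N) (x(1 := t))"
  shows "degree p \<le> N - 1"
proof -
  define n where "n = 2 * N"
  have n2: "n \<ge> 2" using N by (simp add: n_def)
  define q where "q = x n + 1"
  have xq: "x i < q" if "i \<in> {1..n}" for i
    using chamber_less[OF x, of i n] that n2 unfolding n_def q_def by (cases "i = 2 * N") auto
  \<comment> \<open>The image configuration with first point \<open>s\<close>. For
    \<open>s = 0\<close> it is still in the chamber, because the other images are positive; hence
    \<open>f\<close> is continuous there in \<open>s\<close>.\<close>
  define w where "w s = (\<lambda>i\<in>{1..n}. if i = 1 then s else 1 / (q - x i))" for s :: real
  have w0: "w 0 \<in> chamber n"
    unfolding chamber_mem_iff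
  proof (intro conjI ballI impI allI)
    fix i k assume ik: "i \<in> {1..n}" "k \<in> {1..n}" "i < k"
    then have "x i < x k" using chamber_less[OF x] by (simp add: n_def)
    then show "w 0 i < w 0 k"
      using ik xq[OF ik(1)] xq[OF ik(2)] unfolding w_def by (auto intro!: divide_strict_left_mono mult_pos_pos)
  qed (auto simp: w_def restrict_def)
  have one: "1 \<in> {1..n}" using n2 by simp
  have "((\<lambda>s. f ((w 0)(1 := s))) has_real_derivative partial 1 f (w 0)) (at (w 0 1))"
    using smooth_deriv_on[OF f] one w0 unfolding deriv_on_def n_def by blast
  moreover have "(w 0)(1 := s) = w s" for s using one by (auto simp: w_def)
  moreover have "w 0 1 = 0" using one by (simp add: w_def)
  ultimately have "isCont (\<lambda>s. f (w s)) 0" using DERIV_isCont by force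
  then obtain \<delta> where \<delta>: "\<delta> > 0" "\<And>s. \<bar>s\<bar> < \<delta> \<Longrightarrow> \<bar>f (w s) - f (w 0)\<bar> < 1"
    unfolding continuous_at_eps_delta by (metis diff_zero dist_real_def zero_less_one)
  define M where "M = \<bar>f (w 0)\<bar> + 1"
  define C where "C = (\<Prod>i\<in>{2..n}. (q - x i) powr (-1/2))"
  define K where "K = (\<Prod>b\<in>{2..n}. \<Prod>a\<in>{2..<b}. (x b - x a) powr (1/2))"
  have pos: "C \<ge> 0" "K \<ge> 0" "M \<ge> 0" unfolding C_def K_def M_def by (auto intro!: prod_nonneg)
  \<comment> \<open>The first bound keeps \<open>t\<close> to the left of all other points, the
    second one makes \<open>1 / (q - t)\<close> smaller than \<open>\<delta>\<close>.\<close>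
  define T where "T = min (x 2 - 1) (q - 1/\<delta>)"
  show ?thesis
  proof (rule degree_le_if_power_bound[where T = T and M = "C * M * K" and c = q])
    fix t assume t: "t < T"
    have s1: "{1..n} = insert 1 {2..n}" using n2 by auto
    define y where "y = x(1 := t)"
    have yc: "y \<in> chamber n"
    proof -
      have "t < x k" if "k \<in> {2..n}" for k
      proof -
        have "x 2 \<le> x k" using chamber_less[OF x, of 2 k] that n2 by (cases "k = 2") (auto simp: n_def)
        then show ?thesis using t by (simp add: T_def)
      qed
      then show ?thesis using x one unfolding y_def by (auto simp: chamber_mem_iff n_def)
    qed
    have tq: "t < q" using t \<delta>(1) unfolding T_def by (smt (verit) divide_nonneg_pos)
    have yq: "y i < q" if "i \<in> {1..n}" for i using xq that tq by (auto simp: y_def)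
    have "f y = (\<Prod>i\<in>{1..n}. (q - y i) powr (-1/2)) * f (\<lambda>i\<in>{1..n}. 1 / (q - y i))"
      by (rule COV_inversion[OF _ yc yq]) (use cov in \<open>simp_all add: n_def\<close>)
    also have "(\<lambda>i\<in>{1..n}. 1 / (q - y i)) = w (1 / (q - t))" by (auto simp: w_def y_def)
    also have "(\<Prod>i\<in>{1..n}. (q - y i) powr (-1/2)) = (q - t) powr (-1/2) * C"
      unfolding s1 C_def by (simp add: y_def)
    finally have fy: "f y = (q - t) powr (-1/2) * C * f (w (1 / (q - t)))" .
    have "\<bar>1 / (q - t)\<bar> < \<delta>"
    proof -
      have "1 / \<delta> < q - t" using t by (simp add: T_def)
      then show ?thesis using \<delta>(1) tq by (simp add: field_simps)
    qed
    then have fw: "\<bar>f (w (1 / (q - t)))\<bar> \<le> M" using \<delta>(2) unfolding M_def by fastforce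
    have "sq n y = (\<Prod>b\<in>{2..n}. (x b - t) powr (1/2) * (\<Prod>a\<in>{2..<b}. (x b - x a) powr (1/2)))"
    proof -
      have "sq n y = (\<Prod>b\<in>{2..n}. \<Prod>a\<in>{1..<b}. (y b - y a) powr (1/2))" unfolding sq_def s1 by simp
      also have "\<dots> = (\<Prod>b\<in>{2..n}. (x b - t) powr (1/2) * (\<Prod>a\<in>{2..<b}. (x b - x a) powr (1/2)))"
      proof (intro prod.cong refl)
        fix b assume b: "b \<in> {2..n}"
        then have "{1..<b} = insert 1 {2..<b}" by auto
        then show "(\<Prod>a\<in>{1..<b}. (y b - y a) powr (1/2)) = (x b - t) powr (1/2) * (\<Prod>a\<in>{2..<b}. (x b - x a) powr (1/2))"
          using b by (simp add: y_def)
      qed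
      finally show ?thesis .
    qed
    also have "\<dots> = (\<Prod>b\<in>{2..n}. (x b - t) powr (1/2)) * K" by (simp add: prod.distrib K_def)
    finally have sqy: "sq n y = (\<Prod>b\<in>{2..n}. (x b - t) powr (1/2)) * K" .
    have "(\<Prod>b\<in>{2..n}. (x b - t) powr (1/2)) \<le> (\<Prod>b\<in>{2..n}. (q - t) powr (1/2))"
    proof (rule prod_mono)
      fix b assume "b \<in> {2..n}"
      then have "b \<in> {1..n}" "b \<noteq> 1" by auto
      then have "t < x b" "x b < q" using xq chamber_less[OF yc one] by (force simp: y_def)+
      then show "0 \<le> (x b - t) powr (1/2) \<and> (x b - t) powr (1/2) \<le> (q - t) powr (1/2)"
        by (auto intro!: powr_mono2)
    qed
    also have "\<dots> = ((q - t) powr (1/2)) ^ (n - 1)" by simp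
    finally have B: "(\<Prod>b\<in>{2..n}. (x b - t) powr (1/2)) \<le> ((q - t) powr (1/2)) ^ (n - 1)" .
    have "\<bar>poly p t\<bar> = \<bar>f y\<bar> * sq n y"
      using p[of t] yc sq_pos[OF yc] by (simp add: y_def n_def abs_mult)
    also have "\<dots> = (q - t) powr (-1/2) * C * \<bar>f (w (1 / (q - t)))\<bar> * ((\<Prod>b\<in>{2..n}. (x b - t) powr (1/2)) * K)"
      unfolding fy sqy using pos by (simp add: abs_mult)
    also have "\<dots> \<le> (q - t) powr (-1/2) * C * M * (((q - t) powr (1/2)) ^ (n - 1) * K)"
      using pos by (intro mult_mono B fw mult_nonneg_nonneg order_refl prod_nonneg) auto
    also have "\<dots> = C * M * K * ((q - t) powr (-1/2) * ((q - t) powr (1/2)) ^ (n - 1))" by simp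
    also have "(q - t) powr (-1/2) * ((q - t) powr (1/2)) ^ (n - 1) = (q - t) ^ (N - 1)"
    proof -
      have "((q - t) powr (1/2)) ^ (n - 1) = (q - t) powr (real (n - 1) * (1/2))"
        using tq by (simp add: powr_power mult.commute)
      then have "(q - t) powr (-1/2) * ((q - t) powr (1/2)) ^ (n - 1) = (q - t) powr (-1/2 + real (n - 1) * (1/2))"
        by (simp only: powr_add)
      also have "-1/2 + real (n - 1) * (1/2) = real (N - 1)" using N by (simp add: n_def of_nat_diff field_simps)
      finally show ?thesis using tq by (simp add: powr_realpow)
    qed
    finally show "\<bar>poly p t\<bar> \<le> C * M * K * (q - t) ^ (N - 1)" .
  qed
qed


section \<open>Link patterns and ballot words\<close>

lemma link_patterns_iff:
  "\<alpha> \<in> link_patterns N \<longleftrightarrow> \<Union>\<alpha> = {1..2*N} \<and> (\<forall>l\<in>\<alpha>. \<forall>l'\<in>\<alpha>. l \<inter> l' \<noteq> {} \<longrightarrow> l = l') \<and> (\<forall>l\<in>\<alpha>. card l = 2) \<and>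
     (\<forall>a b c d. {a, b} \<in> \<alpha> \<longrightarrow> {c, d} \<in> \<alpha> \<longrightarrow> a < c \<longrightarrow> c < b \<longrightarrow> b < d \<longrightarrow> False)"
proof -
  have n: "{} \<notin> \<alpha>" if "\<forall>l\<in>\<alpha>. card l = 2" using that by force
  have D: "disjoint \<alpha> \<longleftrightarrow> (\<forall>l\<in>\<alpha>. \<forall>l'\<in>\<alpha>. l \<inter> l' \<noteq> {} \<longrightarrow> l = l')"
    unfolding disjoint_def by blast
  have C: "\<not> (\<exists>a b c d. {a, b} \<in> \<alpha> \<and> {c, d} \<in> \<alpha> \<and> a < c \<and> c < b \<and> b < d) \<longleftrightarrow>
     (\<forall>a b c d. {a, b} \<in> \<alpha> \<longrightarrow> {c, d} \<in> \<alpha> \<longrightarrow> a < c \<longrightarrow> c < b \<longrightarrow> b < d \<longrightarrow> False)"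
    by blast
  show ?thesis
    unfolding link_patterns_def partition_on_def mem_Collect_eq D C
    by (rule iffI; elim conjE; intro conjI n; assumption)
qed

lemma link_pattern_unique:
  assumes "\<alpha> \<in> link_patterns N" "l \<in> \<alpha>" "l' \<in> \<alpha>" "l \<inter> l' \<noteq> {}"
  shows "l = l'"
proof -
  have "\<forall>l\<in>\<alpha>. \<forall>l'\<in>\<alpha>. l \<inter> l' \<noteq> {} \<longrightarrow> l = l'"
    using assms(1) unfolding link_patterns_iff by (elim conjE)
  then show ?thesis using assms(2-4) by simp
qed

lemma card_2_lessE:
  fixes l :: "nat set"
  assumes "card l = 2"
  obtains p q where "l = {p, q}" "p < q"
proof -
  obtain p q where "l = {p, q}" "p \<noteq> q" using assms by (meson card_2_iff)
  then show thesis using that[of p q] that[of q p] by (cases "p < q") (auto simp: insert_commute)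
qed

lemma link_pattern_linkE:
  assumes "\<alpha> \<in> link_patterns N" "k \<in> {1..2*N}"
  obtains a b where "{a, b} \<in> \<alpha>" "a < b" "k = a \<or> k = b"
proof -
  have "k \<in> \<Union>\<alpha>" using assms by (simp add: link_patterns_iff)
  then obtain l where l: "l \<in> \<alpha>" "k \<in> l" by blast
  then have "card l = 2" using assms(1) by (simp add: link_patterns_iff)
  then obtain p q where "l = {p, q}" "p < q" by (rule card_2_lessE)
  then show thesis using l that[of p q] by auto
qed

lemma link_pattern_disjoint:
  assumes "\<alpha> \<in> link_patterns N" "{a, b} \<in> \<alpha>" "{c, d} \<in> \<alpha>" "{a, b} \<inter> {c, d} \<noteq> {}"
  shows "{a, b} = {c, d}"
  using assms by (rule link_pattern_unique)

lemma link_pattern_range: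
  assumes "\<alpha> \<in> link_patterns N" "{a, b} \<in> \<alpha>"
  shows "a \<in> {1..2*N}" "b \<in> {1..2*N}" "a \<noteq> b"
proof -
  have "{a, b} \<subseteq> \<Union>\<alpha>" using assms(2) by blast
  then show "a \<in> {1..2*N}" "b \<in> {1..2*N}" using assms(1) unfolding link_patterns_iff by auto
  show "a \<noteq> b" using assms unfolding link_patterns_iff by force
qed

lemma no_crossing:
  assumes "\<alpha> \<in> link_patterns N" "{a, b} \<in> \<alpha>" "{c, d} \<in> \<alpha>" "a < c" "c < b" 
  shows "d \<le> b"
  using assms unfolding link_patterns_iff by (meson not_le)

lemma left_ends_iff:
  assumes "\<alpha> \<in> link_patterns N"
  shows "k \<in> left_ends \<alpha> \<longleftrightarrow> (\<exists>b>k. {k, b} \<in> \<alpha>)"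
proof
  assume "k \<in> left_ends \<alpha>"
  then obtain l where l: "l \<in> \<alpha>" "k = Min l" by (auto simp: left_ends_def)
  then have "card l = 2" using assms(1) by (simp add: link_patterns_iff)
  then obtain p q where "l = {p, q}" "p < q" by (rule card_2_lessE)
  then show "\<exists>b>k. {k, b} \<in> \<alpha>" using l by auto
next
  assume "\<exists>b>k. {k, b} \<in> \<alpha>"
  then obtain b where "b > k" "{k, b} \<in> \<alpha>" by blast
  then show "k \<in> left_ends \<alpha>" unfolding left_ends_def by (force intro: rev_image_eqI)
qed

lemma right_ends_iff:
  assumes "\<alpha> \<in> link_patterns N"
  shows "k \<in> right_ends \<alpha> \<longleftrightarrow> (\<exists>a<k. {a, k} \<in> \<alpha>)"
proof
  assume "k \<in> right_ends \<alpha>"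
  then obtain l where l: "l \<in> \<alpha>" "k = Max l" by (auto simp: right_ends_def)
  then have "card l = 2" using assms(1) by (simp add: link_patterns_iff)
  then obtain p q where "l = {p, q}" "p < q" by (rule card_2_lessE)
  then show "\<exists>a<k. {a, k} \<in> \<alpha>" using l by auto
next
  assume "\<exists>a<k. {a, k} \<in> \<alpha>"
  then obtain a where "a < k" "{a, k} \<in> \<alpha>" by blast
  then show "k \<in> right_ends \<alpha>" unfolding right_ends_def by (force intro: rev_image_eqI)
qed

lemma right_ends_eq:
  assumes "\<alpha> \<in> link_patterns N"
  shows "right_ends \<alpha> = {1..2*N} - left_ends \<alpha>"
proof (intro set_eqI iffI)
  fix k assume "k \<in> right_ends \<alpha>"
  then obtain a where a: "a < k" "{a, k} \<in> \<alpha>" using right_ends_iff[OF assms] by blast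
  have "k \<notin> left_ends \<alpha>"
  proof
    assume "k \<in> left_ends \<alpha>"
    then obtain b where "b > k" "{k, b} \<in> \<alpha>" using left_ends_iff[OF assms] by blast
    then show False using link_pattern_disjoint[OF assms a(2), of k b] a(1) by (auto simp: doubleton_eq_iff)
  qed
  then show "k \<in> {1..2*N} - left_ends \<alpha>" using link_pattern_range(2)[OF assms a(2)] by auto
next
  fix k assume k: "k \<in> {1..2*N} - left_ends \<alpha>"
  then obtain a b where "{a, b} \<in> \<alpha>" "a < b" "k = a \<or> k = b" using link_pattern_linkE[OF assms, of k] by auto
  then show "k \<in> right_ends \<alpha>" using k left_ends_iff[OF assms] right_ends_iff[OF assms] by auto
qed

text \<open>If a left end is followed immediately by a right end and the two are not linked to each
  other, their links cross.\<close>

lemma adjacent_link_iff: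
  assumes \<alpha>: "\<alpha> \<in> link_patterns N" and j: "1 \<le> j" "Suc j \<le> 2*N"
  shows "{j, Suc j} \<in> \<alpha> \<longleftrightarrow> j \<in> left_ends \<alpha> \<and> Suc j \<notin> left_ends \<alpha>"
proof
  assume l: "{j, Suc j} \<in> \<alpha>"
  then have "Suc j \<in> right_ends \<alpha>" "j \<in> left_ends \<alpha>"
    using left_ends_iff[OF \<alpha>] right_ends_iff[OF \<alpha>] by auto
  then show "j \<in> left_ends \<alpha> \<and> Suc j \<notin> left_ends \<alpha>" using right_ends_eq[OF \<alpha>] by auto
next
  assume "j \<in> left_ends \<alpha> \<and> Suc j \<notin> left_ends \<alpha>"
  then obtain b a where b: "b > j" "{j, b} \<in> \<alpha>" and a: "a < Suc j" "{a, Suc j} \<in> \<alpha>"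
    using left_ends_iff[OF \<alpha>] right_ends_iff[OF \<alpha>, of "Suc j"] right_ends_eq[OF \<alpha>] j by auto
  show "{j, Suc j} \<in> \<alpha>"
  proof (cases "a = j \<or> b = Suc j")
    case False
    then have "b \<le> Suc j" using no_crossing[OF \<alpha> a(2) b(2)] a(1) by linarith
    then show ?thesis using False b(1) by linarith
  qed (use a b in auto)
qed

text \<open>Take a link of minimal length. If its ends are not adjacent, the point next to its left
  end belongs to a link that is either nested inside, hence shorter, or crosses it.\<close>

lemma exists_adjacent_link:
  assumes \<alpha>: "\<alpha> \<in> link_patterns N" and N: "N \<ge> 1"
  shows "\<exists>j. 1 \<le> j \<and> Suc j \<le> 2*N \<and> {j, Suc j} \<in> \<alpha>"
proof -
  define Q where "Q p \<longleftrightarrow> fst p < snd p \<and> {fst p, snd p} \<in> \<alpha>" for p :: "nat \<times> nat"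
  have "1 \<in> {1..2*N}" using N by simp
  then obtain a0 b0 where "{a0, b0} \<in> \<alpha>" "a0 < b0" by (rule link_pattern_linkE[OF \<alpha>])
  then have "Q (a0, b0)" by (simp add: Q_def)
  from ex_has_least_nat[of Q, OF this, of "\<lambda>p. snd p - fst p"]
  obtain p where p: "Q p" "\<And>y. Q y \<Longrightarrow> snd p - fst p \<le> snd y - fst y" by blast
  obtain a b where ab: "p = (a, b)" by (cases p)
  have l: "a < b" "{a, b} \<in> \<alpha>" using p(1) by (auto simp: Q_def ab)
  have min: "b - a \<le> d - c" if "c < d" "{c, d} \<in> \<alpha>" for c d using p(2)[of "(c, d)"] that by (simp add: Q_def ab)
  have "b = Suc a"
  proof (rule ccontr)
    assume "b \<noteq> Suc a"
    then have b: "Suc a < b" using l by simp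
    have "Suc a \<in> {1..2*N}" using link_pattern_range(2)[OF \<alpha> l(2)] b by auto
    then obtain c d where cd: "{c, d} \<in> \<alpha>" "c < d" "Suc a = c \<or> Suc a = d" by (rule link_pattern_linkE[OF \<alpha>])
    from cd(3) show False
    proof
      assume c: "Suc a = c"
      then have "d \<le> b" using no_crossing[OF \<alpha> l(2) cd(1)] b by simp
      then show False using min[OF cd(2,1)] c b by simp
    next
      assume d: "Suc a = d"
      show False
      proof (cases "c = a")
        case True
        then show False using link_pattern_disjoint[OF \<alpha> l(2) cd(1)] d b by (auto simp: doubleton_eq_iff)
      next
        case False
        then show False using no_crossing[OF \<alpha> cd(1) l(2)] cd d b by simp
      qed
    qed
  qed
  then show ?thesis using l link_pattern_range[OF \<alpha> l(2)] by (intro exI[of _ a]) auto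
qed

section \<open>Inserting and removing a link between neighbours\<close>

definition widen :: "nat \<Rightarrow> nat \<Rightarrow> nat" where
  "widen j k = (if k < j then k else k + 2)"

definition narrow :: "nat \<Rightarrow> nat \<Rightarrow> nat" where
  "narrow j k = (if k < j then k else k - 2)"

lemma narrow_widen [simp]: "narrow j (widen j k) = k"
  by (simp add: narrow_def widen_def)

lemma widen_narrow: "k \<noteq> j \<Longrightarrow> k \<noteq> Suc j \<Longrightarrow> widen j (narrow j k) = k"
  by (auto simp: narrow_def widen_def)

lemma widen_less_iff [simp]: "widen j a < widen j b \<longleftrightarrow> a < b"
  by (auto simp: widen_def)

lemma widen_neq [simp]: "widen j k \<noteq> j" "widen j k \<noteq> Suc j"
  by (auto simp: widen_def)

lemma inj_widen: "inj (widen j)"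
  by (rule inj_on_inverseI[where g = "narrow j"]) simp

lemma widen_image: 
  assumes "1 \<le> j" "j \<le> Suc (2*M)"
  shows "{1..2 * Suc M} = insert j (insert (Suc j) (widen j ` {1..2*M}))"
proof (intro set_eqI iffI)
  fix k assume k: "k \<in> {1..2 * Suc M}"
  show "k \<in> insert j (insert (Suc j) (widen j ` {1..2*M}))"
  proof (cases "k = j \<or> k = Suc j")
    case False
    then have "k = widen j (narrow j k)" by (simp add: widen_narrow)
    moreover have "narrow j k \<in> {1..2*M}" using k False assms by (auto simp: narrow_def)
    ultimately show ?thesis by blast
  qed auto
qed (use assms in \<open>auto simp: widen_def\<close>)

definition insert_link :: "nat \<Rightarrow> nat set set \<Rightarrow> nat set set" where
  "insert_link j \<gamma> = insert {j, Suc j} ((`) (widen j) ` \<gamma>)"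

lemma remove_link_eq: "remove_link j \<alpha> = (`) (narrow j) ` (\<alpha> - {{j, Suc j}})"
  unfolding remove_link_def narrow_def by simp

lemma insert_link_pattern:
  assumes \<gamma>: "\<gamma> \<in> link_patterns M" and j: "1 \<le> j" "j \<le> Suc (2*M)"
  shows "insert_link j \<gamma> \<in> link_patterns (Suc M)"
  unfolding link_patterns_iff
proof (intro conjI ballI impI allI)
  show "\<Union>(insert_link j \<gamma>) = {1..2 * Suc M}"
  proof -
    have "\<Union>(insert_link j \<gamma>) = insert j (insert (Suc j) (widen j ` \<Union>\<gamma>))"
      unfolding insert_link_def by auto
    then show ?thesis using \<gamma> widen_image[OF j] by (simp add: link_patterns_iff)
  qed
  show "card l = 2" if "l \<in> insert_link j \<gamma>" for l
  proof -
    have "card (widen j ` l) = card l" for l by (rule card_image[OF inj_on_subset[OF inj_widen]]) simp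
    then show ?thesis using that \<gamma> by (auto simp: insert_link_def link_patterns_iff)
  qed
  show "l = l'" if "l \<in> insert_link j \<gamma>" "l' \<in> insert_link j \<gamma>" "l \<inter> l' \<noteq> {}" for l l'
  proof -
    have d: "{j, Suc j} \<inter> widen j ` m = {}" "widen j ` m \<inter> {j, Suc j} = {}" for m using widen_neq by fastforce+
    have "widen j ` m \<inter> widen j ` m' = widen j ` (m \<inter> m')" for m m' by (rule image_Int[OF inj_widen, symmetric])
    then have "widen j ` m = widen j ` m'" if "m \<in> \<gamma>" "m' \<in> \<gamma>" "widen j ` m \<inter> widen j ` m' \<noteq> {}" for m m'
      using link_pattern_unique[OF \<gamma> that(1,2)] that(3) \<open>\<And>m m'. widen j ` m \<inter> widen j ` m' = widen j ` (m \<inter> m')\<close> by auto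
    then show ?thesis using that d unfolding insert_link_def by blast
  qed
  show False if l: "{a, b} \<in> insert_link j \<gamma>" "{c, d} \<in> insert_link j \<gamma>" "a < c" "c < b" "b < d" for a b c d
  proof -
    have im: "{narrow j a, narrow j b} \<in> \<gamma> \<and> a = widen j (narrow j a) \<and> b = widen j (narrow j b)"
      if ab: "{a, b} \<in> insert_link j \<gamma>" "{a, b} \<noteq> {j, Suc j}" for a b
    proof -
      obtain m where m: "m \<in> \<gamma>" "{a, b} = widen j ` m" using ab unfolding insert_link_def by blast
      then have "narrow j ` {a, b} = m" by (simp add: image_image)
      moreover have "a \<in> widen j ` m" "b \<in> widen j ` m" using m(2) by blast+
      ultimately show ?thesis using m(1) by auto
    qed
    show False
    proof (cases "{a, b} = {j, Suc j} \<or> {c, d} = {j, Suc j}")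
      case True
      then show False using l(3-5) by (auto simp: doubleton_eq_iff)
    next
      case False
      then have A: "{narrow j a, narrow j b} \<in> \<gamma>" "a = widen j (narrow j a)" "b = widen j (narrow j b)"
        and C: "{narrow j c, narrow j d} \<in> \<gamma>" "c = widen j (narrow j c)" "d = widen j (narrow j d)"
        using im l by blast+
      have "narrow j a < narrow j c" "narrow j c < narrow j b" "narrow j b < narrow j d"
        using l(3-5) A C widen_less_iff by metis+
      then show False using \<gamma> A(1) C(1) unfolding link_patterns_iff by blast
    qed
  qed
qed

lemma left_ends_insert_link:
  assumes \<gamma>: "\<gamma> \<in> link_patterns M"
  shows "left_ends (insert_link j \<gamma>) = insert j (widen j ` left_ends \<gamma>)"
proof -
  have "Min (widen j ` l) = widen j (Min l)" if "l \<in> \<gamma>" for l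
  proof -
    have "card l = 2" using \<gamma> that by (simp add: link_patterns_iff)
    then have "finite l" "l \<noteq> {}" by (auto intro: card_ge_0_finite)
    moreover have "mono (widen j)" by (auto simp: mono_def widen_def)
    ultimately show ?thesis using mono_Min_commute[of "widen j" l] by simp
  qed
  moreover have "Min {j, Suc j} = j" by simp
  ultimately show ?thesis unfolding left_ends_def insert_link_def by (auto simp: image_image)
qed

lemma remove_link_pattern:
  assumes \<alpha>: "\<alpha> \<in> link_patterns (Suc M)" and l: "{j, Suc j} \<in> \<alpha>"
  shows "remove_link j \<alpha> \<in> link_patterns M" "insert_link j (remove_link j \<alpha>) = \<alpha>"
proof -
  have j: "1 \<le> j" "j \<le> Suc (2*M)" using link_pattern_range[OF \<alpha> l] by auto
  define \<alpha>' where "\<alpha>' = \<alpha> - {{j, Suc j}}"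
  have nj: "k \<noteq> j" "k \<noteq> Suc j" if "m \<in> \<alpha>'" "k \<in> m" for m k
  proof -
    have "m \<in> \<alpha>" "m \<noteq> {j, Suc j}" using that(1) by (auto simp: \<alpha>'_def)
    then have "m \<inter> {j, Suc j} = {}" using link_pattern_unique[OF \<alpha> _ l, of m] by blast
    then show "k \<noteq> j" "k \<noteq> Suc j" using that by auto
  qed
  have wn: "widen j ` narrow j ` m = m" if "m \<in> \<alpha>'" for m
  proof -
    have "widen j (narrow j k) = k" if "k \<in> m" for k using nj[OF \<open>m \<in> \<alpha>'\<close> that] by (rule widen_narrow)
    then show ?thesis by (simp add: image_image)
  qed
  have r: "remove_link j \<alpha> = (`) (narrow j) ` \<alpha>'" by (simp add: remove_link_eq \<alpha>'_def)
  have "(`) (widen j) ` remove_link j \<alpha> = (\<lambda>m. widen j ` narrow j ` m) ` \<alpha>'"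
    unfolding r by (rule image_image)
  also have "\<dots> = (\<lambda>m. m) ` \<alpha>'" by (rule image_cong[OF refl]) (rule wn)
  finally have "(`) (widen j) ` remove_link j \<alpha> = \<alpha>'" by simp
  then show ins: "insert_link j (remove_link j \<alpha>) = \<alpha>"
    using l unfolding insert_link_def \<alpha>'_def by blast
  have wi: "widen j ` m \<in> \<alpha>" if "m \<in> remove_link j \<alpha>" for m using that ins unfolding insert_link_def by blast
  show "remove_link j \<alpha> \<in> link_patterns M"
    unfolding link_patterns_iff
  proof (intro conjI ballI impI allI)
    have "\<Union>\<alpha> = insert j (insert (Suc j) (widen j ` \<Union>(remove_link j \<alpha>)))"
      by (subst ins[symmetric]) (auto simp: insert_link_def)
    then have E: "insert j (insert (Suc j) (widen j ` \<Union>(remove_link j \<alpha>))) = insert j (insert (Suc j) (widen j ` {1..2*M}))"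
      using \<alpha> widen_image[OF j] by (simp add: link_patterns_iff)
    have K: "widen j ` K = insert j (insert (Suc j) (widen j ` K)) - {j, Suc j}" for K
      using widen_neq[of j] by auto
    have "widen j ` \<Union>(remove_link j \<alpha>) = widen j ` {1..2*M}"
    proof -
      have "widen j ` \<Union>(remove_link j \<alpha>) = insert j (insert (Suc j) (widen j ` \<Union>(remove_link j \<alpha>))) - {j, Suc j}" by (rule K)
      also have "\<dots> = insert j (insert (Suc j) (widen j ` {1..2*M})) - {j, Suc j}" by (simp only: E)
      also have "\<dots> = widen j ` {1..2*M}" by (rule K[symmetric])
      finally show ?thesis .
    qed
    then show "\<Union>(remove_link j \<alpha>) = {1..2*M}" unfolding inj_image_eq_iff[OF inj_widen] .
    show "card m = 2" if "m \<in> remove_link j \<alpha>" for m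
    proof -
      have "card (widen j ` m) = card m" by (rule card_image[OF inj_on_subset[OF inj_widen]]) simp
      then show ?thesis using wi[OF that] \<alpha> by (simp add: link_patterns_iff)
    qed
    show "m = m'" if "m \<in> remove_link j \<alpha>" "m' \<in> remove_link j \<alpha>" "m \<inter> m' \<noteq> {}" for m m'
    proof -
      have "widen j ` m \<inter> widen j ` m' \<noteq> {}" using that(3) by blast
      then have "widen j ` m = widen j ` m'" using link_pattern_unique[OF \<alpha> wi[OF that(1)] wi[OF that(2)]] by blast
      then show ?thesis using inj_image_eq_iff[OF inj_widen] by blast
    qed
    show False if "{a, b} \<in> remove_link j \<alpha>" "{c, d} \<in> remove_link j \<alpha>" "a < c" "c < b" "b < d" for a b c d
    proof -
      have "{widen j a, widen j b} \<in> \<alpha>" "{widen j c, widen j d} \<in> \<alpha>" using wi[OF that(1)] wi[OF that(2)] by simp_all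
      then have "\<not> (widen j a < widen j c \<and> widen j c < widen j b \<and> widen j b < widen j d)"
        using \<alpha> unfolding link_patterns_iff by blast
      then show False using that(3-5) by simp
    qed
  qed
qed

section \<open>Link patterns as ballot words, given by their sets of up-steps\<close>

primrec word_path :: "nat set \<Rightarrow> nat \<Rightarrow> int" where
  "word_path L 0 = 0"
| "word_path L (Suc k) = word_path L k + (if Suc k \<in> L then 1 else - 1)"

lemma path_of_eq: "path_of \<alpha> = word_path (left_ends \<alpha>)"
proof
  show "path_of \<alpha> k = word_path (left_ends \<alpha>) k" for k by (induction k) auto
qed

definition ballot :: "nat \<Rightarrow> nat set \<Rightarrow> bool" where
  "ballot N L \<longleftrightarrow> L \<subseteq> {1..2*N} \<and> (\<forall>k\<le>2*N. 0 \<le> word_path L k) \<and> word_path L (2*N) = 0"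

text \<open>A word with different letters at \<open>j\<close> and \<open>Suc j\<close> arises from
  its contraction in one of two ways: by inserting an up-step followed by a down-step, or the same
  steps in the opposite order.\<close>

definition add_peak :: "nat \<Rightarrow> nat set \<Rightarrow> nat set" where
  "add_peak j K = insert j (widen j ` K)"

definition add_valley :: "nat \<Rightarrow> nat set \<Rightarrow> nat set" where
  "add_valley j K = insert (Suc j) (widen j ` K)"

definition contract :: "nat \<Rightarrow> nat set \<Rightarrow> nat set" where
  "contract j L = {k. widen j k \<in> L}"

lemma widen_image_iff: "k \<in> widen j ` K \<longleftrightarrow> (k < j \<and> k \<in> K) \<or> (Suc j < k \<and> k - 2 \<in> K)"
proof
  assume "(k < j \<and> k \<in> K) \<or> (Suc j < k \<and> k - 2 \<in> K)"
  then show "k \<in> widen j ` K"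
  proof
    assume "Suc j < k \<and> k - 2 \<in> K"
    then have "k = widen j (k - 2)" "k - 2 \<in> K" by (auto simp: widen_def)
    then show ?thesis by blast
  next
    assume "k < j \<and> k \<in> K"
    then have "k = widen j k" "k \<in> K" by (auto simp: widen_def)
    then show ?thesis by blast
  qed
qed (auto simp: widen_def split: if_splits)

lemma word_path_add_peak:
  assumes "1 \<le> j"
  shows "word_path (add_peak j K) k = (if k < j then word_path K k else if k = j then word_path K (j - 1) + 1 else word_path K (k - 2))"
proof -
  obtain i where ji: "j = Suc i" using assms by (cases j) auto
  show ?thesis
proof (induction k)
  case (Suc k)
  consider "Suc k < j" | "Suc k = j" | "k = j" | "Suc j \<le> k" by linarith
  then show ?case
  proof cases
    case 4
    show ?thesis
    proof (cases "k = Suc j")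
      case True
      then show ?thesis using Suc assms by (auto simp: add_peak_def widen_image_iff ji)
    next
      case False
      have "Suc k - 2 = Suc (k - 2)" using 4 assms by simp
      then show ?thesis using Suc 4 False assms by (auto simp: add_peak_def widen_image_iff)
    qed
  qed (use Suc assms in \<open>auto simp: add_peak_def widen_image_iff\<close>)
qed (use assms in auto)
qed

lemma word_path_add_valley:
  assumes "1 \<le> j"
  shows "word_path (add_valley j K) k = (if k < j then word_path K k else if k = j then word_path K (j - 1) - 1 else word_path K (k - 2))"
proof -
  obtain i where ji: "j = Suc i" using assms by (cases j) auto
  show ?thesis
proof (induction k)
  case (Suc k)
  consider "Suc k < j" | "Suc k = j" | "k = j" | "Suc j \<le> k" by linarith
  then show ?case
  proof cases
    case 4
    show ?thesis
    proof (cases "k = Suc j")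
      case True
      then show ?thesis using Suc assms by (auto simp: add_valley_def widen_image_iff ji)
    next
      case False
      have "Suc k - 2 = Suc (k - 2)" using 4 assms by simp
      then show ?thesis using Suc 4 False assms by (auto simp: add_valley_def widen_image_iff)
    qed
  qed (use Suc assms in \<open>auto simp: add_valley_def widen_image_iff\<close>)
qed (use assms in auto)
qed

lemma contract_add_peak [simp]: "contract j (add_peak j K) = K"
  using inj_widen[of j] by (auto simp: contract_def add_peak_def inj_image_mem_iff)

lemma contract_add_valley [simp]: "contract j (add_valley j K) = K"
  using inj_widen[of j] by (auto simp: contract_def add_valley_def inj_image_mem_iff)

lemma widen_image_contract: "widen j ` contract j L = L - {j, Suc j}"
proof (intro set_eqI iffI)
  fix k assume k: "k \<in> L - {j, Suc j}"
  then have "k = widen j (narrow j k)" by (simp add: widen_narrow)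
  then show "k \<in> widen j ` contract j L" using k by (metis CollectI DiffD1 contract_def image_eqI)
qed (auto simp: contract_def)

lemma add_peak_contract: "j \<in> L \<Longrightarrow> Suc j \<notin> L \<Longrightarrow> add_peak j (contract j L) = L"
  unfolding add_peak_def widen_image_contract by auto

lemma add_valley_contract: "j \<notin> L \<Longrightarrow> Suc j \<in> L \<Longrightarrow> add_valley j (contract j L) = L"
  unfolding add_valley_def widen_image_contract by auto

lemma widen_image_subset:
  assumes "1 \<le> j" "j \<le> Suc (2*M)"
  shows "widen j ` K \<subseteq> {1..2 * Suc M} \<longleftrightarrow> K \<subseteq> {1..2*M}"
proof -
  have "widen j k \<in> {1..2 * Suc M} \<longleftrightarrow> k \<in> {1..2*M}" for k using assms by (auto simp: widen_def)
  then show ?thesis by blast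
qed

lemma ballot_add_peak_iff:
  assumes j: "1 \<le> j" "j \<le> Suc (2*M)"
  shows "ballot (Suc M) (add_peak j K) \<longleftrightarrow> ballot M K"
proof -
  have s: "add_peak j K \<subseteq> {1..2 * Suc M} \<longleftrightarrow> K \<subseteq> {1..2*M}"
    using widen_image_subset[OF j] j by (auto simp: add_peak_def)
  have e: "word_path (add_peak j K) (2 * Suc M) = word_path K (2*M)"
    unfolding word_path_add_peak[OF j(1)] using j by auto
  have "(\<forall>k\<le>2 * Suc M. 0 \<le> word_path (add_peak j K) k) \<longleftrightarrow> (\<forall>k\<le>2*M. 0 \<le> word_path K k)"
  proof (intro iffI allI impI)
    fix k assume h: "\<forall>k\<le>2 * Suc M. 0 \<le> word_path (add_peak j K) k" and k: "k \<le> 2*M"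
    show "0 \<le> word_path K k"
      using h[rule_format, of k] h[rule_format, of "k + 2"] k by (cases "k < j") (auto simp: word_path_add_peak[OF j(1)] simp del: word_path.simps)
  next
    fix k assume h: "\<forall>k\<le>2*M. 0 \<le> word_path K k" and k: "k \<le> 2 * Suc M"
    then show "0 \<le> word_path (add_peak j K) k"
      using h[rule_format, of "j - 1"] h[rule_format, of k] h[rule_format, of "k - 2"] j by (auto simp: word_path_add_peak[OF j(1)])
  qed
  then show ?thesis unfolding ballot_def s e by blast
qed

text \<open>The inserted pair starts with a down-step, which must leave from positive
  height.\<close>

lemma ballot_add_valley_iff:
  assumes j: "1 \<le> j" "j \<le> Suc (2*M)"
  shows "ballot (Suc M) (add_valley j K) \<longleftrightarrow> ballot M K \<and> word_path K (j - 1) > 0"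
proof -
  have s: "add_valley j K \<subseteq> {1..2 * Suc M} \<longleftrightarrow> K \<subseteq> {1..2*M}"
    using widen_image_subset[OF j] j by (auto simp: add_valley_def)
  have e: "word_path (add_valley j K) (2 * Suc M) = word_path K (2*M)"
    unfolding word_path_add_valley[OF j(1)] using j by auto
  have "(\<forall>k\<le>2 * Suc M. 0 \<le> word_path (add_valley j K) k) \<longleftrightarrow> (\<forall>k\<le>2*M. 0 \<le> word_path K k) \<and> word_path K (j - 1) > 0"
  proof (intro iffI allI impI conjI)
    fix k assume h: "\<forall>k\<le>2 * Suc M. 0 \<le> word_path (add_valley j K) k" and k: "k \<le> 2*M"
    show "0 \<le> word_path K k"
      using h[rule_format, of k] h[rule_format, of "k + 2"] k by (cases "k < j") (auto simp: word_path_add_valley[OF j(1)] simp del: word_path.simps)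
  next
    assume h: "\<forall>k\<le>2 * Suc M. 0 \<le> word_path (add_valley j K) k"
    show "word_path K (j - 1) > 0" using h[rule_format, of j] j by (auto simp: word_path_add_valley[OF j(1)])
  next
    fix k assume h: "(\<forall>k\<le>2*M. 0 \<le> word_path K k) \<and> word_path K (j - 1) > 0" and k: "k \<le> 2 * Suc M"
    then show "0 \<le> word_path (add_valley j K) k"
      using h[THEN conjunct1, rule_format, of k] h[THEN conjunct1, rule_format, of "k - 2"] j by (auto simp: word_path_add_valley[OF j(1)])
  qed
  then show ?thesis unfolding ballot_def s e by blast
qed

lemma ballot_peak_exists:
  assumes "ballot (Suc M) L"
  shows "\<exists>j. 1 \<le> j \<and> j \<le> Suc (2*M) \<and> j \<in> L \<and> Suc j \<notin> L"
proof (rule ccontr)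
  assume n: "\<not> ?thesis"
  have "k \<in> L" if "1 \<le> k" "k \<le> 2 * Suc M" for k
    using that
  proof (induction k rule: dec_induct)
    case base
    have "0 \<le> word_path L 1"
      using assms[unfolded ballot_def, THEN conjunct2, THEN conjunct1, rule_format, of 1] by simp
    then show ?case by (simp split: if_splits)
  next
    case (step k)
    then show ?case using n by auto
  qed
  then have "2 * Suc M \<in> L" by simp
  moreover have "0 \<le> word_path L (Suc (2*M))"
    using assms[unfolded ballot_def, THEN conjunct2, THEN conjunct1, rule_format, of "Suc (2*M)"] by simp
  ultimately have "word_path L (2 * Suc M) > 0" by simp
  then show False using assms by (simp add: ballot_def)
qed

text \<open>A link between neighbours of the pattern is the same as a peak of the word, by
  \<open>adjacent_link_iff\<close>. Both sides are therefore reduced at a common position, and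
  removing the link corresponds to contracting the word there.\<close>

theorem bij_betw_left_ends: "bij_betw left_ends (link_patterns N) {L. ballot N L}"
proof (induction N)
  case 0
  have "link_patterns 0 = {{}}"
    by (auto simp: link_patterns_def partition_on_empty)
  moreover have "{L. ballot 0 L} = {{}}" by (auto simp: ballot_def)
  ultimately show ?case by (simp add: left_ends_def bij_betw_def)
next
  case (Suc M)
  have IH: "inj_on left_ends (link_patterns M)" "left_ends ` link_patterns M = {L. ballot M L}"
    using Suc by (auto simp: bij_betw_def)
  have le: "left_ends \<alpha> = add_peak j (left_ends (remove_link j \<alpha>))"
    if "\<alpha> \<in> link_patterns (Suc M)" "{j, Suc j} \<in> \<alpha>" for \<alpha> j
    using left_ends_insert_link[OF remove_link_pattern(1)[OF that], of j] remove_link_pattern(2)[OF that]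
    by (simp add: add_peak_def)
  have into: "left_ends \<alpha> \<in> {L. ballot (Suc M) L}" if \<alpha>: "\<alpha> \<in> link_patterns (Suc M)" for \<alpha>
  proof -
    obtain j where j: "1 \<le> j" "Suc j \<le> 2 * Suc M" "{j, Suc j} \<in> \<alpha>" using exists_adjacent_link[OF \<alpha>] by auto
    have "ballot M (left_ends (remove_link j \<alpha>))" using remove_link_pattern(1)[OF \<alpha> j(3)] IH(2) by blast
    then show ?thesis using le[OF \<alpha> j(3)] ballot_add_peak_iff[of j M] j by simp
  qed
  have inj: "\<alpha> = \<alpha>'" if \<alpha>: "\<alpha> \<in> link_patterns (Suc M)" and \<alpha>': "\<alpha>' \<in> link_patterns (Suc M)" and eq: "left_ends \<alpha> = left_ends \<alpha>'" for \<alpha> \<alpha>'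
  proof -
    obtain j where j: "1 \<le> j" "Suc j \<le> 2 * Suc M" "{j, Suc j} \<in> \<alpha>" using exists_adjacent_link[OF \<alpha>] by auto
    then have j': "{j, Suc j} \<in> \<alpha>'" using adjacent_link_iff[OF \<alpha> j(1,2)] adjacent_link_iff[OF \<alpha>' j(1,2)] eq by simp
    have "contract j (left_ends \<alpha>) = contract j (left_ends \<alpha>')" using eq by simp
    then have "left_ends (remove_link j \<alpha>) = left_ends (remove_link j \<alpha>')"
      unfolding le[OF \<alpha> j(3)] le[OF \<alpha>' j'] contract_add_peak .
    from inj_onD[OF IH(1) this remove_link_pattern(1)[OF \<alpha> j(3)] remove_link_pattern(1)[OF \<alpha>' j']]
    have "insert_link j (remove_link j \<alpha>) = insert_link j (remove_link j \<alpha>')" by (rule arg_cong)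
    then show ?thesis unfolding remove_link_pattern(2)[OF \<alpha> j(3)] remove_link_pattern(2)[OF \<alpha>' j'] .
  qed
  have surj: "L \<in> left_ends ` link_patterns (Suc M)" if L: "ballot (Suc M) L" for L
  proof -
    obtain j where j: "1 \<le> j" "j \<le> Suc (2*M)" "j \<in> L" "Suc j \<notin> L" using ballot_peak_exists[OF L] by blast
    have "ballot M (contract j L)"
      using L add_peak_contract[OF j(3,4)] ballot_add_peak_iff[OF j(1,2), of "contract j L"] by simp
    then have "contract j L \<in> left_ends ` link_patterns M" unfolding IH(2) by simp
    then obtain \<gamma> where \<gamma>: "\<gamma> \<in> link_patterns M" "left_ends \<gamma> = contract j L" by (metis imageE)
    then have "left_ends (insert_link j \<gamma>) = L"
      using left_ends_insert_link[OF \<gamma>(1), of j] add_peak_contract[OF j(3,4)] by (simp add: add_peak_def)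
    then show ?thesis using insert_link_pattern[OF \<gamma>(1) j(1,2)] by blast
  qed
  show ?case
    unfolding bij_betw_def
  proof (intro conjI equalityI)
    show "inj_on left_ends (link_patterns (Suc M))" by (rule inj_onI) (rule inj)
    show "left_ends ` link_patterns (Suc M) \<subseteq> {L. ballot (Suc M) L}" by (rule image_subsetI) (rule into)
    show "{L. ballot (Suc M) L} \<subseteq> left_ends ` link_patterns (Suc M)" using surj by (intro subsetI) simp
  qed
qed

lemma left_ends_remove_link:
  assumes "\<alpha> \<in> link_patterns (Suc M)" "{j, Suc j} \<in> \<alpha>"
  shows "left_ends \<alpha> = add_peak j (left_ends (remove_link j \<alpha>))"
  using left_ends_insert_link[OF remove_link_pattern(1)[OF assms], of j] remove_link_pattern(2)[OF assms]
  by (simp add: add_peak_def)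

lemma ballot_left_ends: "\<alpha> \<in> link_patterns N \<Longrightarrow> ballot N (left_ends \<alpha>)"
  using bij_betw_left_ends[of N] by (auto simp: bij_betw_def)


section \<open>Cover-inclusive Dyck tilings\<close>

definition strip :: "nat \<Rightarrow> nat \<Rightarrow> (nat \<Rightarrow> int) \<Rightarrow> (nat \<times> int) set" where
  "strip x y f = {(k, f k) | k. x \<le> k \<and> k \<le> y}"

lemma mem_strip: "(k, m) \<in> strip x y f \<longleftrightarrow> x \<le> k \<and> k \<le> y \<and> m = f k"
  by (auto simp: strip_def)

definition dyck_strip :: "nat \<Rightarrow> nat \<Rightarrow> (nat \<Rightarrow> int) \<Rightarrow> bool" where
  "dyck_strip x y f \<longleftrightarrow> x \<le> y \<and> (\<forall>k. x \<le> k \<longrightarrow> k < y \<longrightarrow> \<bar>f (Suc k) - f k\<bar> = 1) \<and> (\<forall>k. x \<le> k \<longrightarrow> k \<le> y \<longrightarrow> f x \<le> f k) \<and> f y = f x"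

lemma dyck_strip_parity:
  assumes "dyck_strip x y f"
  shows "i \<le> y - x \<Longrightarrow> even (f (x + i) - f x - int i)"
proof (induction i)
  case (Suc i)
  then have "\<bar>f (Suc (x + i)) - f (x + i)\<bar> = 1" using assms by (auto simp: dyck_strip_def)
  then have "f (Suc (x + i)) - f (x + i) = 1 \<or> f (Suc (x + i)) - f (x + i) = -1" by linarith
  then show ?case using Suc by auto presburger+
qed simp

lemma dyck_tile_iff: "dyck_tile t \<longleftrightarrow> (\<exists>x y f. dyck_strip x y f \<and> t = strip x y f)"
proof
  assume "dyck_tile t"
  then obtain n x h \<delta> where d: "dyck_path n \<delta>" and t: "t = {(x + i, h + \<delta> i) | i. i \<le> 2*n}"
    unfolding dyck_tile_def by blast
  define f where "f k = h + \<delta> (k - x)" for k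
  have "dyck_strip x (x + 2*n) f"
    using d unfolding dyck_strip_def dyck_path_def f_def by (auto simp: Suc_diff_le)
  moreover have "t = strip x (x + 2*n) f"
  proof (intro set_eqI iffI; clarify)
    fix k m assume "(k, m) \<in> t"
    then show "(k, m) \<in> strip x (x + 2*n) f" unfolding t mem_strip f_def by auto
  next
    fix k m assume "(k, m) \<in> strip x (x + 2*n) f"
    then have "k = x + (k - x)" "k - x \<le> 2*n" "m = h + \<delta> (k - x)" unfolding mem_strip f_def by auto
    then show "(k, m) \<in> t" unfolding t by blast
  qed
  ultimately show "\<exists>x y f. dyck_strip x y f \<and> t = strip x y f" by blast
next
  assume "\<exists>x y f. dyck_strip x y f \<and> t = strip x y f"
  then obtain x y f where d: "dyck_strip x y f" and t: "t = strip x y f" by blast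
  have xy: "x \<le> y" "f y = f x" using d by (auto simp: dyck_strip_def)
  have "even (int (y - x))" using dyck_strip_parity[OF d, of "y - x"] xy by simp
  then obtain n where n: "y - x = 2*n" by (metis even_of_nat evenE)
  then have y: "y = x + 2*n" using xy by simp
  define \<delta> where "\<delta> i = f (x + i) - f x" for i
  have "dyck_path n \<delta>" using d unfolding dyck_strip_def dyck_path_def \<delta>_def y by auto
  moreover have "t = {(x + i, f x + \<delta> i) | i. i \<le> 2*n}"
  proof (intro set_eqI iffI; clarify)
    fix k m assume "(k, m) \<in> t"
    then have "k = x + (k - x)" "k - x \<le> 2*n" "m = f x + \<delta> (k - x)" unfolding t mem_strip y \<delta>_def by auto
    then show "\<exists>i. (k, m) = (x + i, f x + \<delta> i) \<and> i \<le> 2*n" by blast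
  next
    fix i assume "i \<le> 2*n"
    then show "(x + i, f x + \<delta> i) \<in> t" unfolding t mem_strip y \<delta>_def by auto
  qed
  ultimately show "dyck_tile t" unfolding dyck_tile_def by blast
qed

lemma tile_unique_height: "dyck_tile t \<Longrightarrow> (k, m) \<in> t \<Longrightarrow> (k, m') \<in> t \<Longrightarrow> m = m'"
  by (auto simp: dyck_tile_iff mem_strip)

lemma extent_iff: "k \<in> extent t \<longleftrightarrow> (\<exists>m. (k, m) \<in> t)"
  by (force simp: extent_def)

lemma tile_neighbour:
  assumes "dyck_tile t" "(k, m) \<in> t" "k' \<in> extent t" "k' = Suc k \<or> k = Suc k'"
  shows "(k', m + 1) \<in> t \<or> (k', m - 1) \<in> t"
proof -
  obtain x y f where d: "dyck_strip x y f" and t: "t = strip x y f" using assms(1) dyck_tile_iff by blast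
  have k: "x \<le> k" "k \<le> y" "m = f k" "x \<le> k'" "k' \<le> y" using assms(2,3) by (auto simp: t mem_strip extent_iff)
  have step: "f (Suc i) = f i + 1 \<or> f (Suc i) = f i - 1" if "x \<le> i" "i < y" for i
  proof -
    have "\<bar>f (Suc i) - f i\<bar> = 1" using d that by (simp add: dyck_strip_def)
    then show ?thesis by linarith
  qed
  from assms(4) show ?thesis
  proof
    assume "k' = Suc k"
    then show ?thesis using step[of k] k by (auto simp: t mem_strip)
  next
    assume "k = Suc k'"
    then show ?thesis using step[of k'] k by (auto simp: t mem_strip)
  qed
qed

text \<open>The end squares of a tile are at its lowest height. A square none of whose neighbours in
  the tile lies higher can thus be an end only if the tile has no other square.\<close>

lemma tile_peak:
  assumes t: "dyck_tile t" and j: "(Suc i, m) \<in> t" and ns: "t \<noteq> {(Suc i, m)}"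
    and up: "(i, m + 1) \<notin> t" "(Suc (Suc i), m + 1) \<notin> t"
  shows "(i, m - 1) \<in> t" "(Suc (Suc i), m - 1) \<in> t"
proof -
  obtain x y f where d: "dyck_strip x y f" and tt: "t = strip x y f" using t dyck_tile_iff by blast
  have k: "x \<le> Suc i" "Suc i \<le> y" "m = f (Suc i)" using j by (auto simp: tt mem_strip)
  have minf: "f x \<le> f k" if "x \<le> k" "k \<le> y" for k using d that by (simp add: dyck_strip_def)
  have fy: "f y = f x" using d by (simp add: dyck_strip_def)
  have dn: "(k', m - 1) \<in> t" if "k' \<in> {x..y}" "k' = i \<or> k' = Suc (Suc i)" for k'
    using tile_neighbour[OF t j, of k'] that up by (auto simp: extent_iff tt mem_strip)
  have "Suc i \<noteq> x \<or> Suc i \<noteq> y"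
  proof (rule ccontr)
    assume "\<not> ?thesis"
    then have "strip x y f = {(Suc i, m)}" using k by (auto simp: strip_def)
    then show False using ns tt by simp
  qed
  moreover have "Suc i \<noteq> x" if "Suc i \<noteq> y"
  proof
    assume x: "Suc i = x"
    have "(Suc (Suc i), m - 1) \<in> t" by (rule dn) (use that k in auto)
    then have "f (Suc (Suc i)) = m - 1" "Suc (Suc i) \<le> y" by (auto simp: tt mem_strip)
    then show False using minf[of "Suc (Suc i)"] x k by simp
  qed
  moreover have "Suc i \<noteq> y" if "Suc i \<noteq> x"
  proof
    assume y: "Suc i = y"
    have "(i, m - 1) \<in> t" by (rule dn) (use that k in auto)
    then have "f i = m - 1" "x \<le> i" "i \<le> y" by (auto simp: tt mem_strip)
    then show False using minf[of i] y k fy by simp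
  qed
  ultimately have "x \<le> i" "Suc (Suc i) \<le> y" using k by linarith+
  then show "(i, m - 1) \<in> t" "(Suc (Suc i), m - 1) \<in> t" using dn k by auto
qed

text \<open>In common columns the height difference is even and nonzero, and from one column to the
  next it changes by at most 2, so it keeps its sign.\<close>

lemma tiles_do_not_cross:
  assumes t: "dyck_tile t" "dyck_tile t'" "t \<inter> t' = {}"
    and odd: "\<And>k m. (k, m) \<in> t \<union> t' \<Longrightarrow> odd (int k + m)"
    and above: "(k, m) \<in> t" "(k, m') \<in> t'" "m' < m"
  shows "\<not> covers t' t"
proof
  assume "covers t' t"
  then obtain l n n' where l: "(l, n) \<in> t" "(l, n') \<in> t'" "n < n'" unfolding covers_def by blast
  obtain x y f where d: "dyck_strip x y f" and tt: "t = strip x y f" using t(1) dyck_tile_iff by blast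
  obtain x' y' f' where d': "dyck_strip x' y' f'" and tt': "t' = strip x' y' f'" using t(2) dyck_tile_iff by blast
  define a where "a = max x x'"
  define b where "b = min y y'"
  have in_both: "i \<in> {a..b} \<longleftrightarrow> x \<le> i \<and> i \<le> y \<and> x' \<le> i \<and> i \<le> y'" for i by (auto simp: a_def b_def)
  have ne: "f i \<noteq> f' i" "even (f i - f' i)" if "i \<in> {a..b}" for i
  proof -
    have m: "(i, f i) \<in> t" "(i, f' i) \<in> t'" using that in_both by (auto simp: tt tt' mem_strip)
    then show "f i \<noteq> f' i" using t(3) by auto
    have "odd (int i + f i)" "odd (int i + f' i)" using m odd by auto
    then show "even (f i - f' i)" by presburger
  qed
  have step1: "f i < f' i \<longleftrightarrow> f (Suc i) < f' (Suc i)" if "i \<in> {a..b}" "Suc i \<in> {a..b}" for i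
  proof -
    have "\<bar>f (Suc i) - f i\<bar> = 1" "\<bar>f' (Suc i) - f' i\<bar> = 1"
    proof -
      have "x \<le> i" "i < y" "x' \<le> i" "i < y'" using that in_both[of i] in_both[of "Suc i"] by auto
      then show "\<bar>f (Suc i) - f i\<bar> = 1" "\<bar>f' (Suc i) - f' i\<bar> = 1" using d d' by (simp_all add: dyck_strip_def)
    qed
    then show ?thesis using ne[OF that(1)] ne[OF that(2)] by presburger
  qed
  have mono: "f i < f' i \<longleftrightarrow> f i' < f' i'" if "i \<in> {a..b}" "i' \<in> {a..b}" "i \<le> i'" for i i'
    using that(3,2)
  proof (induction i' rule: dec_induct)
    case (step i')
    then have "i' \<in> {a..b}" using that(1) by auto
    then show ?case using step step1[of i'] by auto
  qed simp
  have kl: "k \<in> {a..b}" "l \<in> {a..b}" "m = f k" "m' = f' k" "n = f l" "n' = f' l"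
    using above l in_both by (auto simp: tt tt' mem_strip)
  then show False using mono[of k l] mono[of l k] above(3) l(3) by (cases "k \<le> l") auto
qed

definition ctil :: "(nat \<times> int) set \<Rightarrow> (nat \<times> int) set set set" where
  "ctil D = {T. dyck_tiling D T \<and> cover_inclusive T}"

lemma finite_ctil: "finite D \<Longrightarrow> finite (ctil D)"
  by (rule finite_subset[of _ "Pow (Pow D)"]) (auto simp: ctil_def dyck_tiling_def partition_on_def)

lemma tiling_unique:
  assumes "dyck_tiling D T" "t \<in> T" "t' \<in> T" "s \<in> t" "s \<in> t'"
  shows "t = t'"
  using assms unfolding dyck_tiling_def partition_on_def disjoint_def by blast

lemma tiling_obtain:
  assumes "dyck_tiling D T" "s \<in> D"
  obtains t where "t \<in> T" "s \<in> t" "dyck_tile t"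
  using assms unfolding dyck_tiling_def partition_on_def by blast

lemma tiling_subset: "dyck_tiling D T \<Longrightarrow> t \<in> T \<Longrightarrow> t \<subseteq> D"
  unfolding dyck_tiling_def partition_on_def by blast

lemma tiling_tile: "dyck_tiling D T \<Longrightarrow> t \<in> T \<Longrightarrow> dyck_tile t"
  unfolding dyck_tiling_def by blast

lemma dyck_tile_singleton: "dyck_tile {(k, m)}"
  unfolding dyck_tile_iff
  by (rule exI[of _ k], rule exI[of _ k], rule exI[of _ "\<lambda>_. m"]) (auto simp: dyck_strip_def strip_def)

text \<open>A single square on top of its column covers each other tile that meets the column, and
  its extent is contained in that of such a tile. Adding or removing it therefore never affects
  cover-inclusiveness.\<close>

lemma bij_betw_add_top_square:
  assumes D: "(j, h) \<notin> D" and top: "\<And>m. (j, m) \<in> D \<Longrightarrow> m < h"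
  shows "bij_betw (insert {(j, h)}) (ctil D) {T \<in> ctil (insert (j, h) D). {(j, h)} \<in> T}"
proof (rule bij_betw_byWitness[where f' = "\<lambda>T. T - {{(j, h)}}"])
  have sub: "{(j, h)} \<notin> T" if "T \<in> ctil D" for T
    using that D tiling_subset[of D T "{(j, h)}"] by (auto simp: ctil_def)
  then show "\<forall>T\<in>ctil D. insert {(j, h)} T - {{(j, h)}} = T" by auto
  show "\<forall>T\<in>{T \<in> ctil (insert (j, h) D). {(j, h)} \<in> T}. insert {(j, h)} (T - {{(j, h)}}) = T" by auto
  show "insert {(j, h)} ` ctil D \<subseteq> {T \<in> ctil (insert (j, h) D). {(j, h)} \<in> T}"
  proof (rule image_subsetI)
    fix T assume "T \<in> ctil D"
    then have T: "dyck_tiling D T" "cover_inclusive T" by (auto simp: ctil_def)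
    have "dyck_tiling (insert (j, h) D) (insert {(j, h)} T)"
      using T(1) D unfolding dyck_tiling_def partition_on_def disjoint_def
      by (auto simp: dyck_tile_singleton)
    moreover have s: "extent {(j, h)} \<inter> extent t = {} \<or> covers {(j, h)} t \<and> extent {(j, h)} \<subseteq> extent t" if "t \<in> T" for t
    proof (cases "j \<in> extent t")
      case True
      then obtain m where "(j, m) \<in> t" by (auto simp: extent_iff)
      moreover from this have "m < h" using top tiling_subset[OF T(1) that] by blast
      ultimately show ?thesis using True by (auto simp: covers_def extent_def)
    qed (auto simp: extent_def)
    have "cover_inclusive (insert {(j, h)} T)"
      unfolding cover_inclusive_def
    proof (intro ballI impI)
      fix t1 t2 assume t: "t1 \<in> insert {(j, h)} T" "t2 \<in> insert {(j, h)} T" "t1 \<noteq> t2"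
      consider "t1 = {(j, h)}" "t2 \<in> T" | "t2 = {(j, h)}" "t1 \<in> T" | "t1 \<in> T" "t2 \<in> T" using t by blast
      then show "extent t1 \<inter> extent t2 = {} \<or> covers t1 t2 \<and> extent t1 \<subseteq> extent t2 \<or> covers t2 t1 \<and> extent t2 \<subseteq> extent t1"
      proof cases
        case 1
        then show ?thesis using s[of t2] by blast
      next
        case 2
        then show ?thesis using s[of t1] by blast
      next
        case 3
        then show ?thesis using T(2) t(3) unfolding cover_inclusive_def by blast
      qed
    qed
    ultimately show "insert {(j, h)} T \<in> {T \<in> ctil (insert (j, h) D). {(j, h)} \<in> T}" by (simp add: ctil_def)
  qed
  show "(\<lambda>T. T - {{(j, h)}}) ` {T \<in> ctil (insert (j, h) D). {(j, h)} \<in> T} \<subseteq> ctil D"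
  proof (rule image_subsetI)
    fix T assume "T \<in> {T \<in> ctil (insert (j, h) D). {(j, h)} \<in> T}"
    then have T: "dyck_tiling (insert (j, h) D) T" "cover_inclusive T" "{(j, h)} \<in> T" by (auto simp: ctil_def)
    have nj: "(j, h) \<notin> t" if "t \<in> T - {{(j, h)}}" for t
      using tiling_unique[OF T(1) _ T(3), of t "(j, h)"] that by auto
    have "\<Union>(T - {{(j, h)}}) = D"
    proof (intro set_eqI iffI)
      fix s assume "s \<in> \<Union>(T - {{(j, h)}})"
      then obtain t where t: "t \<in> T - {{(j, h)}}" "s \<in> t" by blast
      then show "s \<in> D" using tiling_subset[OF T(1), of t] nj[OF t(1)] by blast
    next
      fix s assume "s \<in> D"
      then obtain t where "t \<in> T" "s \<in> t" using tiling_obtain[OF T(1), of s] by blast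
      then show "s \<in> \<Union>(T - {{(j, h)}})" using D \<open>s \<in> D\<close> by blast
    qed
    then have "dyck_tiling D (T - {{(j, h)}})"
      using T(1) unfolding dyck_tiling_def partition_on_def disjoint_def by simp
    moreover have "cover_inclusive (T - {{(j, h)}})" using T(2) unfolding cover_inclusive_def by blast
    ultimately show "T - {{(j, h)}} \<in> ctil D" by (simp add: ctil_def)
  qed
qed

text \<open>Without the single tile at the top square of column \<open>j\<close>, the tile there descends on both sides, and
  cover-inclusiveness passes this shape on to all the tiles below.\<close>

lemma tiles_peak_at:
  assumes T: "T \<in> ctil D" "{(Suc i, h)} \<notin> T"
    and odd: "\<And>k m. (k, m) \<in> D \<Longrightarrow> odd (int k + m)"
    and top: "\<And>m. (Suc i, m) \<in> D \<Longrightarrow> m \<le> h" "\<And>m. (i, m) \<in> D \<Longrightarrow> m < h" "\<And>m. (Suc (Suc i), m) \<in> D \<Longrightarrow> m < h"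
    and col: "\<And>m. (Suc i, m) \<in> D \<Longrightarrow> m \<noteq> h \<Longrightarrow> (Suc i, m + 2) \<in> D"
    and m: "(Suc i, m) \<in> D"
  shows "\<exists>t\<in>T. (Suc i, m) \<in> t \<and> (i, m - 1) \<in> t \<and> (Suc (Suc i), m - 1) \<in> t"
  using m
proof (induction "nat (h - m)" arbitrary: m rule: less_induct)
  case less
  have til: "dyck_tiling D T" and ci: "cover_inclusive T" using T by (auto simp: ctil_def)
  obtain t where t: "t \<in> T" "(Suc i, m) \<in> t" "dyck_tile t" by (rule tiling_obtain[OF til less.prems])
  show ?case
  proof (cases "m = h")
    case True
    \<comment> \<open>At the top, the squares that would lie higher in the neighbouring columns are
      outside \<open>D\<close>, so the tile has to descend on both sides.\<close>
    have "(i, m + 1) \<notin> t" "(Suc (Suc i), m + 1) \<notin> t" "t \<noteq> {(Suc i, m)}"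
      using top(2,3) tiling_subset[OF til t(1)] True T(2) t(1) by fastforce+
    then show ?thesis using tile_peak[OF t(3,2)] t by blast
  next
    case False
    then have m2: "(Suc i, m + 2) \<in> D" using col less.prems by blast
    have "m < h" using False top(1)[OF less.prems] by simp
    then have "nat (h - (m + 2)) < nat (h - m)" by simp
    from less.hyps[OF this m2] obtain u where
      u: "u \<in> T" "(Suc i, m + 2) \<in> u" "(i, m + 2 - 1) \<in> u" "(Suc (Suc i), m + 2 - 1) \<in> u" by blast
    have "m + 2 - 1 = m + 1" by simp
    note u = u[unfolded this]
    have ut: "u \<noteq> t" using tile_unique_height[OF t(3) t(2)] u(2) by fastforce
    have dis: "u \<inter> t = {}" using tiling_unique[OF til u(1) t(1)] ut by blast
    have odd': "odd (int k + m)" if "(k, m) \<in> u \<union> t" for k m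
      using that odd tiling_subset[OF til] t(1) u(1) by blast
    \<comment> \<open>The tile \<open>u\<close> directly above \<open>t\<close> already has a peak
      here. As tiles do not cross, it is \<open>u\<close> that covers \<open>t\<close>, hence the
      extent of \<open>t\<close> contains both neighbouring columns.\<close>
    have nc: "\<not> covers t u"
      by (rule tiles_do_not_cross[OF tiling_tile[OF til u(1)] t(3) dis odd' u(2) t(2)]) auto
    have "Suc i \<in> extent u \<inter> extent t" using u(2) t(2) by (auto simp: extent_iff)
    then have "extent u \<subseteq> extent t"
      using ci u(1) t(1) ut nc unfolding cover_inclusive_def by blast
    moreover have "i \<in> extent u" "Suc (Suc i) \<in> extent u" using u unfolding extent_iff by blast+
    ultimately have "i \<in> extent t" "Suc (Suc i) \<in> extent t" by blast+
    then have "(i, m + 1) \<in> t \<or> (i, m - 1) \<in> t" "(Suc (Suc i), m + 1) \<in> t \<or> (Suc (Suc i), m - 1) \<in> t"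
      using tile_neighbour[OF t(3,2)] by blast+
    \<comment> \<open>The higher neighbouring squares belong to \<open>u\<close>, which leaves only
      the lower ones for \<open>t\<close>.\<close>
    then show ?thesis using dis u t by blast
  qed
qed

section \<open>Inserting a peak into all tiles of a column\<close>

definition crho :: "nat \<Rightarrow> nat \<Rightarrow> nat" where
  "crho j k = (if k < j then k else if k = j then j - 1 else k - 2)"

text \<open>Columns \<open>j - 1\<close>, \<open>j\<close> and \<open>j + 1\<close> collapse to
  column \<open>j - 1\<close>, the middle one after lowering by one. The preimage of a tile that
  meets column \<open>j - 1\<close> is the tile with an up-step and a down-step inserted there.
  Preimages commute with unions and intersections, so partitions are transported for free.\<close>

definition rho :: "nat \<Rightarrow> nat \<times> int \<Rightarrow> nat \<times> int" where
  "rho j = (\<lambda>(k, m). (crho j k, if k = j then m - 1 else m))"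

lemma surj_crho: "1 \<le> j \<Longrightarrow> \<exists>k. k \<noteq> j \<and> crho j k = l"
  by (rule exI[of _ "if l < j then l else l + 2"]) (auto simp: crho_def)

lemma surj_rho: assumes "1 \<le> j" shows "surj (rho j)"
proof -
  have "\<exists>s. (l, m) = rho j s" for l m
  proof -
    obtain k where "k \<noteq> j" "crho j k = l" using surj_crho[OF assms] by blast
    then show ?thesis by (intro exI[of _ "(k, m)"]) (simp add: rho_def)
  qed
  then show ?thesis by (auto simp: surj_def)
qed

lemma dyck_tile_vimage_rho:
  assumes j: "1 \<le> j" and t: "dyck_tile t"
  shows "dyck_tile (rho j -` t)"
proof -
  obtain x y f where d: "dyck_strip x y f" and tt: "t = strip x y f" using t dyck_tile_iff by blast
  define x' where "x' = (if x < j then x else x + 2)"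
  \<comment> \<open>A tile that ends in column \<open>j - 1\<close> is extended by the two inserted
    columns, so only tiles ending before that column keep their right end. The left end needs no
    such correction, because \<open>j - 1\<close> is the first of the three columns.\<close>
  define y' where "y' = (if Suc y < j then y else y + 2)"
  define f' where "f' k = (if k = j then f (j - 1) + 1 else f (crho j k))" for k
  have "rho j -` t = strip x' y' f'"
    using j by (auto simp: rho_def tt mem_strip x'_def y'_def f'_def crho_def split: if_splits)
  moreover have "dyck_strip x' y' f'"
    unfolding dyck_strip_def
  proof (intro conjI allI impI)
    have xy: "x \<le> y" using d by (simp add: dyck_strip_def)
    then show "x' \<le> y'" by (auto simp: x'_def y'_def)
    have fx: "f' x' = f x" using j by (auto simp: x'_def f'_def crho_def)
    have fy: "f' y' = f y" using j by (auto simp: y'_def f'_def crho_def)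
    show "f' y' = f' x'" using fx fy d by (simp add: dyck_strip_def)
    have minf: "f x \<le> f k" if "x \<le> k" "k \<le> y" for k using d that by (simp add: dyck_strip_def)
    show "f' x' \<le> f' k" if "x' \<le> k" "k \<le> y'" for k
    proof (cases "k = j")
      case True
      then have "f x \<le> f (j - 1)" using that j by (intro minf) (auto simp: x'_def y'_def split: if_splits)
      then show ?thesis unfolding fx using True by (simp add: f'_def)
    next
      case False
      then have "f x \<le> f (crho j k)" using that j by (intro minf) (auto simp: x'_def y'_def crho_def split: if_splits)
      then show ?thesis unfolding fx using False by (simp add: f'_def)
    qed
    show "\<bar>f' (Suc k) - f' k\<bar> = 1" if k: "x' \<le> k" "k < y'" for k
    proof -
      have st: "\<bar>f (Suc i) - f i\<bar> = 1" if "x \<le> i" "i < y" for i using d that by (simp add: dyck_strip_def)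
      consider "Suc k < j" | "Suc k = j" | "k = j" | "j < k" by linarith
      then show ?thesis
      proof cases
        case 1
        then show ?thesis using st[of k] k by (auto simp: f'_def crho_def x'_def y'_def split: if_splits)
      next
        case 2
        then show ?thesis by (auto simp: f'_def crho_def)
      next
        case 3
        then show ?thesis using j by (auto simp: f'_def crho_def)
      next
        case 4
        then have "crho j (Suc k) = Suc (k - 2)" "crho j k = k - 2" using j by (auto simp: crho_def)
        then show ?thesis using st[of "k - 2"] k 4 j by (auto simp: f'_def x'_def y'_def split: if_splits)
      qed
    qed
  qed
  ultimately show ?thesis using dyck_tile_iff by blast
qed

text \<open>The hypotheses leave two possibilities: the tile has a peak in column
  \<open>Suc i\<close> with both lower neighbours, or it avoids all three columns. In the first case
  the peak can be cut out, and in the second case the tile is at most shifted.\<close>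

lemma saturated_tile:
  assumes t: "dyck_tile t"
    and sat: "\<And>m. (Suc i, m) \<in> t \<longleftrightarrow> (i, m - 1) \<in> t" "\<And>m. (Suc i, m) \<in> t \<longleftrightarrow> (Suc (Suc i), m - 1) \<in> t"
  shows "\<exists>t'. dyck_tile t' \<and> t = rho (Suc i) -` t'"
proof -
  obtain x y f where d: "dyck_strip x y f" and tt: "t = strip x y f" using t dyck_tile_iff by blast
  have xy: "x \<le> y" using d by (simp add: dyck_strip_def)
  have S: "x \<le> i \<and> Suc (Suc i) \<le> y \<and> f i = f (Suc i) - 1 \<and> f (Suc (Suc i)) = f (Suc i) - 1 \<or> y < i \<or> Suc (Suc i) < x"
  proof (cases "x \<le> Suc i \<and> Suc i \<le> y")
    case True
    then show ?thesis using sat(1)[of "f (Suc i)"] sat(2)[of "f (Suc i)"] by (auto simp: tt mem_strip)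
  next
    case False
    then have "(i, f i) \<notin> t" "(Suc (Suc i), f (Suc (Suc i))) \<notin> t"
      using sat(1)[of "f i + 1"] sat(2)[of "f (Suc (Suc i)) + 1"] by (auto simp: tt mem_strip)
    then show ?thesis using False xy by (auto simp: tt mem_strip)
  qed
  define x' where "x' = (if x \<le> i then x else x - 2)"
  define y' where "y' = (if y < i then y else y - 2)"
  define f' where "f' k = (if k \<le> i then f k else f (k + 2))" for k
  have "t = rho (Suc i) -` strip x' y' f'"
  proof (intro set_eqI, clarify)
    fix k m
    show "(k, m) \<in> t \<longleftrightarrow> (k, m) \<in> rho (Suc i) -` strip x' y' f'"
    proof -
      consider "k \<le> i" | "k = Suc i" | "k = Suc (Suc i)" | "Suc (Suc i) < k" by linarith
      then show ?thesis
      proof cases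
        case 1
        then show ?thesis using S xy by (auto simp: rho_def tt mem_strip x'_def y'_def f'_def crho_def)
      next
        case 2
        then show ?thesis using S by (auto simp: rho_def tt mem_strip x'_def y'_def f'_def crho_def)
      next
        case 3
        then show ?thesis using S by (auto simp: rho_def tt mem_strip x'_def y'_def f'_def crho_def)
      next
        case 4
        then have "crho (Suc i) k = k - 2" "\<not> k - 2 \<le> i" "k - 2 + 2 = k" by (auto simp: crho_def)
        then show ?thesis using S 4 by (auto simp: rho_def tt mem_strip x'_def y'_def f'_def)
      qed
    qed
  qed
  moreover have "dyck_strip x' y' f'"
    unfolding dyck_strip_def
  proof (intro conjI allI impI)
    show "x' \<le> y'" using S xy by (auto simp: x'_def y'_def)
    have fx: "f' x' = f x"
    proof (cases "x \<le> i")
      case False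
      then have "x - 2 + 2 = x" "\<not> x - 2 \<le> i" using S xy by auto
      then show ?thesis using False by (simp add: f'_def x'_def)
    qed (simp add: f'_def x'_def)
    have fy: "f' y' = f y"
    proof (cases "y < i")
      case False
      then have y: "Suc (Suc i) \<le> y" using S xy by auto
      show ?thesis
      proof (cases "y = Suc (Suc i)")
        case True
        then show ?thesis using S xy by (auto simp: f'_def y'_def)
      next
        case False
        then have "y - 2 + 2 = y" "\<not> y - 2 \<le> i" using y by auto
        then show ?thesis using y by (simp add: f'_def y'_def)
      qed
    qed (simp add: f'_def y'_def)
    show "f' y' = f' x'" using fx fy d by (simp add: dyck_strip_def)
    have minf: "f x \<le> f k" if "x \<le> k" "k \<le> y" for k using d that by (simp add: dyck_strip_def)
    show "f' x' \<le> f' k" if "x' \<le> k" "k \<le> y'" for k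
    proof (cases "k \<le> i")
      case True
      then have "f x \<le> f k" using that S xy by (intro minf) (auto simp: x'_def y'_def split: if_splits)
      then show ?thesis unfolding fx using True by (simp add: f'_def)
    next
      case False
      then have "f x \<le> f (k + 2)" using that S xy by (intro minf) (auto simp: x'_def y'_def split: if_splits)
      then show ?thesis unfolding fx using False by (simp add: f'_def)
    qed
    show "\<bar>f' (Suc k) - f' k\<bar> = 1" if k: "x' \<le> k" "k < y'" for k
    proof -
      have st: "\<bar>f (Suc i) - f i\<bar> = 1" if "x \<le> i" "i < y" for i using d that by (simp add: dyck_strip_def)
      consider "Suc k \<le> i" | "k = i" | "i < k" by linarith
      then show ?thesis
      proof cases
        case 1
        then show ?thesis using st[of k] k S xy by (auto simp: f'_def x'_def y'_def split: if_splits)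
      next
        case 2
        then have "x \<le> i" "Suc (Suc i) < y" using k S xy by (auto simp: x'_def y'_def split: if_splits)
        then show ?thesis using 2 S st[of "Suc (Suc i)"] by (auto simp: f'_def)
      next
        case 3
        then show ?thesis using st[of "k + 2"] k S xy by (auto simp: f'_def x'_def y'_def split: if_splits)
      qed
    qed
  qed
  ultimately show ?thesis using dyck_tile_iff by blast
qed

lemma extent_vimage_rho:
  assumes "1 \<le> j"
  shows "extent (rho j -` t) = crho j -` extent t"
proof -
  have "(\<exists>m. rho j (k, m) \<in> t) \<longleftrightarrow> (\<exists>m. (crho j k, m) \<in> t)" for k
  proof
    assume "\<exists>m. (crho j k, m) \<in> t"
    then obtain m where "(crho j k, m) \<in> t" by blast
    then have "rho j (k, if k = j then m + 1 else m) \<in> t" by (cases "k = j") (simp_all add: rho_def)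
    then show "\<exists>m. rho j (k, m) \<in> t" by blast
  qed (auto simp: rho_def)
  then show ?thesis by (auto simp: extent_iff)
qed

lemma covers_vimage_rho:
  assumes "1 \<le> j"
  shows "covers (rho j -` t1) (rho j -` t2) \<longleftrightarrow> covers t1 t2"
proof
  assume "covers (rho j -` t1) (rho j -` t2)"
  then obtain k m m' where "rho j (k, m) \<in> t1" "rho j (k, m') \<in> t2" "m' < m" unfolding covers_def by blast
  then show "covers t1 t2" unfolding covers_def by (auto simp: rho_def split: if_splits) (metis diff_strict_right_mono)+
next
  assume "covers t1 t2"
  then obtain l m m' where l: "(l, m) \<in> t1" "(l, m') \<in> t2" "m' < m" unfolding covers_def by blast
  obtain k where k: "k \<noteq> j" "crho j k = l" using surj_crho[OF assms] by blast
  then have "(k, m) \<in> rho j -` t1" "(k, m') \<in> rho j -` t2" using l by (simp_all add: rho_def)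
  then show "covers (rho j -` t1) (rho j -` t2)" using l(3) unfolding covers_def by blast
qed

lemma cover_inclusive_vimage_rho:
  assumes j: "1 \<le> j"
  shows "cover_inclusive ((\<lambda>t. rho j -` t) ` T) \<longleftrightarrow> cover_inclusive T"
proof -
  have inj: "rho j -` t1 = rho j -` t2 \<longleftrightarrow> t1 = t2" for t1 t2
    using surj_rho[OF j] by (metis surj_image_vimage_eq)
  have "crho j ` UNIV = UNIV" using surj_crho[OF j] by (metis surjI)
  then have sub: "crho j -` A \<subseteq> crho j -` B \<longleftrightarrow> A \<subseteq> B" "crho j -` A \<inter> crho j -` B = {} \<longleftrightarrow> A \<inter> B = {}" for A B
    by (auto simp: set_eq_iff subset_iff) (metis UNIV_I imageE)+
  show ?thesis
    unfolding cover_inclusive_def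
    by (simp add: inj extent_vimage_rho[OF j] covers_vimage_rho[OF j] sub)
qed

lemma partition_on_vimage_surj:
  assumes "surj r"
  shows "partition_on (r -` D) ((\<lambda>t. r -` t) ` T) \<longleftrightarrow> partition_on D T"
proof -
  have inj: "r -` t1 = r -` t2 \<longleftrightarrow> t1 = t2" for t1 t2
    using assms by (metis surj_image_vimage_eq)
  have "\<Union>((\<lambda>t. r -` t) ` T) = r -` \<Union>T" by auto
  moreover have "r -` t1 \<inter> r -` t2 = {} \<longleftrightarrow> t1 \<inter> t2 = {}" for t1 t2
    using inj[of "t1 \<inter> t2" "{}"] by auto
  moreover have "{} \<in> (\<lambda>t. r -` t) ` T \<longleftrightarrow> {} \<in> T"
  proof -
    have "r -` t = {} \<longleftrightarrow> t = {}" for t using inj[of t "{}"] by simp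
    then show ?thesis by (metis (no_types, lifting) imageE image_eqI)
  qed
  ultimately show ?thesis unfolding partition_on_def disjoint_def by (simp add: inj)
qed

text \<open>Taking preimages is injective because \<open>rho j\<close> is surjective. Every tiling
  without the single top tile is reached: \<open>tiles_peak_at\<close> shows that all its tiles in
  column \<open>j\<close> have a peak there, so each tile is a preimage by
  \<open>saturated_tile\<close>.\<close>

lemma bij_betw_vimage_rho:
  assumes j: "j = Suc i"
    and odd: "\<And>k m. (k, m) \<in> rho j -` D \<Longrightarrow> odd (int k + m)"
    and top: "\<And>m. (Suc i, m) \<in> rho j -` D \<Longrightarrow> m \<le> h" "\<And>m. (i, m) \<in> rho j -` D \<Longrightarrow> m < h" "\<And>m. (Suc (Suc i), m) \<in> rho j -` D \<Longrightarrow> m < h"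
    and col: "\<And>m. (Suc i, m) \<in> rho j -` D \<Longrightarrow> m \<noteq> h \<Longrightarrow> (Suc i, m + 2) \<in> rho j -` D"
  shows "bij_betw ((`) (\<lambda>t. rho j -` t)) (ctil D) {T \<in> ctil (rho j -` D). {(j, h)} \<notin> T}"
proof -
  have j1: "1 \<le> j" using j by simp
  have surj: "surj (rho j)" by (rule surj_rho[OF j1])
  have invi: "rho j ` (rho j -` t) = t" for t using surj by (simp add: surj_image_vimage_eq)
  have rhos: "rho j (Suc i, m) = (i, m - 1)" "rho j (i, m - 1) = (i, m - 1)" "rho j (Suc (Suc i), m - 1) = (i, m - 1)" for m
    using j by (auto simp: rho_def crho_def)
  show ?thesis
    unfolding bij_betw_def
  proof (intro conjI equalityI)
    have "inj (\<lambda>t. rho j -` t)" using invi by (intro inj_on_inverseI[where g = "(`) (rho j)"]) auto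
    then show "inj_on ((`) (\<lambda>t. rho j -` t)) (ctil D)"
      by (intro inj_onI) (simp add: inj_image_eq_iff)
    show "(`) (\<lambda>t. rho j -` t) ` ctil D \<subseteq> {T \<in> ctil (rho j -` D). {(j, h)} \<notin> T}"
    proof (rule image_subsetI)
      fix T assume "T \<in> ctil D"
      then have T: "dyck_tiling D T" "cover_inclusive T" by (auto simp: ctil_def)
      have "dyck_tiling (rho j -` D) ((\<lambda>t. rho j -` t) ` T)"
        using T(1) dyck_tile_vimage_rho[OF j1] unfolding dyck_tiling_def by (simp add: partition_on_vimage_surj[OF surj])
      \<comment> \<open>A preimage that meets one of the three collapsed columns meets all of
        them.\<close>
      moreover have "{(j, h)} \<noteq> rho j -` t" for t
      proof
        assume e: "{(j, h)} = rho j -` t"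
        then have "(Suc i, h) \<in> rho j -` t" using j by auto
        then have "(i, h - 1) \<in> rho j -` t" by (simp add: rhos)
        then have "(i, h - 1) \<in> {(j, h)}" by (simp only: e)
        then show False using j by simp
      qed
      ultimately show "(\<lambda>t. rho j -` t) ` T \<in> {T \<in> ctil (rho j -` D). {(j, h)} \<notin> T}"
        using T(2) cover_inclusive_vimage_rho[OF j1] by (auto simp: ctil_def)
    qed
    show "{T \<in> ctil (rho j -` D). {(j, h)} \<notin> T} \<subseteq> (`) (\<lambda>t. rho j -` t) ` ctil D"
    proof
      fix T assume "T \<in> {T \<in> ctil (rho j -` D). {(j, h)} \<notin> T}"
      then have T: "T \<in> ctil (rho j -` D)" "{(Suc i, h)} \<notin> T" using j by auto
      have til: "dyck_tiling (rho j -` D) T" and ci: "cover_inclusive T" using T by (auto simp: ctil_def)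
      have "\<exists>t'. dyck_tile t' \<and> t = rho j -` t'" if t: "t \<in> T" for t
        unfolding j
      proof (rule saturated_tile[OF tiling_tile[OF til t]])
        have key: "(i, m - 1) \<in> t \<and> (Suc i, m) \<in> t \<and> (Suc (Suc i), m - 1) \<in> t"
          if s: "s \<in> t" "rho j s = (i, m - 1)" "s \<in> {(i, m - 1), (Suc i, m), (Suc (Suc i), m - 1)}" for s m
        proof -
          have "s \<in> rho j -` D" using tiling_subset[OF til t] s(1) by blast
          then have "(Suc i, m) \<in> rho j -` D" using s(2) rhos(1) by simp
          then obtain u where u: "u \<in> T" "(Suc i, m) \<in> u" "(i, m - 1) \<in> u" "(Suc (Suc i), m - 1) \<in> u"
            using tiles_peak_at[OF T odd top col] by blast
          then have "s \<in> u" using s(3) by blast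
          then have "u = t" using tiling_unique[OF til u(1) t] s(1) by blast
          then show ?thesis using u by blast
        qed
        show "(Suc i, m) \<in> t \<longleftrightarrow> (i, m - 1) \<in> t" for m
          using key[of "(Suc i, m)" m] key[of "(i, m - 1)" m] rhos by blast
        show "(Suc i, m) \<in> t \<longleftrightarrow> (Suc (Suc i), m - 1) \<in> t" for m
          using key[of "(Suc i, m)" m] key[of "(Suc (Suc i), m - 1)" m] rhos by blast
      qed
      then have t': "rho j -` (rho j ` t) = t \<and> dyck_tile (rho j ` t)" if "t \<in> T" for t
        using that invi by metis
      have T': "(\<lambda>t. rho j -` t) ` ((`) (rho j) ` T) = T"
      proof -
        have "(\<lambda>t. rho j -` t) ` ((`) (rho j) ` T) = (\<lambda>t. rho j -` (rho j ` t)) ` T" by (rule image_image)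
        also have "\<dots> = (\<lambda>t. t) ` T" by (rule image_cong[OF refl]) (use t' in blast)
        finally show ?thesis by simp
      qed
      have "partition_on D ((`) (rho j) ` T)"
        using til partition_on_vimage_surj[OF surj, of D "(`) (rho j) ` T"] unfolding T' dyck_tiling_def by simp
      moreover have "cover_inclusive ((`) (rho j) ` T)"
        using ci cover_inclusive_vimage_rho[OF j1, of "(`) (rho j) ` T"] unfolding T' by simp
      ultimately have "(`) (rho j) ` T \<in> ctil D" using t' by (auto simp: ctil_def dyck_tiling_def)
      then show "T \<in> (`) (\<lambda>t. rho j -` t) ` ctil D" using T' by (metis image_eqI)
    qed
  qed
qed

section \<open>Skew shapes of words and the recursion for the coefficients\<close>

lemma word_path_parity: "even (word_path L k + int k)"
  by (induction k) auto

definition skew :: "nat \<Rightarrow> nat set \<Rightarrow> nat set \<Rightarrow> (nat \<times> int) set" where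
  "skew n A B = {(k, m). k \<le> n \<and> odd (int k + m) \<and> word_path A k < m \<and> m < word_path B k}"

lemma mem_skew: "(k, m) \<in> skew n A B \<longleftrightarrow> k \<le> n \<and> odd (int k + m) \<and> word_path A k < m \<and> m < word_path B k"
  by (simp add: skew_def)

lemma finite_skew: "finite (skew n A B)"
  by (rule finite_subset[of _ "Sigma {..n} (\<lambda>k. {word_path A k<..<word_path B k})"]) (auto simp: skew_def)

lemma word_path_step: "\<bar>word_path L (Suc k) - word_path L k\<bar> = 1"
  by simp

text \<open>The conditions on the left and right corners of a square follow from those on its
  column, as both paths have unit steps. The outermost columns are excluded automatically, because
  both paths are at height 0 there.\<close>

lemma skew_diagram_eq:
  assumes "\<alpha> \<in> link_patterns N" "\<beta> \<in> link_patterns N"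
  shows "skew_diagram N \<alpha> \<beta> = skew (2*N) (left_ends \<alpha>) (left_ends \<beta>)"
proof (intro set_eqI iffI; clarify)
  fix k m assume "(k, m) \<in> skew_diagram N \<alpha> \<beta>"
  then show "(k, m) \<in> skew (2*N) (left_ends \<alpha>) (left_ends \<beta>)"
    by (auto simp: skew_diagram_def mem_skew path_of_eq)
next
  fix k m assume km: "(k, m) \<in> skew (2*N) (left_ends \<alpha>) (left_ends \<beta>)"
  let ?p = "word_path (left_ends \<alpha>)" and ?q = "word_path (left_ends \<beta>)"
  have z: "?p (2*N) = 0" "?q (2*N) = 0" using ballot_left_ends assms by (auto simp: ballot_def)
  have m: "k \<le> 2*N" "odd (int k + m)" "?p k < m" "m < ?q k" using km by (auto simp: mem_skew)
  have "k \<noteq> 0" using m by (intro notI) simp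
  then obtain i where i: "k = Suc i" by (cases k) auto
  have "k \<noteq> 2*N" using m z by (intro notI) simp
  then have k: "k + 1 \<le> 2*N" using m(1) by simp
  have "\<bar>?p k - ?p i\<bar> = 1" "\<bar>?q k - ?q i\<bar> = 1" unfolding i by (rule word_path_step)+
  moreover have "\<bar>?p (k + 1) - ?p k\<bar> = 1" "\<bar>?q (k + 1) - ?q k\<bar> = 1" unfolding Suc_eq_plus1[symmetric] by (rule word_path_step)+
  ultimately have "?p i \<le> m" "m \<le> ?q i" "?p (k + 1) \<le> m" "m \<le> ?q (k + 1)" using m(3,4) by linarith+
  then show "(k, m) \<in> skew_diagram N \<alpha> \<beta>"
    using m k i unfolding skew_diagram_def path_of_eq by simp
qed

definition M_word :: "nat \<Rightarrow> nat set \<Rightarrow> nat set \<Rightarrow> int" where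
  "M_word N A B = (if \<forall>k\<le>2*N. word_path A k \<le> word_path B k
     then (- 1) ^ card (skew (2*N) A B) * int (card (ctil (skew (2*N) A B))) else 0)"

lemma M_inv_eq:
  assumes "\<alpha> \<in> link_patterns N" "\<beta> \<in> link_patterns N"
  shows "M_inv N \<alpha> \<beta> = M_word N (left_ends \<alpha>) (left_ends \<beta>)"
proof -
  have "path_le N \<alpha> \<beta> \<longleftrightarrow> (\<forall>k\<le>2*N. word_path (left_ends \<alpha>) k \<le> word_path (left_ends \<beta>) k)"
    unfolding path_le_def path_of_eq by auto
  then show ?thesis
    unfolding M_inv_def M_word_def num_cover_inclusive_tilings_def ctil_def skew_diagram_eq[OF assms] by simp
qed

lemma vimage_rho_skew:
  assumes j: "1 \<le> j" "j \<le> Suc (2*M)"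
  shows "rho j -` skew (2*M) A K = skew (2 * Suc M) (add_peak j A) (add_peak j K)"
proof (intro set_eqI, clarify)
  fix k m
  show "(k, m) \<in> rho j -` skew (2*M) A K \<longleftrightarrow> (k, m) \<in> skew (2 * Suc M) (add_peak j A) (add_peak j K)"
  proof -
    consider "k < j" | "k = j" | "j < k" by linarith
    then show ?thesis
    proof cases
      case 1
      then show ?thesis using j by (auto simp: rho_def crho_def mem_skew word_path_add_peak[OF j(1)] simp del: word_path.simps)
    next
      case 2
      have "odd (int (j - 1) + (m - 1)) \<longleftrightarrow> odd (int j + m)" using j by (auto simp: of_nat_diff)
      then show ?thesis using j 2 by (auto simp: rho_def crho_def mem_skew word_path_add_peak[OF j(1)] simp del: word_path.simps)
    next
      case 3
      then have "odd (int (k - 2) + m) \<longleftrightarrow> odd (int k + m)" using j by (auto simp: of_nat_diff)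
      then show ?thesis using j 3 by (auto simp: rho_def crho_def mem_skew word_path_add_peak[OF j(1)] simp del: word_path.simps)
    qed
  qed
qed

text \<open>One column is replaced by three copies of itself, so the number of squares grows by an
  even number and the sign of the coefficient is preserved.\<close>

lemma card_vimage_rho:
  assumes j: "1 \<le> j" and fin: "finite D"
  shows "even (card (rho j -` D)) \<longleftrightarrow> even (card D)"
proof -
  define C where "C = {m. (j - 1, m) \<in> D}"
  have "C = snd ` (D \<inter> {j - 1} \<times> UNIV)" by (force simp: C_def)
  then have finC: "finite C" using fin by simp
  define e where "e = (\<lambda>(k, m :: int). (widen j k, m))"
  define X where "X = (\<lambda>m. (j, m + 1)) ` C"
  define Y where "Y = (\<lambda>m. (Suc j, m)) ` C"
  have "rho j -` D = e ` D \<union> (X \<union> Y)"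
  proof (intro set_eqI, clarify)
    fix k m
    have e: "(k, m) \<in> e ` D \<longleftrightarrow> k \<noteq> j \<and> k \<noteq> Suc j \<and> (narrow j k, m) \<in> D"
    proof
      assume "k \<noteq> j \<and> k \<noteq> Suc j \<and> (narrow j k, m) \<in> D"
      then have "(k, m) = e (narrow j k, m)" "(narrow j k, m) \<in> D" by (simp_all add: e_def widen_narrow)
      then show "(k, m) \<in> e ` D" by blast
    qed (auto simp: e_def)
    have x: "(k, m) \<in> X \<longleftrightarrow> k = j \<and> (j - 1, m - 1) \<in> D"
    proof
      assume "k = j \<and> (j - 1, m - 1) \<in> D"
      then have "(k, m) = (j, (m - 1) + 1)" "m - 1 \<in> C" by (simp_all add: C_def)
      then show "(k, m) \<in> X" unfolding X_def by blast
    qed (auto simp: X_def C_def)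
    have y: "(k, m) \<in> Y \<longleftrightarrow> k = Suc j \<and> (j - 1, m) \<in> D" by (auto simp: Y_def C_def)
    show "(k, m) \<in> rho j -` D \<longleftrightarrow> (k, m) \<in> e ` D \<union> (X \<union> Y)"
      unfolding Un_iff e x y using j by (auto simp: rho_def crho_def narrow_def)
  qed
  moreover have "e ` D \<inter> (X \<union> Y) = {}"
    unfolding e_def X_def Y_def using widen_neq[of j] by fastforce
  moreover have "X \<inter> Y = {}" by (auto simp: X_def Y_def)
  moreover have "card (e ` D) = card D"
    by (rule card_image) (use inj_widen[of j] in \<open>auto simp: e_def inj_on_def\<close>)
  moreover have "card X = card C" "card Y = card C"
    unfolding X_def Y_def by (rule card_image, simp add: inj_on_def)+
  ultimately have "card (rho j -` D) = card D + (card C + card C)"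
    using fin finC by (simp add: card_Un_disjoint X_def Y_def)
  then show ?thesis by simp
qed

text \<open>The coefficients satisfy the same recursion as the pure partition functions under the fusion of
  two adjacent points.\<close>

lemma M_word_recursion:
  assumes A: "ballot (Suc M) A" and K: "ballot M K" and j: "1 \<le> j" "j \<le> Suc (2*M)"
  shows "M_word (Suc M) A (add_peak j K) + (if ballot (Suc M) (add_valley j K) then M_word (Suc M) A (add_valley j K) else 0)
    = (if j \<in> A \<and> Suc j \<notin> A then M_word M (contract j A) K else 0)"
proof -
  define p where "p = word_path A"
  \<comment> \<open>The height at which the peak or valley is inserted. If the path of
    \<open>A\<close> is low enough, \<open>(j, h)\<close> is the top square of column
    \<open>j\<close> below the peak, and replacing the peak by a valley removes just this
    square.\<close>
  define h where "h = word_path K (j - 1)"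
  define U where "U = add_peak j K"
  define V where "V = add_valley j K"
  define n where "n = 2 * Suc M"
  obtain i where i: "j = Suc i" using j by (cases j) auto
  have jn: "j \<le> n" "Suc j \<le> n" "i \<le> n" using j i by (auto simp: n_def)
  have U: "word_path U k = (if k < j then word_path K k else if k = j then h + 1 else word_path K (k - 2))" for k
    unfolding U_def h_def by (rule word_path_add_peak[OF j(1)])
  have V: "word_path V k = (if k < j then word_path K k else if k = j then h - 1 else word_path K (k - 2))" for k
    unfolding V_def h_def by (rule word_path_add_valley[OF j(1)])
  have Ui: "word_path U i = h" "word_path U (Suc j) = h" unfolding U by (simp_all add: i h_def)
  have par: "even (p k + int k)" for k unfolding p_def by (rule word_path_parity)
  have parh: "even (h + int i)" using word_path_parity[of K i] by (simp add: h_def i)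
  have st: "\<bar>p (Suc k) - p k\<bar> = 1" for k unfolding p_def by (rule word_path_step)
  have pos: "0 \<le> p j" using A jn unfolding ballot_def p_def n_def by blast
  have UV: "word_path V k = word_path U k" if "k \<noteq> j" for k using that by (simp add: U V)
  have leV: "(\<forall>k\<le>n. p k \<le> word_path V k) \<longleftrightarrow> (\<forall>k\<le>n. p k \<le> word_path U k) \<and> p j < h"
  proof (intro iffI conjI allI impI)
    fix k assume a: "\<forall>k\<le>n. p k \<le> word_path V k" "k \<le> n"
    then have "p k \<le> word_path V k" by blast
    also have "\<dots> \<le> word_path U k" by (auto simp: U V)
    finally show "p k \<le> word_path U k" .
  next
    assume "\<forall>k\<le>n. p k \<le> word_path V k"
    then have "p j \<le> word_path V j" using jn by blast
    then show "p j < h" by (simp add: V)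
  next
    fix k assume a: "(\<forall>k\<le>n. p k \<le> word_path U k) \<and> p j < h" "k \<le> n"
    show "p k \<le> word_path V k"
      by (cases "k = j") (use a in \<open>auto simp: UV, simp add: V\<close>)
  qed
  define DU where "DU = skew n A U"
  define DV where "DV = skew n A V"
  have finU: "finite DU" unfolding DU_def by (rule finite_skew)
  have memU: "(k, m) \<in> DU \<longleftrightarrow> k \<le> n \<and> odd (int k + m) \<and> p k < m \<and> m < word_path U k" for k m
    by (simp add: DU_def mem_skew p_def)
  have memV: "(k, m) \<in> DV \<longleftrightarrow> k \<le> n \<and> odd (int k + m) \<and> p k < m \<and> m < word_path V k" for k m
    by (simp add: DV_def mem_skew p_def)
  have Uj: "word_path U j = h + 1" and Vj: "word_path V j = h - 1" by (simp_all add: U V)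
  have topU: "m \<le> h" if "(Suc i, m) \<in> DU" for m using that Uj by (simp add: memU i)
  have topU': "m < h" if "(i, m) \<in> DU" for m using that Ui by (simp add: memU)
  have topU'': "m < h" if "(Suc (Suc i), m) \<in> DU" for m using that Ui by (simp add: memU i)
  have oddU: "odd (int k + m)" if "(k, m) \<in> DU" for k m using that by (simp add: memU)
  have colU: "(Suc i, m + 2) \<in> DU" if "(Suc i, m) \<in> DU" "m \<noteq> h" for m
  proof -
    have m: "odd (int (Suc i) + m)" "p j < m" "m < h + 1" using that(1) Uj by (simp_all add: memU i)
    then have "m + 2 < h + 1" using that(2) parh by presburger
    then show ?thesis using m jn Uj by (simp add: memU i)
  qed
  have split: "card (ctil DU) = card {T \<in> ctil DU. {(j, h)} \<in> T} + card {T \<in> ctil DU. {(j, h)} \<notin> T}"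
  proof -
    have "ctil DU = {T \<in> ctil DU. {(j, h)} \<in> T} \<union> {T \<in> ctil DU. {(j, h)} \<notin> T}" by blast
    moreover have "card ({T \<in> ctil DU. {(j, h)} \<in> T} \<union> {T \<in> ctil DU. {(j, h)} \<notin> T}) =
       card {T \<in> ctil DU. {(j, h)} \<in> T} + card {T \<in> ctil DU. {(j, h)} \<notin> T}"
      by (rule card_Un_disjoint) (use finite_ctil[OF finU] in auto)
    ultimately show ?thesis by simp
  qed
  have DUV: "DU = insert (j, h) DV" "(j, h) \<notin> DV" if "p j < h"
  proof -
    show "(j, h) \<notin> DV" by (simp add: memV Vj)
    show "DU = insert (j, h) DV"
    proof (intro set_eqI, clarify)
      fix k m
      have "odd (int j + m) \<Longrightarrow> m < h + 1 \<longleftrightarrow> m < h - 1 \<or> m = h" using parh i by presburger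
      moreover have "odd (int j + h)" using parh i by presburger
      ultimately show "(k, m) \<in> DU \<longleftrightarrow> (k, m) \<in> insert (j, h) DV"
        using that jn(1) UV[of k] by (cases "k = j") (auto simp: memU memV Uj Vj)
    qed
  qed
  have single: "card {T \<in> ctil DU. {(j, h)} \<in> T} = (if p j < h then card (ctil DV) else 0)"
  proof (cases "p j < h")
    case True
    have "bij_betw (insert {(j, h)}) (ctil DV) {T \<in> ctil (insert (j, h) DV). {(j, h)} \<in> T}"
      by (rule bij_betw_add_top_square) (use DUV[OF True] in \<open>auto simp: memV Vj\<close>)
    then show ?thesis using True DUV(1)[OF True] bij_betw_same_card by fastforce
  next
    case False
    have "(j, h) \<notin> DU" using False by (simp add: memU)
    then have "{T \<in> ctil DU. {(j, h)} \<in> T} = {}" using tiling_subset by (fastforce simp: ctil_def)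
    with False show ?thesis by (simp only: card.empty if_False)
  qed
  have nonsingle: "card {T \<in> ctil DU. {(j, h)} \<notin> T} = (if j \<in> A \<and> Suc j \<notin> A then card (ctil (skew (2*M) (contract j A) K)) else 0)"
    if leU: "\<forall>k\<le>n. p k \<le> word_path U k"
  proof (cases "j \<in> A \<and> Suc j \<notin> A")
    case True
    then have "add_peak j (contract j A) = A" by (intro add_peak_contract) auto
    then have "rho j -` skew (2*M) (contract j A) K = DU"
      using vimage_rho_skew[OF j, of "contract j A" K] by (simp add: DU_def U_def n_def)
    then have "bij_betw ((`) (\<lambda>t. rho j -` t)) (ctil (skew (2*M) (contract j A) K)) {T \<in> ctil DU. {(j, h)} \<notin> T}"
      using bij_betw_vimage_rho[OF i, of "skew (2*M) (contract j A) K" h] oddU topU topU' topU'' colU by simp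
    then show ?thesis using True bij_betw_same_card by fastforce
  next
    case False
    \<comment> \<open>Without a peak of \<open>A\<close> at \<open>j\<close> no tiling can avoid the
      single tile: such a tiling would force the path of \<open>A\<close> to descend from column
      \<open>j\<close> on both sides.\<close>
    have "{T \<in> ctil DU. {(j, h)} \<notin> T} = {}"
    proof (rule ccontr)
      assume "{T \<in> ctil DU. {(j, h)} \<notin> T} \<noteq> {}"
      then obtain T where T: "T \<in> ctil DU" "{(Suc i, h)} \<notin> T" using i by blast
      have pU: "p j \<le> h + 1" "p i \<le> h" "p (Suc j) \<le> h" using leU jn Uj Ui by fastforce+
      have "p i < p j \<and> p (Suc j) < p j"
      proof (cases "p j < h")
        case False
        then have "p j = h \<or> p j = h + 1" using pU(1) by linarith
        moreover have "p j \<noteq> h" using par[of j] parh i by auto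
        ultimately have "p j = h + 1" by blast
        then show ?thesis using pU by simp
      next
        case True
        \<comment> \<open>The lowest square of column \<open>j\<close>, directly above the path of
          \<open>A\<close>. Its tile descends on both sides, and these neighbouring squares also lie
          above \<open>A\<close>.\<close>
        define m where "m = p j + 1"
        have "(Suc i, m) \<in> DU" using True par[of j] jn by (simp add: memU m_def Uj flip: i)
        from tiles_peak_at[OF T oddU topU topU' topU'' colU this]
        obtain t where "t \<in> T" "(i, m - 1) \<in> t" "(Suc (Suc i), m - 1) \<in> t" by blast
        then have "(i, m - 1) \<in> DU" "(Suc j, m - 1) \<in> DU" using tiling_subset T(1) i by (fastforce simp: ctil_def)+
        then show ?thesis by (simp add: memU m_def)
      qed
      then show False using False by (auto simp: p_def i split: if_splits)
    qed
    with False show ?thesis by (simp only: card.empty if_False)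
  qed
  show ?thesis
  proof (cases "\<forall>k\<le>n. p k \<le> word_path U k")
    case False
    have "M_word (Suc M) A U = 0" "M_word (Suc M) A V = 0"
      using False leV unfolding M_word_def p_def n_def by (simp_all only: if_False simp_thms)
    moreover have "M_word M (contract j A) K = 0" if pk: "j \<in> A \<and> Suc j \<notin> A"
    proof -
      have Ap: "add_peak j (contract j A) = A" using pk by (intro add_peak_contract) auto
      \<comment> \<open>Otherwise inserting a peak at \<open>j\<close> into both words would give
        back the comparison of \<open>A\<close> with \<open>U\<close>, which fails here.\<close>
      have "\<not> (\<forall>k\<le>2*M. word_path (contract j A) k \<le> word_path K k)"
      proof
        assume a: "\<forall>k\<le>2*M. word_path (contract j A) k \<le> word_path K k"
        have "p k \<le> word_path U k" if "k \<le> n" for k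
        proof -
          have "p k = word_path (add_peak j (contract j A)) k" by (simp add: Ap p_def)
          then show ?thesis
            using a[rule_format, of k] a[rule_format, of "j - 1"] a[rule_format, of "k - 2"] that j
            unfolding U h_def by (auto simp: word_path_add_peak[OF j(1)] n_def)
        qed
        then show False using False by blast
      qed
      then show ?thesis unfolding M_word_def by (rule if_not_P)
    qed
    ultimately show ?thesis by (simp add: U_def V_def)
  next
    case leU: True
    have MU: "M_word (Suc M) A U = (- 1) ^ card DU * int (card (ctil DU))"
      using leU by (simp add: M_word_def DU_def n_def p_def del: word_path.simps)
    have MV: "(if ballot (Suc M) V then M_word (Suc M) A V else 0) = (if p j < h then - ((- 1) ^ card DU) * int (card (ctil DV)) else 0)"
    proof (cases "p j < h")
      case True
      then have "ballot (Suc M) V" using ballot_add_valley_iff[OF j, of K] K pos by (simp add: V_def h_def)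
      moreover have "M_word (Suc M) A V = (- 1) ^ card DV * int (card (ctil DV))"
        using leU True leV by (simp add: M_word_def DV_def n_def p_def del: word_path.simps)
      moreover have "card DU = Suc (card DV)" using DUV[OF True] finU by simp
      ultimately show ?thesis using True by simp
    next
      case False
      then have "\<not> (\<forall>k\<le>n. p k \<le> word_path V k)" using leV by blast
      then have "M_word (Suc M) A V = 0" unfolding M_word_def p_def n_def by auto
      then show ?thesis using False by simp
    qed
    \<comment> \<open>The two diagrams differ by one square, so their signs are opposite, and the
      tilings with the single tile cancel against all tilings of the smaller diagram.\<close>
    have "M_word (Suc M) A U + (if ballot (Suc M) V then M_word (Suc M) A V else 0)
       = (- 1) ^ card DU * int (card {T \<in> ctil DU. {(j, h)} \<notin> T})"
      unfolding MU MV split single by (simp add: algebra_simps)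
    also have "\<dots> = (if j \<in> A \<and> Suc j \<notin> A then M_word M (contract j A) K else 0)"
    proof (cases "j \<in> A \<and> Suc j \<notin> A")
      case True
      then have Ap: "add_peak j (contract j A) = A" by (intro add_peak_contract) auto
      define D' where "D' = skew (2*M) (contract j A) K"
      have D': "rho j -` D' = DU"
        using vimage_rho_skew[OF j, of "contract j A" K] Ap by (simp add: DU_def U_def n_def D'_def)
      have "even (card DU) \<longleftrightarrow> even (card D')"
        using card_vimage_rho[OF j(1), of D'] D' finite_skew by (simp add: D'_def)
      then have sgn: "(- 1) ^ card DU = ((- 1) ^ card D' :: int)" by (simp add: minus_one_power_iff)
      have "word_path (contract j A) k \<le> word_path K k" if "k \<le> 2*M" for k
      proof -
        have "p (widen j k) = word_path (contract j A) k"
          using word_path_add_peak[OF j(1), of "contract j A" "widen j k"] Ap by (auto simp: p_def widen_def simp del: word_path.simps)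
        moreover have "word_path U (widen j k) = word_path K k" by (auto simp: U widen_def)
        moreover have "widen j k \<le> n" using that by (auto simp: widen_def n_def)
        ultimately show ?thesis using leU by metis
      qed
      then have "M_word M (contract j A) K = (- 1) ^ card D' * int (card (ctil D'))" by (simp add: M_word_def D'_def)
      then show ?thesis using nonsingle[OF leU] True sgn by (simp add: D'_def)
    qed (use nonsingle[OF leU] in auto)
    finally show ?thesis unfolding U_def V_def .
  qed
qed


section \<open>Conformal blocks\<close>

definition block_poly :: "nat \<Rightarrow> nat set \<Rightarrow> (nat \<Rightarrow> real) \<Rightarrow> real" where
  "block_poly n L x = (\<Prod>b\<in>{1..n}. \<Prod>a\<in>{1..<b}. if a \<in> L \<longleftrightarrow> b \<in> L then x b - x a else 1)"

lemma conformal_block_sq: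
  assumes \<beta>: "\<beta> \<in> link_patterns N" and x: "x \<in> chamber (2*N)"
  shows "conformal_block N \<beta> x * sq (2*N) x = block_poly (2*N) (left_ends \<beta>) x"
  unfolding conformal_block_def sq_def block_poly_def prod.distrib[symmetric]
proof (intro prod.cong refl)
  fix b a assume ab: "b \<in> {1..2*N}" "a \<in> {1..<b}"
  then have a: "a \<in> {1..2*N}" "a < b" by auto
  have pos: "x b - x a > 0" using chamber_less[OF x a(1) ab(1) a(2)] by simp
  have "vartheta \<beta> a b = (if a \<in> left_ends \<beta> \<longleftrightarrow> b \<in> left_ends \<beta> then 1 else -1)"
    using a(1) ab(1) unfolding vartheta_def right_ends_eq[OF \<beta>] by auto
  then show "(x b - x a) powr (1/2 * vartheta \<beta> a b) * (x b - x a) powr (1/2) =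
      (if a \<in> left_ends \<beta> \<longleftrightarrow> b \<in> left_ends \<beta> then x b - x a else 1)"
    using pos by (simp flip: powr_add)
qed

lemma polyfun_block_poly: "polyfun n (block_poly n L)"
proof -
  have "polyfun n (\<lambda>x. if a \<in> L \<longleftrightarrow> b \<in> L then x b - x a else 1)" if "b \<in> {1..n}" "a \<in> {1..<b}" for a b
  proof (cases "a \<in> L \<longleftrightarrow> b \<in> L")
    case True
    have "polyfun n (\<lambda>x. x b - x a)" by (rule polyfun_diff; rule polyfun_coord) (use that in auto)
    then show ?thesis using True by simp
  next
    case False
    then show ?thesis by (simp add: polyfun_const)
  qed
  then have "polyfun n (\<lambda>x. \<Prod>b\<in>{1..n}. \<Prod>a\<in>{1..<b}. if a \<in> L \<longleftrightarrow> b \<in> L then x b - x a else 1)"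
    by (intro polyfun_prod)
  then show ?thesis by (simp add: block_poly_def[abs_def])
qed

lemma deriv_on_block_poly:
  assumes k: "k \<in> {1..n}"
  shows "deriv_on n k (block_poly n L)
    (\<lambda>x. (\<Sum>l\<in>{1..n}-{k}. (if k \<in> L \<longleftrightarrow> l \<in> L then 1 else 0) / (x k - x l)) * block_poly n L x)"
proof -
  define c :: "nat \<Rightarrow> nat \<Rightarrow> real" where "c a b = (if a \<in> L \<longleftrightarrow> b \<in> L then 1 else 0)" for a b
  have "deriv_on n k (\<lambda>x. if a \<in> L \<longleftrightarrow> b \<in> L then x b - x a else 1)
     (\<lambda>x. ((if k = b then c a b else 0) - (if k = a then c a b else 0)) / (x b - x a) * (if a \<in> L \<longleftrightarrow> b \<in> L then x b - x a else 1))"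
    if ab: "a \<in> {1..n}" "b \<in> {1..n}" "a < b" for a b
  proof (cases "a \<in> L \<longleftrightarrow> b \<in> L")
    case True
    have c: "c a b = 1" unfolding c_def by (rule if_P[OF True])
    have "deriv_on n k (\<lambda>x. x i) (\<lambda>x. if k = i then 1 else 0)" for i
      unfolding deriv_on_def by (cases "k = i") simp_all
    from deriv_on_minus[OF this[of b] this[of a]]
    have "deriv_on n k (\<lambda>x. x b - x a) (\<lambda>x. (if k = b then 1 else 0) - (if k = a then 1 else 0))" .
    then have "deriv_on n k (\<lambda>x. x b - x a) (\<lambda>x. ((if k = b then c a b else 0) - (if k = a then c a b else 0)) / (x b - x a) * (x b - x a))"
    proof (rule deriv_on_cong)
      fix y assume "y \<in> chamber n"
      then have nz: "y b - y a \<noteq> 0" using chamber_less[OF _ ab, of y] by simp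
      show "(if k = b then 1 else 0) - (if k = a then 1 else 0) =
          ((if k = b then c a b else 0) - (if k = a then c a b else 0)) / (y b - y a) * (y b - y a)"
        unfolding c times_divide_eq_left nonzero_mult_div_cancel_right[OF nz] by (rule refl)
    qed
    then show ?thesis by (simp only: if_P[OF True])
  next
    case False
    have "c a b = 0" unfolding c_def by (rule if_not_P[OF False])
    then show ?thesis by (simp only: if_not_P[OF False] if_cancel diff_self div_0 mult_zero_left deriv_on_const)
  qed
  then have "deriv_on n k (\<lambda>x. \<Prod>b\<in>{1..n}. \<Prod>a\<in>{1..<b}. if a \<in> L \<longleftrightarrow> b \<in> L then x b - x a else 1)
     (\<lambda>x. (\<Sum>b\<in>{1..n}. \<Sum>a\<in>{1..<b}. ((if k = b then c a b else 0) - (if k = a then c a b else 0)) / (x b - x a)) *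
        (\<Prod>b\<in>{1..n}. \<Prod>a\<in>{1..<b}. if a \<in> L \<longleftrightarrow> b \<in> L then x b - x a else 1))"
    by (intro deriv_on_prod_log) auto
  moreover have pairs: "(\<Sum>b\<in>{1..n}. \<Sum>a\<in>{1..<b}. ((if k = b then c a b else 0) - (if k = a then c a b else 0)) / (x b - x a))
     = (\<Sum>l\<in>{1..n}-{k}. c k l / (x k - x l))" for x
    by (rule sum_pairs_at[OF k]) (auto simp: c_def)
  ultimately have "deriv_on n k (block_poly n L) (\<lambda>x. (\<Sum>l\<in>{1..n}-{k}. c k l / (x k - x l)) * block_poly n L x)"
    unfolding block_poly_def[abs_def, symmetric] block_poly_def[symmetric] by (simp only: pairs)
  then show ?thesis unfolding c_def .
qed

text \<open>The identity behind the harmonicity of a Vandermonde polynomial. Summing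
  \<open>triple_sum_identity\<close> over \<open>k\<close>, the mixed sum becomes minus the sum of
  the squares \<open>(S l)\<^sup>2\<close> by antisymmetry, so three times the left side equals
  three times the right side.\<close>

lemma sum_square_inverse_diff:
  fixes x :: "'i \<Rightarrow> real"
  assumes C: "finite C" "inj_on x C"
  shows "(\<Sum>k\<in>C. (\<Sum>l\<in>C-{k}. 1 / (x k - x l))\<^sup>2) = (\<Sum>k\<in>C. \<Sum>l\<in>C-{k}. (1 / (x k - x l))\<^sup>2)"
proof -
  define r where "r i j = 1 / (x i - x j)" for i j
  define S where "S k = (\<Sum>l\<in>C-{k}. r k l)" for k
  have "(\<Sum>k\<in>C. (S k)\<^sup>2) = (\<Sum>k\<in>C. 3 * (\<Sum>l\<in>C-{k}. (r k l)\<^sup>2) + 2 * (\<Sum>l\<in>C-{k}. r k l * S l))"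
    unfolding S_def by (intro sum.cong refl triple_sum_identity[OF C(1) _ C(2)]) (simp_all add: r_def)
  also have "\<dots> = 3 * (\<Sum>k\<in>C. \<Sum>l\<in>C-{k}. (r k l)\<^sup>2) + 2 * (\<Sum>k\<in>C. \<Sum>l\<in>C-{k}. r k l * S l)"
    by (simp only: sum.distrib sum_distrib_left)
  also have "(\<Sum>k\<in>C. \<Sum>l\<in>C-{k}. r k l * S l) = (\<Sum>l\<in>C. \<Sum>k\<in>C-{l}. r k l * S l)"
    by (rule sum_offdiag_swap[OF C(1)])
  also have "\<dots> = (\<Sum>l\<in>C. - (S l)\<^sup>2)"
  proof (intro sum.cong refl)
    fix l
    have "r k l = - r l k" for k unfolding r_def by (metis minus_diff_eq minus_divide_right)
    then have "(\<Sum>k\<in>C-{l}. r k l * S l) = (\<Sum>k\<in>C-{l}. - (r l k * S l))" by (metis mult_minus_left)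
    then show "(\<Sum>k\<in>C-{l}. r k l * S l) = - (S l)\<^sup>2"
      by (simp add: sum_negf S_def power2_eq_square sum_distrib_right)
  qed
  finally show ?thesis by (simp add: sum_negf S_def r_def)
qed

text \<open>With logarithmic derivatives \<open>S k\<close>, the second derivatives are
  \<open>((S k)\<^sup>2 - R k)\<close> times the block. Only points with the same letter interact,
  so the sum splits into two classes, and \<open>sum_square_inverse_diff\<close> applies to
  each.\<close>

lemma lap_block_poly:
  assumes x: "x \<in> chamber n"
  shows "lap n (block_poly n L) x = 0"
proof -
  define S where "S k x = (\<Sum>l\<in>{1..n}-{k}. (if k \<in> L \<longleftrightarrow> l \<in> L then 1 else 0) / (x k - x l))" for k and x :: "nat \<Rightarrow> real"
  define R where "R k x = (\<Sum>l\<in>{1..n}-{k}. (if k \<in> L \<longleftrightarrow> l \<in> L then 1 else 0) * (1 / (x k - x l))\<^sup>2)" for k and x :: "nat \<Rightarrow> real"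
  have dS: "deriv_on n k (S k) (\<lambda>x. - R k x)" if k: "k \<in> {1..n}" for k
  proof -
    have "deriv_on n k (\<lambda>x. (if k \<in> L \<longleftrightarrow> l \<in> L then 1 else 0) / (x k - x l)) (\<lambda>x. - ((if k \<in> L \<longleftrightarrow> l \<in> L then 1 else 0) * (1 / (x k - x l))\<^sup>2))"
      if l: "l \<in> {1..n}-{k}" for l
      using k l chamber_neq[of _ n k l] unfolding deriv_on_def
      by (auto intro!: derivative_eq_intros simp: power2_eq_square)
    then have "deriv_on n k (\<lambda>x. \<Sum>l\<in>{1..n}-{k}. (if k \<in> L \<longleftrightarrow> l \<in> L then 1 else 0) / (x k - x l))
       (\<lambda>x. \<Sum>l\<in>{1..n}-{k}. - ((if k \<in> L \<longleftrightarrow> l \<in> L then 1 else 0) * (1 / (x k - x l))\<^sup>2))"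
      by (rule deriv_on_sum)
    then show ?thesis by (simp add: S_def[abs_def] R_def sum_negf)
  qed
  have dB: "deriv_on n k (block_poly n L) (\<lambda>x. S k x * block_poly n L x)" if "k \<in> {1..n}" for k
    unfolding S_def by (rule deriv_on_block_poly[OF that])
  have "partial k (partial k (block_poly n L)) x = ((S k x)\<^sup>2 - R k x) * block_poly n L x" if k: "k \<in> {1..n}" for k
  proof -
    have "partial k (partial k (block_poly n L)) x = partial k (\<lambda>x. S k x * block_poly n L x) x"
      by (rule partial_cong[OF _ x k]) (rule deriv_on_partial[OF dB[OF k]])
    also have "\<dots> = - R k x * block_poly n L x + S k x * (S k x * block_poly n L x)"
      by (rule deriv_on_partial[OF deriv_on_mult[OF dS[OF k] dB[OF k]] x])
    finally show ?thesis by (simp add: algebra_simps power2_eq_square)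
  qed
  then have "lap n (block_poly n L) x = (\<Sum>k\<in>{1..n}. (S k x)\<^sup>2 - R k x) * block_poly n L x"
    unfolding lap_def sum_distrib_right by (rule sum.cong[OF refl])
  also have "(\<Sum>k\<in>{1..n}. (S k x)\<^sup>2 - R k x) = 0"
  proof -
    have cl: "(\<Sum>k\<in>C. (S k x)\<^sup>2 - R k x) = 0" if C: "C \<subseteq> {1..n}" "\<And>k l. k \<in> C \<Longrightarrow> l \<in> {1..n} \<Longrightarrow> (k \<in> L \<longleftrightarrow> l \<in> L) \<longleftrightarrow> l \<in> C" for C
    proof -
      have finC: "finite C" using C(1) finite_subset by blast
      have inj: "inj_on x C" using chamber_neq[OF x] C(1) by (intro inj_onI) blast
      have "S k x = (\<Sum>l\<in>C-{k}. 1 / (x k - x l))" "R k x = (\<Sum>l\<in>C-{k}. (1 / (x k - x l))\<^sup>2)" if k: "k \<in> C" for k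
      proof -
        have same: "(k \<in> L) = (l \<in> L)" if "l \<in> C" for l using C(2)[OF k, of l] C(1) that by blast
        have "S k x = (\<Sum>l\<in>C-{k}. (if k \<in> L \<longleftrightarrow> l \<in> L then 1 else 0) / (x k - x l))"
          unfolding S_def by (rule sum.mono_neutral_right) (use C k in auto)
        also have "\<dots> = (\<Sum>l\<in>C-{k}. 1 / (x k - x l))" by (rule sum.cong) (use same in auto)
        finally show "S k x = (\<Sum>l\<in>C-{k}. 1 / (x k - x l))" .
        have "R k x = (\<Sum>l\<in>C-{k}. (if k \<in> L \<longleftrightarrow> l \<in> L then 1 else 0) * (1 / (x k - x l))\<^sup>2)"
          unfolding R_def by (rule sum.mono_neutral_right) (use C k in auto)
        also have "\<dots> = (\<Sum>l\<in>C-{k}. (1 / (x k - x l))\<^sup>2)" by (rule sum.cong) (use same in auto)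
        finally show "R k x = (\<Sum>l\<in>C-{k}. (1 / (x k - x l))\<^sup>2)" .
      qed
      then show ?thesis using sum_square_inverse_diff[OF finC inj] by (simp add: sum_subtractf)
    qed
    have u: "{1..n} = ({1..n} \<inter> L) \<union> ({1..n} - L)" by auto
    have "(\<Sum>k\<in>{1..n}. (S k x)\<^sup>2 - R k x) = (\<Sum>k\<in>{1..n} \<inter> L. (S k x)\<^sup>2 - R k x) + (\<Sum>k\<in>{1..n} - L. (S k x)\<^sup>2 - R k x)"
      by (subst u, rule sum.union_disjoint) auto
    also have "\<dots> = 0" using cl[of "{1..n} \<inter> L"] cl[of "{1..n} - L"] by auto
    finally show ?thesis .
  qed
  finally show ?thesis by simp
qed

lemma word_path_card: "word_path L k = 2 * int (card (L \<inter> {1..k})) - int k"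
proof (induction k)
  case (Suc k)
  have "{1..Suc k} = insert (Suc k) {1..k}" by auto
  then show ?case using Suc by (auto simp: Int_insert_right)
qed simp

text \<open>A ballot word begins with an up-step, so the first variable occurs only in the
  differences with the other \<open>N - 1\<close> left ends.\<close>

lemma degree_block_poly:
  assumes L: "ballot N L" and N: "N \<ge> 1" and p: "\<And>t. block_poly (2*N) L (x(1 := t)) = poly p t"
  shows "degree p \<le> N - 1"
proof -
  define n where "n = 2*N"
  have s1: "{1..n} = insert 1 {2..n}" using N by (auto simp: n_def)
  have L1: "1 \<in> L"
  proof -
    have "0 \<le> word_path L 1"
      using L[unfolded ballot_def, THEN conjunct2, THEN conjunct1, rule_format, of 1] N by simp
    then show ?thesis by (simp split: if_splits)
  qed
  define K where "K = (\<Prod>b\<in>{2..n}. \<Prod>a\<in>{2..<b}. if a \<in> L \<longleftrightarrow> b \<in> L then x b - x a else 1)"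
  have "block_poly n L (x(1 := t)) = (\<Prod>b\<in>{2..n}. if b \<in> L then x b - t else 1) * K" for t
  proof -
    have "block_poly n L (x(1 := t)) = (\<Prod>b\<in>{2..n}. \<Prod>a\<in>{1..<b}. if a \<in> L \<longleftrightarrow> b \<in> L then (x(1 := t)) b - (x(1 := t)) a else 1)"
      unfolding block_poly_def s1 by simp
    also have "\<dots> = (\<Prod>b\<in>{2..n}. (if b \<in> L then x b - t else 1) * (\<Prod>a\<in>{2..<b}. if a \<in> L \<longleftrightarrow> b \<in> L then x b - x a else 1))"
    proof (intro prod.cong refl)
      fix b assume b: "b \<in> {2..n}"
      then have e: "{1..<b} = insert 1 {2..<b}" by auto
      define G where "G a = (if a \<in> L \<longleftrightarrow> b \<in> L then (x(1 := t)) b - (x(1 := t)) a else 1)" for a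
      have "prod G {1..<b} = G 1 * prod G {2..<b}" unfolding e by simp
      moreover have "G 1 = (if b \<in> L then x b - t else 1)" using b L1 by (simp add: G_def)
      moreover have "prod G {2..<b} = (\<Prod>a\<in>{2..<b}. if a \<in> L \<longleftrightarrow> b \<in> L then x b - x a else 1)"
        by (rule prod.cong) (use b in \<open>auto simp: G_def\<close>)
      ultimately show "(\<Prod>a\<in>{1..<b}. if a \<in> L \<longleftrightarrow> b \<in> L then (x(1 := t)) b - (x(1 := t)) a else 1) =
        (if b \<in> L then x b - t else 1) * (\<Prod>a\<in>{2..<b}. if a \<in> L \<longleftrightarrow> b \<in> L then x b - x a else 1)"
        unfolding G_def by (simp only:)
    qed
    finally show ?thesis by (simp add: prod.distrib K_def)
  qed
  moreover have "(\<Prod>b\<in>{2..n}. if b \<in> L then x b - t else 1) = (\<Prod>b\<in>{2..n} \<inter> L. x b - t)" for t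
    by (rule prod.inter_restrict[symmetric]) simp
  ultimately have "poly p t = poly (smult K (\<Prod>b\<in>{2..n} \<inter> L. [:x b, -1:])) t" for t
    using p[of t] by (simp add: n_def poly_prod mult.commute)
  then have "p = smult K (\<Prod>b\<in>{2..n} \<inter> L. [:x b, -1:])" using poly_eq_poly_eq_iff by blast
  then have "degree p \<le> degree (\<Prod>b\<in>{2..n} \<inter> L. [:x b, -1:])" by simp
  also have "\<dots> \<le> (\<Sum>b\<in>{2..n} \<inter> L. degree [:x b, -1:])" using degree_prod_sum_le[of "{2..n} \<inter> L" "\<lambda>b. [:x b, -1:]"] by (simp add: o_def)
  also have "\<dots> = card ({2..n} \<inter> L)" by simp
  also have "\<dots> = N - 1"
  proof -
    have "word_path L n = 0" using L by (simp add: ballot_def n_def)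
    then have "card (L \<inter> {1..n}) = N" unfolding word_path_card n_def by simp
    moreover have "L \<inter> {1..n} = insert 1 ({2..n} \<inter> L)" using L1 s1 by auto
    ultimately show ?thesis by simp
  qed
  finally show ?thesis .
qed

section \<open>Limits and values on the walls\<close>

lemma prod_pairs_split:
  fixes F :: "nat \<Rightarrow> nat \<Rightarrow> real"
  assumes j: "1 \<le> j" "j \<le> Suc (2*M)"
  shows "(\<Prod>b\<in>{1..2 * Suc M}. \<Prod>a\<in>{1..<b}. F a b) = F j (Suc j) *
     (\<Prod>k\<in>{1..2*M}. if k < j then F k j * F k (Suc j) else F j (k + 2) * F (Suc j) (k + 2)) *
     (\<Prod>b\<in>{1..2*M}. \<Prod>a\<in>{1..<b}. F (widen j a) (widen j b))"
proof -
  define P where "P b = (\<Prod>a\<in>{1..<b}. F a b)" for b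
  have "j \<notin> insert (Suc j) (widen j ` {1..2*M})" "Suc j \<notin> widen j ` {1..2*M}"
    using widen_neq[of j] by (metis imageE insertE n_not_Suc_n)+
  then have "(\<Prod>b\<in>{1..2 * Suc M}. P b) = P j * (P (Suc j) * (\<Prod>b\<in>{1..2*M}. P (widen j b)))"
    unfolding widen_image[OF j] by (simp add: prod.reindex[OF inj_on_subset[OF inj_widen]])
  moreover have "P (Suc j) = F j (Suc j) * (\<Prod>a\<in>{1..<j}. F a (Suc j))"
  proof -
    have "{1..<Suc j} = insert j {1..<j}" using j by auto
    then show ?thesis by (simp add: P_def)
  qed
  moreover have "(\<Prod>b\<in>{1..2*M}. P (widen j b)) = (\<Prod>k\<in>{1..2*M}. if k < j then 1 else F j (k + 2) * F (Suc j) (k + 2)) *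
     (\<Prod>b\<in>{1..2*M}. \<Prod>a\<in>{1..<b}. F (widen j a) (widen j b))"
    unfolding prod.distrib[symmetric]
  proof (intro prod.cong refl)
    fix b assume b: "b \<in> {1..2*M}"
    show "P (widen j b) = (if b < j then 1 else F j (b + 2) * F (Suc j) (b + 2)) * (\<Prod>a\<in>{1..<b}. F (widen j a) (widen j b))"
    proof (cases "b < j")
      case True
      then show ?thesis by (simp add: P_def widen_def)
    next
      case False
      have "{1..<b + 2} = insert j (insert (Suc j) (widen j ` {1..<b}))"
      proof (intro set_eqI iffI)
        fix k assume k: "k \<in> {1..<b + 2}"
        show "k \<in> insert j (insert (Suc j) (widen j ` {1..<b}))"
        proof (cases "k = j \<or> k = Suc j")
          case False
          then have "k = widen j (narrow j k)" by (simp add: widen_narrow)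
          moreover have "narrow j k \<in> {1..<b}" using k False \<open>\<not> b < j\<close> j by (auto simp: narrow_def)
          ultimately show ?thesis by blast
        qed auto
      qed (use j False in \<open>auto simp: widen_def\<close>)
      moreover have "j \<notin> insert (Suc j) (widen j ` {1..<b})" "Suc j \<notin> widen j ` {1..<b}"
        using widen_neq[of j] by (metis imageE insertE n_not_Suc_n)+
      moreover have "widen j b = b + 2" using False by (simp add: widen_def)
      ultimately show ?thesis using False by (simp add: P_def prod.reindex[OF inj_on_subset[OF inj_widen]])
    qed
  qed
  moreover have "P j * (\<Prod>a\<in>{1..<j}. F a (Suc j)) = (\<Prod>k\<in>{1..2*M}. if k < j then F k j * F k (Suc j) else 1)"
  proof -
    have "P j * (\<Prod>a\<in>{1..<j}. F a (Suc j)) = (\<Prod>k\<in>{1..<j}. if k < j then F k j * F k (Suc j) else 1)"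
      unfolding P_def prod.distrib[symmetric] by (rule prod.cong) auto
    also have "\<dots> = (\<Prod>k\<in>{1..2*M}. if k < j then F k j * F k (Suc j) else 1)"
      by (rule prod.mono_neutral_left) (use j in auto)
    finally show ?thesis .
  qed
  moreover have "(\<Prod>k\<in>{1..2*M}. if k < j then F k j * F k (Suc j) else F j (k + 2) * F (Suc j) (k + 2)) =
     (\<Prod>k\<in>{1..2*M}. if k < j then F k j * F k (Suc j) else 1) * (\<Prod>k\<in>{1..2*M}. if k < j then 1 else F j (k + 2) * F (Suc j) (k + 2))"
    unfolding prod.distrib[symmetric] by (rule prod.cong) auto
  ultimately show ?thesis unfolding P_def by (simp add: mult_ac)
qed

lemma drop_two_widen: "k \<in> {1..2*M} \<Longrightarrow> drop_two (2 * Suc M) j x k = x (widen j k)"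
  by (auto simp: drop_two_def widen_def)

lemma drop_two_chamber:
  assumes x: "x \<in> chamber (2 * Suc M)"
  shows "drop_two (2 * Suc M) j x \<in> chamber (2*M)"
  unfolding chamber_mem_iff
proof (intro conjI allI impI ballI)
  fix a b assume ab: "a \<in> {1..2*M}" "b \<in> {1..2*M}" "a < b"
  then have "widen j a \<in> {1..2 * Suc M}" "widen j b \<in> {1..2 * Suc M}" "widen j a < widen j b" by (auto simp: widen_def)
  then show "drop_two (2 * Suc M) j x a < drop_two (2 * Suc M) j x b"
    unfolding drop_two_widen[OF ab(1)] drop_two_widen[OF ab(2)] by (rule chamber_less[OF x])
qed (auto simp: drop_two_def)

text \<open>The factor by which both a nonvanishing block polynomial and the rescaled
  \<open>\<surd>V\<close> exceed their counterparts with two points less. Being common to all terms,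
  it is harmless in the comparison.\<close>

definition wall_factor :: "nat \<Rightarrow> nat \<Rightarrow> (nat \<Rightarrow> real) \<Rightarrow> real" where
  "wall_factor M j x = (\<Prod>k\<in>{1..2*M}. \<bar>x (widen j k) - x (Suc j)\<bar>)"

text \<open>Equal letters at \<open>j\<close> and \<open>Suc j\<close> give the vanishing factor
  \<open>x (Suc j) - x j\<close>. For different letters each other point shares its letter with
  exactly one of the two merged points, so its distance to them occurs exactly once.\<close>

lemma block_poly_wall:
  assumes x: "x \<in> chamber (2 * Suc M)" and j: "1 \<le> j" "j \<le> Suc (2*M)"
  shows "block_poly (2 * Suc M) L (x(j := x (Suc j))) =
    (if j \<in> L \<longleftrightarrow> Suc j \<in> L then 0 else wall_factor M j x * block_poly (2*M) (contract j L) (drop_two (2 * Suc M) j x))"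
proof -
  define y where "y = x(j := x (Suc j))"
  define F where "F a b = (if a \<in> L \<longleftrightarrow> b \<in> L then y b - y a else 1)" for a b
  have bp: "block_poly (2 * Suc M) L y = F j (Suc j) *
     (\<Prod>k\<in>{1..2*M}. if k < j then F k j * F k (Suc j) else F j (k + 2) * F (Suc j) (k + 2)) *
     (\<Prod>b\<in>{1..2*M}. \<Prod>a\<in>{1..<b}. F (widen j a) (widen j b))"
    unfolding block_poly_def F_def[symmetric] by (rule prod_pairs_split[OF j])
  show ?thesis
  proof (cases "j \<in> L \<longleftrightarrow> Suc j \<in> L")
    case True
    then have "F j (Suc j) = 0" by (simp add: F_def y_def)
    then show ?thesis using True bp by (simp add: y_def)
  next
    case False
    have "F j (Suc j) = 1" using False by (simp add: F_def)
    moreover have "(if k < j then F k j * F k (Suc j) else F j (k + 2) * F (Suc j) (k + 2)) = \<bar>x (widen j k) - x (Suc j)\<bar>"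
      if k: "k \<in> {1..2*M}" for k
    proof (cases "k < j")
      case True
      then have "x k < x (Suc j)" using k j by (intro chamber_less[OF x]) auto
      then show ?thesis using True False by (auto simp: F_def y_def widen_def)
    next
      case kj: False
      then have "x (Suc j) < x (k + 2)" using k j by (intro chamber_less[OF x]) auto
      then show ?thesis using kj False by (auto simp: F_def y_def widen_def)
    qed
    then have "(\<Prod>k\<in>{1..2*M}. if k < j then F k j * F k (Suc j) else F j (k + 2) * F (Suc j) (k + 2)) = wall_factor M j x"
      unfolding wall_factor_def by (rule prod.cong[OF refl])
    moreover have "(\<Prod>b\<in>{1..2*M}. \<Prod>a\<in>{1..<b}. F (widen j a) (widen j b)) = block_poly (2*M) (contract j L) (drop_two (2 * Suc M) j x)"
      unfolding block_poly_def
    proof (intro prod.cong refl)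
      fix b a assume ab: "b \<in> {1..2*M}" "a \<in> {1..<b}"
      then have a: "a \<in> {1..2*M}" by auto
      show "F (widen j a) (widen j b) = (if (a \<in> contract j L) = (b \<in> contract j L) then drop_two (2 * Suc M) j x b - drop_two (2 * Suc M) j x a else 1)"
        unfolding drop_two_widen[OF a] drop_two_widen[OF ab(1)] by (simp add: F_def contract_def y_def)
    qed
    ultimately show ?thesis using bp False by (simp add: y_def)
  qed
qed

text \<open>The pair of merging points supplies \<open>t powr (1/2)\<close>. For each other point
  the two square roots of distances to the merging points combine to one distance in the
  limit.\<close>

lemma sq_near_wall:
  assumes x: "x \<in> chamber (2 * Suc M)" and j: "1 \<le> j" "j \<le> Suc (2*M)"
  shows "((\<lambda>t. sq (2 * Suc M) (x(j := x (Suc j) - t)) / t powr (1/2)) \<longlongrightarrow>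
     wall_factor M j x * sq (2*M) (drop_two (2 * Suc M) j x)) (at_right 0)"
proof -
  define y where "y t = x(j := x (Suc j) - t)" for t
  define F where "F t a b = (y t b - y t a) powr (1/2)" for t a b
  define E where "E t k = (if k < j then F t k j * F t k (Suc j) else F t j (k + 2) * F t (Suc j) (k + 2))" for t k
  define R where "R = (\<Prod>b\<in>{1..2*M}. \<Prod>a\<in>{1..<b}. F 0 (widen j a) (widen j b))"
  have sq: "sq (2 * Suc M) (y t) = t powr (1/2) * (\<Prod>k\<in>{1..2*M}. E t k) * R" for t
  proof -
    have "sq (2 * Suc M) (y t) = F t j (Suc j) * (\<Prod>k\<in>{1..2*M}. E t k) * (\<Prod>b\<in>{1..2*M}. \<Prod>a\<in>{1..<b}. F t (widen j a) (widen j b))"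
      unfolding sq_def F_def[symmetric] E_def by (rule prod_pairs_split[OF j])
    moreover have "F t j (Suc j) = t powr (1/2)" by (simp add: F_def y_def)
    moreover have "F t (widen j a) (widen j b) = F 0 (widen j a) (widen j b)" for a b by (simp add: F_def y_def)
    ultimately show ?thesis by (simp add: R_def)
  qed
  have R: "R = sq (2*M) (drop_two (2 * Suc M) j x)"
    unfolding R_def sq_def
  proof (intro prod.cong refl)
    fix b a assume ab: "b \<in> {1..2*M}" "a \<in> {1..<b}"
    then have a: "a \<in> {1..2*M}" by auto
    show "F 0 (widen j a) (widen j b) = (drop_two (2 * Suc M) j x b - drop_two (2 * Suc M) j x a) powr (1/2)"
      unfolding drop_two_widen[OF a] drop_two_widen[OF ab(1)] by (simp add: F_def y_def)
  qed
  have "((\<lambda>t. E t k) \<longlongrightarrow> \<bar>x (widen j k) - x (Suc j)\<bar>) (at_right 0)" if k: "k \<in> {1..2*M}" for k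
  proof (cases "k < j")
    case True
    then have lt: "x k < x (Suc j)" using k j by (intro chamber_less[OF x]) auto
    have "((\<lambda>t. (x (Suc j) - t - x k) powr (1/2) * (x (Suc j) - x k) powr (1/2)) \<longlongrightarrow> (x (Suc j) - 0 - x k) powr (1/2) * (x (Suc j) - x k) powr (1/2)) (at_right 0)"
      using lt by (intro tendsto_intros) auto
    moreover have "(x (Suc j) - 0 - x k) powr (1/2) * (x (Suc j) - x k) powr (1/2) = \<bar>x (widen j k) - x (Suc j)\<bar>"
      using lt True by (simp add: widen_def flip: powr_add)
    ultimately show ?thesis using True by (simp add: E_def F_def y_def)
  next
    case False
    then have lt: "x (Suc j) < x (k + 2)" using k j by (intro chamber_less[OF x]) auto
    have "((\<lambda>t. (x (k + 2) - (x (Suc j) - t)) powr (1/2) * (x (k + 2) - x (Suc j)) powr (1/2)) \<longlongrightarrow> (x (k + 2) - (x (Suc j) - 0)) powr (1/2) * (x (k + 2) - x (Suc j)) powr (1/2)) (at_right 0)"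
      using lt by (intro tendsto_intros) auto
    moreover have "(x (k + 2) - (x (Suc j) - 0)) powr (1/2) * (x (k + 2) - x (Suc j)) powr (1/2) = \<bar>x (widen j k) - x (Suc j)\<bar>"
      using lt False by (simp add: widen_def flip: powr_add)
    ultimately show ?thesis using False by (simp add: E_def F_def y_def)
  qed
  then have "((\<lambda>t. (\<Prod>k\<in>{1..2*M}. E t k) * R) \<longlongrightarrow> wall_factor M j x * R) (at_right 0)"
    unfolding wall_factor_def by (intro tendsto_mult tendsto_prod tendsto_const)
  moreover have "\<forall>\<^sub>F t in at_right 0. (\<Prod>k\<in>{1..2*M}. E t k) * R = sq (2 * Suc M) (y t) / t powr (1/2)"
    unfolding eventually_at_right_field by (rule exI[of _ 1]) (simp add: sq del: mult_Suc_right)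
  ultimately have "((\<lambda>t. sq (2 * Suc M) (y t) / t powr (1/2)) \<longlongrightarrow> wall_factor M j x * R) (at_right 0)"
    by (rule Lim_transform_eventually)
  then show ?thesis unfolding y_def R .
qed

text \<open>The square-root singularity of \<open>f\<close> prescribed by \<open>ASY_at\<close> is
  compensated by the zero of \<open>sq\<close>, so the value of the polynomial on the wall is the
  limit of the product.\<close>

lemma polyfun_at_wall:
  assumes x: "x \<in> chamber (2 * Suc M)" and j: "1 \<le> j" "j \<le> Suc (2*M)"
    and P: "polyfun (2 * Suc M) P" "\<And>y. y \<in> chamber (2 * Suc M) \<Longrightarrow> P y = f y * sq (2 * Suc M) y"
    and asy: "ASY_at (2 * Suc M) j f g"
  shows "P (x(j := x (Suc j))) = wall_factor M j x * (g (drop_two (2 * Suc M) j x) * sq (2*M) (drop_two (2 * Suc M) j x))"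
proof -
  define n where "n = 2 * Suc M"
  define y where "y t = x(j := x (Suc j) - t)" for t
  have jn: "j \<in> {1..n}" "Suc j \<in> {1..n}" using j by (auto simp: n_def)
  have xj: "x j < x (Suc j)" using chamber_less[OF x] jn by (simp add: n_def)
  obtain p where p: "\<And>s. P (x(j := s)) = poly p s" using polyfun_update_poly[OF P(1)] by blast
  have "((\<lambda>t. poly p (x (Suc j) - t)) \<longlongrightarrow> poly p (x (Suc j) - 0)) (at_right 0)"
    by (intro tendsto_intros)
  then have lim1: "((\<lambda>t. P (y t)) \<longlongrightarrow> P (x(j := x (Suc j)))) (at_right 0)" by (simp add: p y_def)
  have "((\<lambda>(u, v). (v - u) powr (1/2) * f (x(j := u, j + 1 := v))) \<longlongrightarrow> g (drop_two n j x))
       (at (x (Suc j), x (Suc j)) within {(u, v). u < v})"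
  proof -
    have "1 < j \<longrightarrow> x (j - 1) < x (Suc j)" using j chamber_less[OF x, of "j - 1" "Suc j"] jn by (auto simp: n_def)
    moreover have "j + 1 < n \<longrightarrow> x (Suc j) < x (j + 2)" using chamber_less[OF x, of "Suc j" "j + 2"] jn by (auto simp: n_def)
    ultimately show ?thesis using asy x unfolding ASY_at_def n_def by blast
  qed
  \<comment> \<open>The joint limit is specialised to the path on which \<open>v\<close> rests at
    \<open>x (Suc j)\<close> and \<open>u\<close> approaches it from below.\<close>
  moreover have "filterlim (\<lambda>t. (x (Suc j) - t, x (Suc j))) (at (x (Suc j), x (Suc j)) within {(u, v). u < v}) (at_right 0)"
    unfolding filterlim_at
  proof
    show "\<forall>\<^sub>F t in at_right 0. (x (Suc j) - t, x (Suc j)) \<in> {(u, v). u < v} \<and> (x (Suc j) - t, x (Suc j)) \<noteq> (x (Suc j), x (Suc j))"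
      unfolding eventually_at_right_field by (rule exI[of _ 1]) simp
    have "((\<lambda>t. (x (Suc j) - t, x (Suc j))) \<longlongrightarrow> (x (Suc j) - 0, x (Suc j))) (at_right 0)" by (intro tendsto_intros)
    then show "((\<lambda>t. (x (Suc j) - t, x (Suc j))) \<longlongrightarrow> (x (Suc j), x (Suc j))) (at_right 0)" by simp
  qed
  ultimately have "((\<lambda>t. (\<lambda>(u, v). (v - u) powr (1/2) * f (x(j := u, j + 1 := v))) (x (Suc j) - t, x (Suc j))) \<longlongrightarrow> g (drop_two n j x)) (at_right 0)"
    by (rule filterlim_compose)
  moreover have "x(j := x (Suc j) - t, Suc j := x (Suc j)) = y t" for t by (auto simp: y_def)
  ultimately have "((\<lambda>t. t powr (1/2) * f (y t)) \<longlongrightarrow> g (drop_two n j x)) (at_right 0)" by simp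
  from tendsto_mult[OF this sq_near_wall[OF x j]]
  have "((\<lambda>t. (t powr (1/2) * f (y t)) * (sq n (y t) / t powr (1/2))) \<longlongrightarrow> g (drop_two n j x) * (wall_factor M j x * sq (2*M) (drop_two n j x))) (at_right 0)"
    by (simp add: y_def n_def)
  moreover have "\<forall>\<^sub>F t in at_right 0. (t powr (1/2) * f (y t)) * (sq n (y t) / t powr (1/2)) = P (y t)"
    unfolding eventually_at_right_field
  proof (intro exI[of _ "x (Suc j) - x j"] conjI allI impI)
    fix t assume t: "0 < t" "t < x (Suc j) - x j"
    have "y t \<in> chamber n"
      unfolding chamber_mem_iff
    proof (intro conjI allI impI ballI)
      fix i assume "i \<notin> {1..n}"
      then show "y t i = undefined" using x jn by (auto simp: y_def chamber_mem_iff n_def)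
    next
      fix a b assume ab: "a \<in> {1..n}" "b \<in> {1..n}" "a < b"
      have lt: "x c < x d" if "c \<in> {1..n}" "d \<in> {1..n}" "c < d" for c d using chamber_less[OF x] that by (simp add: n_def)
      have "x (Suc j) \<le> x b" if "a = j"
        using lt[of "Suc j" b] ab that jn by (cases "b = Suc j") auto
      moreover have "x a < x j" if "b = j" using lt[of a j] ab that by simp
      ultimately show "y t a < y t b" using lt[OF ab] ab(3) t by (auto simp: y_def)
    qed
    then show "(t powr (1/2) * f (y t)) * (sq n (y t) / t powr (1/2)) = P (y t)"
      using P(2)[of "y t"] t by (simp add: n_def)
  qed (use xj in simp)
  ultimately have "((\<lambda>t. P (y t)) \<longlongrightarrow> g (drop_two n j x) * (wall_factor M j x * sq (2*M) (drop_two n j x))) (at_right 0)"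
    by (rule Lim_transform_eventually)
  with lim1 have "P (x(j := x (Suc j))) = g (drop_two n j x) * (wall_factor M j x * sq (2*M) (drop_two n j x))"
    using tendsto_unique[OF trivial_limit_at_right_real] by blast
  then show ?thesis by (simp add: n_def)
qed

lemma finite_ballot: "finite {L. ballot N L}"
  by (rule finite_subset[of _ "Pow {1..2*N}"]) (auto simp: ballot_def)

lemma finite_link_patterns: "finite (link_patterns N)"
  using bij_betw_finite[OF bij_betw_left_ends] finite_ballot by blast

lemma sum_link_patterns: "(\<Sum>\<beta>\<in>link_patterns N. h (left_ends \<beta>)) = (\<Sum>L | ballot N L. h L)"
  by (rule sum.reindex_bij_betw[OF bij_betw_left_ends])

text \<open>Words with different letters at \<open>j\<close> and \<open>Suc j\<close> are grouped by
  their contraction \<open>K\<close>: the word with a peak is always ballot, the one with a valley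
  only sometimes.\<close>

lemma sum_ballot_contract:
  fixes m h :: "nat set \<Rightarrow> real"
  assumes j: "1 \<le> j" "j \<le> Suc (2*M)"
  shows "(\<Sum>L | ballot (Suc M) L. if j \<in> L \<longleftrightarrow> Suc j \<in> L then 0 else m L * h (contract j L)) =
    (\<Sum>K | ballot M K. (m (add_peak j K) + (if ballot (Suc M) (add_valley j K) then m (add_valley j K) else 0)) * h K)"
proof -
  define B where "B = {L. ballot (Suc M) L}"
  define f where "f L = m L * h (contract j L)" for L
  have finB: "finite B" unfolding B_def by (rule finite_ballot)
  have peaks: "(\<Sum>L | L \<in> B \<and> j \<in> L \<and> Suc j \<notin> L. f L) = (\<Sum>K | ballot M K. f (add_peak j K))"
  proof (rule sum.reindex_bij_witness[where i = "add_peak j" and j = "contract j"])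
    fix L assume L: "L \<in> {L. L \<in> B \<and> j \<in> L \<and> Suc j \<notin> L}"
    then show "add_peak j (contract j L) = L" by (simp add: add_peak_contract)
    then show "contract j L \<in> {K. ballot M K}" "f (add_peak j (contract j L)) = f L"
      using L ballot_add_peak_iff[OF j, of "contract j L"] by (auto simp: B_def)
  next
    fix K assume "K \<in> {K. ballot M K}"
    moreover have "j \<in> add_peak j K" "Suc j \<notin> add_peak j K" by (auto simp: add_peak_def widen_image_iff)
    ultimately show "add_peak j K \<in> {L. L \<in> B \<and> j \<in> L \<and> Suc j \<notin> L}"
      using ballot_add_peak_iff[OF j] by (simp add: B_def)
  qed simp
  have valleys: "(\<Sum>L | L \<in> B \<and> j \<notin> L \<and> Suc j \<in> L. f L) = (\<Sum>K | ballot M K \<and> ballot (Suc M) (add_valley j K). f (add_valley j K))"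
  proof (rule sum.reindex_bij_witness[where i = "add_valley j" and j = "contract j"])
    fix L assume L: "L \<in> {L. L \<in> B \<and> j \<notin> L \<and> Suc j \<in> L}"
    then show v: "add_valley j (contract j L) = L" by (simp add: add_valley_contract)
    then show "contract j L \<in> {K. ballot M K \<and> ballot (Suc M) (add_valley j K)}" "f (add_valley j (contract j L)) = f L"
      using L ballot_add_valley_iff[OF j, of "contract j L"] by (auto simp: B_def)
  next
    fix K assume "K \<in> {K. ballot M K \<and> ballot (Suc M) (add_valley j K)}"
    moreover have "j \<notin> add_valley j K" "Suc j \<in> add_valley j K" by (auto simp: add_valley_def widen_image_iff)
    ultimately show "add_valley j K \<in> {L. L \<in> B \<and> j \<notin> L \<and> Suc j \<in> L}" by (simp add: B_def)
  qed simp
  have "(\<Sum>L\<in>B. if j \<in> L \<longleftrightarrow> Suc j \<in> L then 0 else f L) = (\<Sum>L\<in>B. (if j \<in> L \<and> Suc j \<notin> L then f L else 0) + (if j \<notin> L \<and> Suc j \<in> L then f L else 0))"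
    by (rule sum.cong) auto
  also have "\<dots> = (\<Sum>L | L \<in> B \<and> j \<in> L \<and> Suc j \<notin> L. f L) + (\<Sum>L | L \<in> B \<and> j \<notin> L \<and> Suc j \<in> L. f L)"
    unfolding sum.distrib by (simp only: sum.inter_filter[OF finB])
  also have "\<dots> = (\<Sum>K | ballot M K. f (add_peak j K)) + (\<Sum>K | ballot M K. if ballot (Suc M) (add_valley j K) then f (add_valley j K) else 0)"
    unfolding peaks valleys using sum.inter_filter[OF finite_ballot[of M], of "\<lambda>K. f (add_valley j K)" "\<lambda>K. ballot (Suc M) (add_valley j K)"] by simp
  also have "\<dots> = (\<Sum>K | ballot M K. (m (add_peak j K) + (if ballot (Suc M) (add_valley j K) then m (add_valley j K) else 0)) * h K)"
    unfolding sum.distrib[symmetric] by (rule sum.cong) (auto simp: f_def distrib_right)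
  finally show ?thesis unfolding B_def f_def .
qed

section \<open>The expansion of the pure partition functions into blocks\<close>

theorem theorem1p5:
  fixes Z :: "nat set set \<Rightarrow> (nat \<Rightarrow> real) \<Rightarrow> real"
    and N :: nat and \<alpha> :: "nat set set" and x :: "nat \<Rightarrow> real"
  assumes "pure_partition_functions Z"
    and "N \<ge> 1"
    and "\<alpha> \<in> link_patterns N"
    and "x \<in> chamber (2*N)"
  shows "Z \<alpha> x = (\<Sum>\<beta>\<in>link_patterns N. real_of_int (M_inv N \<alpha> \<beta>) * conformal_block N \<beta> x)"
  using assms(3,4)
proof (induction N arbitrary: \<alpha> x)
  \<comment> \<open>Removing links at walls ends with the empty pattern, so the induction starts
    here: the empty diagram has exactly one tiling, and the block is an empty product.\<close>
  case 0
  have LP0: "link_patterns 0 = {{}}" by (auto simp: link_patterns_def partition_on_empty)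
  have "M_inv 0 {} {} = 1"
  proof -
    have "path_le 0 {} {}" by (simp add: path_le_def)
    moreover have D: "skew_diagram 0 {} {} = {}" by (auto simp: skew_diagram_def)
    moreover have "{T. dyck_tiling {} T \<and> cover_inclusive T} = {{}}"
      by (auto simp: dyck_tiling_def partition_on_empty cover_inclusive_def)
    ultimately show ?thesis by (simp add: M_inv_def num_cover_inclusive_tilings_def)
  qed
  then show ?case using 0 assms(1) by (simp add: LP0 conformal_block_def pure_partition_functions_def)
next
  case (Suc M)
  define n where "n = 2 * Suc M"
  have n2: "n \<ge> 2" by (simp add: n_def)
  define A where "A = left_ends \<alpha>"
  have A: "ballot (Suc M) A" unfolding A_def by (rule ballot_left_ends[OF Suc.prems(1)])
  have Z: "smooth_on_chamber n (Z \<alpha>)" "PDE n (Z \<alpha>)" "COV n (Z \<alpha>)"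
    "\<And>j. j \<in> {1..<n} \<Longrightarrow> ASY_at n j (Z \<alpha>) (if {j, j + 1} \<in> \<alpha> then Z (remove_link j \<alpha>) else (\<lambda>_. 0))"
    using assms(1) Suc.prems(1) unfolding pure_partition_functions_def n_def by blast+
  interpret null_system n "\<lambda>x. Z \<alpha> x * sq n x"
    "\<lambda>k x. sq n x * (partial k (Z \<alpha>) x - 1/2 * (\<Sum>l\<in>{1..n}-{k}. 1 / (x k - x l)) * Z \<alpha> x)"
    by (rule null_system_sq[OF Z(1-3)])
  obtain P where P: "polyfun n P" "\<And>y. y \<in> chamber n \<Longrightarrow> P y = Z \<alpha> y * sq n y"
    using polyfun_if_funpow_partial_zero[OF _ smooth_H funpow_partial_eq_0] n2 by (metis gr0I not_numeral_le_zero)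
  \<comment> \<open>The claimed right-hand side times \<open>\<surd>V\<close>; the aim is
    \<open>P = R\<close> as polynomials.\<close>
  define R where "R x = (\<Sum>\<beta>\<in>link_patterns (Suc M). real_of_int (M_inv (Suc M) \<alpha> \<beta>) * block_poly n (left_ends \<beta>) x)" for x
  have pR: "polyfun n R" unfolding R_def by (intro polyfun_sum polyfun_cmult polyfun_block_poly)
  have "P y - R y = 0" for y
  proof (rule harmonic_polyfun_eq_0[OF polyfun_diff[OF P(1) pR] n2])
    fix x assume x: "x \<in> chamber n"
    have "lap n P x = (\<Sum>i\<in>{1..n}. partial i (partial i (\<lambda>x. Z \<alpha> x * sq n x)) x)"
      unfolding lap_def
    proof (intro sum.cong refl)
      fix i assume i: "i \<in> {1..n}"
      show "partial i (partial i P) x = partial i (partial i (\<lambda>x. Z \<alpha> x * sq n x)) x"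
        by (intro partial_cong[OF _ x i] partial_cong[OF _ _ i] P(2))
    qed
    then have lP: "lap n P x = 0" using harmonic[OF x n2] by simp
    have "lap n R x = (\<Sum>\<beta>\<in>link_patterns (Suc M). lap n (\<lambda>x. real_of_int (M_inv (Suc M) \<alpha> \<beta>) * block_poly n (left_ends \<beta>) x) x)"
      unfolding R_def[abs_def] by (rule lap_sum[OF finite_link_patterns]) (intro polyfun_cmult polyfun_block_poly)
    also have "\<dots> = 0" by (simp add: lap_cmult[OF polyfun_block_poly] lap_block_poly[OF x])
    finally have lR: "lap n R x = 0" .
    have "lap n (\<lambda>x. P x + (-1) * R x) x = lap n P x + (-1) * lap n R x"
      by (simp only: lap_add[OF P(1) polyfun_cmult[OF pR]] lap_cmult[OF pR])
    then show "lap n (\<lambda>x. P x - R x) x = 0" using lP lR by simp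
  next
    fix x j assume x: "x \<in> chamber n" and j: "1 \<le> j" "Suc j \<le> n"
    have j': "1 \<le> j" "j \<le> Suc (2*M)" using j by (auto simp: n_def)
    define d where "d = drop_two n j x"
    define G where "G = wall_factor M j x"
    have xM: "x \<in> chamber (2 * Suc M)" using x by (simp add: n_def)
    have dc: "d \<in> chamber (2*M)" unfolding d_def n_def by (rule drop_two_chamber[OF xM])
    have pk: "{j, j + 1} \<in> \<alpha> \<longleftrightarrow> j \<in> A \<and> Suc j \<notin> A"
      using adjacent_link_iff[OF Suc.prems(1), of j] j by (simp add: A_def n_def)
    have "P (x(j := x (Suc j))) = G * ((if {j, j + 1} \<in> \<alpha> then Z (remove_link j \<alpha>) else (\<lambda>_. 0)) d * sq (2*M) d)"
      unfolding G_def d_def n_def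
      by (rule polyfun_at_wall[OF xM j' P(1)[unfolded n_def] _ Z(4)[unfolded n_def]]) (use P(2) j in \<open>auto simp: n_def\<close>)
    \<comment> \<open>The induction hypothesis for the pattern without the link, rewritten as a sum
      over ballot words.\<close>
    also have "(if {j, j + 1} \<in> \<alpha> then Z (remove_link j \<alpha>) else (\<lambda>_. 0)) d * sq (2*M) d =
       (\<Sum>K | ballot M K. real_of_int (if j \<in> A \<and> Suc j \<notin> A then M_word M (contract j A) K else 0) * block_poly (2*M) K d)"
    proof (cases "j \<in> A \<and> Suc j \<notin> A")
      case True
      then have l: "{j, Suc j} \<in> \<alpha>" using pk by simp
      note rl = remove_link_pattern(1)[OF Suc.prems(1) l]
      have cA: "left_ends (remove_link j \<alpha>) = contract j A"
        unfolding A_def left_ends_remove_link[OF Suc.prems(1) l] by simp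
      have "Z (remove_link j \<alpha>) d * sq (2*M) d =
         (\<Sum>\<beta>\<in>link_patterns M. real_of_int (M_inv M (remove_link j \<alpha>) \<beta>) * (conformal_block M \<beta> d * sq (2*M) d))"
        unfolding Suc.IH[OF rl dc] by (simp add: sum_distrib_right mult.assoc)
      also have "\<dots> = (\<Sum>\<beta>\<in>link_patterns M. real_of_int (M_word M (contract j A) (left_ends \<beta>)) * block_poly (2*M) (left_ends \<beta>) d)"
        by (rule sum.cong) (simp_all add: conformal_block_sq[OF _ dc] M_inv_eq[OF rl] cA)
      also have "\<dots> = (\<Sum>K | ballot M K. real_of_int (M_word M (contract j A) K) * block_poly (2*M) K d)"
        by (rule sum_link_patterns)
      finally show ?thesis using True l by simp
    next
      case False
      then show ?thesis using pk by auto
    qed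
    \<comment> \<open>The recursion is read from right to left: the coefficient for \<open>K\<close>
      is split into those of the peak word and the valley word, which are exactly the words whose
      block survives on the wall and contracts to \<open>K\<close>.\<close>
    also have "\<dots> = (\<Sum>K | ballot M K. (real_of_int (M_word (Suc M) A (add_peak j K)) +
        (if ballot (Suc M) (add_valley j K) then real_of_int (M_word (Suc M) A (add_valley j K)) else 0)) * block_poly (2*M) K d)"
    proof (rule sum.cong[OF refl])
      have of_int_add_if: "real_of_int a + (if q then real_of_int b else 0) = real_of_int c"
        if "a + (if q then b else 0) = c" for a b c :: int and q
        using that by auto
      fix K assume "K \<in> {K. ballot M K}"
      then have "M_word (Suc M) A (add_peak j K) + (if ballot (Suc M) (add_valley j K) then M_word (Suc M) A (add_valley j K) else 0)
         = (if j \<in> A \<and> Suc j \<notin> A then M_word M (contract j A) K else 0)"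
        using M_word_recursion[OF A _ j'] by simp
      then have "real_of_int (M_word (Suc M) A (add_peak j K)) +
          (if ballot (Suc M) (add_valley j K) then real_of_int (M_word (Suc M) A (add_valley j K)) else 0)
        = real_of_int (if j \<in> A \<and> Suc j \<notin> A then M_word M (contract j A) K else 0)"
        by (rule of_int_add_if)
      then show "real_of_int (if j \<in> A \<and> Suc j \<notin> A then M_word M (contract j A) K else 0) * block_poly (2*M) K d =
         (real_of_int (M_word (Suc M) A (add_peak j K)) +
          (if ballot (Suc M) (add_valley j K) then real_of_int (M_word (Suc M) A (add_valley j K)) else 0)) * block_poly (2*M) K d"
        by (simp only:)
    qed
    also have "\<dots> = (\<Sum>L | ballot (Suc M) L. if j \<in> L \<longleftrightarrow> Suc j \<in> L then 0 else real_of_int (M_word (Suc M) A L) * block_poly (2*M) (contract j L) d)"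
      by (rule sum_ballot_contract[OF j', symmetric])
    also have "G * \<dots> = (\<Sum>L | ballot (Suc M) L. real_of_int (M_word (Suc M) A L) * block_poly n L (x(j := x (Suc j))))"
      unfolding sum_distrib_left n_def
    proof (rule sum.cong[OF refl])
      fix L
      show "G * (if j \<in> L \<longleftrightarrow> Suc j \<in> L then 0 else real_of_int (M_word (Suc M) A L) * block_poly (2*M) (contract j L) d)
        = real_of_int (M_word (Suc M) A L) * block_poly (2 * Suc M) L (x(j := x (Suc j)))"
        unfolding block_poly_wall[OF xM j'] by (simp add: G_def d_def n_def)
    qed
    also have "\<dots> = (\<Sum>\<beta>\<in>link_patterns (Suc M). real_of_int (M_word (Suc M) A (left_ends \<beta>)) * block_poly n (left_ends \<beta>) (x(j := x (Suc j))))"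
      by (rule sum_link_patterns[symmetric])
    also have "\<dots> = R (x(j := x (Suc j)))"
      unfolding R_def by (rule sum.cong) (simp_all add: M_inv_eq[OF Suc.prems(1)] A_def)
    finally show "P (x(j := x (Suc j))) - R (x(j := x (Suc j))) = 0" by (rule iffD2[OF right_minus_eq])
  next
    fix x p assume x: "x \<in> chamber n" and p: "\<And>t. P (x(1 := t)) - R (x(1 := t)) = poly p t"
    obtain p1 where p1: "\<And>t. P (x(1 := t)) = poly p1 t" using polyfun_update_poly[OF P(1)] by blast
    have "\<exists>q. \<forall>t. block_poly n L (x(1 := t)) = poly q t" for L by (rule polyfun_update_poly[OF polyfun_block_poly])
    then obtain q where q: "\<And>L t. block_poly n L (x(1 := t)) = poly (q L) t" by metis
    define p2 where "p2 = (\<Sum>\<beta>\<in>link_patterns (Suc M). smult (real_of_int (M_inv (Suc M) \<alpha> \<beta>)) (q (left_ends \<beta>)))"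
    have "R (x(1 := t)) = poly p2 t" for t unfolding R_def p2_def q by (simp add: poly_sum)
    then have "poly p t = poly (p1 - p2) t" for t using p[of t] p1 by simp
    then have pe: "p = p1 - p2" using poly_eq_poly_eq_iff by blast
    have "degree p1 \<le> Suc M - 1"
    proof (rule COV_degree_bound[OF _ Z(1)[unfolded n_def] Z(3)[unfolded n_def] x[unfolded n_def]])
      show "poly p1 t = Z \<alpha> (x(1 := t)) * sq (2 * Suc M) (x(1 := t))" if "x(1 := t) \<in> chamber (2 * Suc M)" for t
      proof -
        have "P (x(1 := t)) = Z \<alpha> (x(1 := t)) * sq n (x(1 := t))"
          by (rule P(2)) (use that in \<open>simp only: n_def\<close>)
        then show ?thesis unfolding p1 n_def .
      qed
    qed simp
    moreover have "degree p2 \<le> Suc M - 1"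
      unfolding p2_def
    proof (rule degree_sum_le[OF finite_link_patterns])
      fix \<beta> assume \<beta>: "\<beta> \<in> link_patterns (Suc M)"
      have "degree (q (left_ends \<beta>)) \<le> Suc M - 1"
        by (rule degree_block_poly[OF ballot_left_ends[OF \<beta>], of x]) (use q in \<open>auto simp: n_def\<close>)
      then show "degree (smult (real_of_int (M_inv (Suc M) \<alpha> \<beta>)) (q (left_ends \<beta>))) \<le> Suc M - 1"
        using degree_smult_le order_trans by blast
    qed
    \<comment> \<open>The bound is \<open>M\<close>, while there are
      \<open>n - 1 = 2 * M + 1\<close> zeros in the root count.\<close>
    ultimately have "degree p \<le> Suc M - 1" unfolding pe by (rule degree_diff_le)
    then show "degree p < n - 1" by (simp add: n_def)
  qed
  then have PR: "P x = R x" by (metis eq_iff_diff_eq_0)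
  have xn: "x \<in> chamber n" using Suc.prems(2) by (simp add: n_def)
  have "Z \<alpha> x * sq n x = R x" using P(2)[OF xn] PR by simp
  also have "R x = (\<Sum>\<beta>\<in>link_patterns (Suc M). real_of_int (M_inv (Suc M) \<alpha> \<beta>) * conformal_block (Suc M) \<beta> x) * sq n x"
    unfolding R_def sum_distrib_right
  proof (rule sum.cong[OF refl])
    fix \<beta> assume "\<beta> \<in> link_patterns (Suc M)"
    from conformal_block_sq[OF this Suc.prems(2)]
    show "real_of_int (M_inv (Suc M) \<alpha> \<beta>) * block_poly n (left_ends \<beta>) x =
        real_of_int (M_inv (Suc M) \<alpha> \<beta>) * conformal_block (Suc M) \<beta> x * sq n x"
      unfolding n_def by (simp only: mult.assoc)
  qed
  finally show ?case using sq_pos[OF xn] by simp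
qed

end
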